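(* Let $\mathcal R^{132}_n$ be the set of $n$-element 132-avoiding sorting networks and $\mathbb P_n$ the uniform probability measure on it. For $w\in\mathcal R^{132}_n$ and $0\le\alpha\le1$ let $J_w(\alpha)=\{j\in[n]:\sigma_{\lfloor\alpha N\rfloor}(j)\le\sigma_{\lfloor\alpha N\rfloor}(1)\}$ and $J^c_w(\alpha)=[n]\setminus J_w(\alpha)$. Then for all $0\le\alpha\le1$ and $\epsilon>0$, as $n\to\infty$, \[\mathbb P_n\Big(w:\max_{j\in J_w(\alpha)}\Big|\frac{\sigma_{\lfloor\alpha N\rfloor}(j)}{n}-\frac1{\sqrt2}\Big(\tilde g_\alpha\Big(\frac{-j}{n\sqrt2}\Big)-\frac{j}{n\sqrt2}\Big)\Big|>\epsilon\Big)\to0,\] and \[\mathbb P_n\Big(w:\max_{j\in J^c_w(\alpha)}\Big|\frac{\sigma_{\lfloor\alpha N\rfloor}(j)}{n}+\frac1{\sqrt2}\Big(\tilde g_{1-\alpha}\Big(\frac{-j}{n\sqrt2}\Big)-\frac{j}{n\sqrt2}\Big)-1\Big|>\epsilon\Big)\to0.\]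
   Context: $N=\binom n2$; $s_i=(i,i+1)$; $w_0\in\mathfrak S_n$ the reverse permutation. A sorting network is a word $w=w_1\cdots w_N$ over $[n-1]$ with $s_{w_1}\cdots s_{w_N}=w_0$; its intermediate permutations are $\sigma_0=\mathrm{id}$, $\sigma_k=s_{w_1}\cdots s_{w_k}$, where in one-line notation $\sigma_k$ is obtained from $\sigma_{k-1}$ by swapping the entries in positions $w_k,w_k+1$ (so $\sigma_k(j)$ is the value in position $j$). It is 132-avoiding if all $\sigma_k$ avoid the pattern 132. For $0<\alpha<1/2$ let $g_\alpha$ on $[-\sqrt{2\alpha(1-\alpha)},\sqrt{2\alpha(1-\alpha)}]$ be \[g_\alpha(u)=\frac{2u}{\pi}\tan^{-1}\Big(\frac{(1-2\alpha)u}{\sqrt{2\alpha(1-\alpha)-u^2}}\Big)+\frac{\sqrt2}{\pi}\tan^{-1}\Big(\frac{\sqrt{2(2\alpha(1-\alpha)-u^2)}}{1-2\alpha}\Big),\] and define $\tilde g_\alpha$ on $[-\sqrt2/2,\sqrt2/2]$ by $\tilde g_\alpha(u)=g_\alpha(u)$ if $|u|\le\sqrt{2\alpha(1-\alpha)}$ and $\tilde g_\alpha(u)=|u|$ otherwise; for $1/2<\alpha<1$ set $\tilde g_\alpha=\sqrt2-\tilde g_{1-\alpha}$; $\tilde g_{1/2}\equiv\sqrt2/2$; and by convention $\tilde g_0(u)=|u|$, $\tilde g_1(u)=\sqrt2-|u|$. *)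

theory Defs
  imports Complex_Main
begin

definition NN :: "nat \<Rightarrow> nat" where
  "NN n = n choose 2"

definition swp :: "nat \<Rightarrow> nat \<Rightarrow> nat \<Rightarrow> nat" where
  "swp a b j = (if j = a then b else if j = b then a else j)"

text \<open>Intermediate permutations in one-line notation: sigma_0 = id and
  sigma_k is sigma_(k-1) with the entries in positions w_k, w_k+1 swapped,
  i.e. sigma_k = sigma_(k-1) o (w_k, w_k+1).  Words are lists; letter w_k is
  the (k-1)-th list entry.\<close>
definition inter :: "nat list \<Rightarrow> nat \<Rightarrow> (nat \<Rightarrow> nat)" where
  "inter w k = foldl (\<lambda>\<sigma> i. \<sigma> \<circ> swp i (Suc i)) id (take k w)"

definition sorting_network :: "nat \<Rightarrow> nat list \<Rightarrow> bool" where
  "sorting_network n w \<longleftrightarrow>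
     length w = NN n \<and> (\<forall>i\<in>set w. 1 \<le> i \<and> i \<le> n - 1) \<and>
     (\<forall>j\<in>{1..n}. inter w (NN n) j = n + 1 - j)"

definition avoids132 :: "nat \<Rightarrow> (nat \<Rightarrow> nat) \<Rightarrow> bool" where
  "avoids132 n \<sigma> \<longleftrightarrow>
     \<not> (\<exists>i j k. 1 \<le> i \<and> i < j \<and> j < k \<and> k \<le> n \<and> \<sigma> i < \<sigma> k \<and> \<sigma> k < \<sigma> j)"

definition R132 :: "nat \<Rightarrow> nat list set" where
  "R132 n = {w. sorting_network n w \<and> (\<forall>k\<le>NN n. avoids132 n (inter w k))}"

definition Pn :: "nat \<Rightarrow> (nat list \<Rightarrow> bool) \<Rightarrow> real" where
  "Pn n P = real (card {w \<in> R132 n. P w}) / real (card (R132 n))"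

definition g :: "real \<Rightarrow> real \<Rightarrow> real" where
  "g \<alpha> u = 2 * u / pi * arctan ((1 - 2*\<alpha>) * u / sqrt (2*\<alpha>*(1-\<alpha>) - u\<^sup>2))
           + sqrt 2 / pi * arctan (sqrt (2 * (2*\<alpha>*(1-\<alpha>) - u\<^sup>2)) / (1 - 2*\<alpha>))"

text \<open>tilde g for 0 < alpha < 1/2.  On the boundary |u| = sqrt(2 alpha(1-alpha))
  the formula for g contains a division by 0; there the (continuous) value |u|
  is used, which is what the formula gives as a limit.\<close>
definition gt_low :: "real \<Rightarrow> real \<Rightarrow> real" where
  "gt_low \<alpha> u = (if \<bar>u\<bar> < sqrt (2*\<alpha>*(1-\<alpha>)) then g \<alpha> u else \<bar>u\<bar>)"

definition gt :: "real \<Rightarrow> real \<Rightarrow> real" where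
  "gt \<alpha> u =
     (if \<alpha> = 0 then \<bar>u\<bar>
      else if \<alpha> = 1 then sqrt 2 - \<bar>u\<bar>
      else if \<alpha> = 1/2 then sqrt 2 / 2
      else if \<alpha> < 1/2 then gt_low \<alpha> u
      else sqrt 2 - gt_low (1 - \<alpha>) u)"

definition Jw :: "nat \<Rightarrow> nat list \<Rightarrow> real \<Rightarrow> nat set" where
  "Jw n w \<alpha> = (let \<sigma> = inter w (nat \<lfloor>\<alpha> * real (NN n)\<rfloor>) in {j\<in>{1..n}. \<sigma> j \<le> \<sigma> 1})"

definition Jcw :: "nat \<Rightarrow> nat list \<Rightarrow> real \<Rightarrow> nat set" where
  "Jcw n w \<alpha> = {1..n} - Jw n w \<alpha>"

end

theory Submission
  imports Defs "HOL-Analysis.Analysis"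
begin

text \<open>A 132-avoiding sorting network is a growing strict partition: the letter \<open>i\<close> turns a part \<open>i - 1\<close>
  into \<open>i\<close>, the values up to \<open>\<sigma> 1\<close> are, apart from \<open>\<sigma> 1\<close> itself, the ranks of the parts, a part \<open>y\<close> sitting at
  position \<open>y + 1\<close>, and the other values increase. So both limits say that the number of parts \<open>\<ge> j\<close> at time
  \<open>\<alpha> N\<close>, divided by \<open>n\<close>, is close to a deterministic profile at \<open>j / n\<close>.

  Words reaching a shape are counted by Schur's product formula, words leaving it by the formula for
  the complementary set of parts. Replacing the time by a binomial variable with success probability \<open>p\<close>
  turns the law of the shape into a gas with weight \<open>\<Prod>W(x) \<Prod>((x - y) / (x + y))\<^sup>2\<close>. Its parts are negatively
  correlated, because \<open>1 / (x + y)\<close> is a positive kernel, so linear statistics concentrate. Moreover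
  \<open>F = \<Prod>(T + y (y + 1)) / (T + y (y - 1))\<close> satisfies the exact loop equation
  \<open>(1 - p) T E[F] - p (M (M + 1) + T) E[1 / F] = (1 - 2 p) T\<close> with \<open>M = n - 1\<close>. By concentration \<open>F\<close> at
  \<open>T = \<tau>\<^sup>2 n\<^sup>2\<close> tends to the positive root of a quadratic equation, which gives the integrals of the limiting density of
  parts against \<open>2 v / (\<tau>\<^sup>2 + v\<^sup>2)\<close> for all \<open>\<tau> > 0\<close>, and these determine it. That the claimed profile has the
  same integrals follows by differentiating in the time parameter, since its time derivative is a
  semicircle. Finally the number of large parts is monotone in time, which removes the randomization.\<close>

section \<open>Negative correlation in a discrete Coulomb gas\<close>

text \<open>The randomized law is a gas because the squared Schur factor of the complement of
  \<open>L\<close> equals that of \<open>L\<close> up to factors of single sites, so the two word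
  counts multiply to one-site weights times squared pair factors. The obstacle is to close an
  equation for \<open>F\<close>. Two coincidences do it. The weights of neighbouring sites have the
  rational ratio \<open>W x * x^2 = r * W (x - 1) * (M * (M + 1) - x * (x - 1))\<close> with
  \<open>r = p / (1 - p)\<close>, and the factor of \<open>F\<close> has its zeros and poles at
  \<open>y * (y + 1)\<close> and \<open>y * (y - 1)\<close>, up to sign, so moving a part by one
  step matches a pole of \<open>F\<close> with a pole of \<open>1 / F\<close>. What survives is the
  mean size of the shape, unknown in a general gas but exactly \<open>N * p\<close> here, since the
  size of the shape is the time. Only real \<open>T > 0\<close> occurs: with \<open>u = v^2\<close>,
  the functions \<open>1 / (1 + s * u)\<close> for \<open>s > 0\<close> already have every power of
  \<open>u\<close> in the uniform closure of their span, so no complex analysis enters. Removing the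
  randomization costs only a factor 2: a one-sided deviation is monotone in time, and the binomial
  time falls into the window where it is compared with probability at least 1/2.\<close>

definition cratio :: "nat \<Rightarrow> nat \<Rightarrow> real" where
  "cratio x y = (real x - real y) / (real x + real y)"

text \<open>By Cauchy's formula this is the determinant of \<open>2 * x / (x + y)\<close> over
  \<open>x, y\<close> in \<open>L\<close> if 0 is not in \<open>L\<close>; running over ordered
  pairs squares every unordered pair. So \<open>Zsum\<close> is an expanded determinant of identity
  plus kernel.\<close>

definition V2 :: "nat set \<Rightarrow> real" where
  "V2 L = (\<Prod>x\<in>L. \<Prod>y\<in>L - {x}. \<bar>cratio x y\<bar>)"

definition wt :: "(nat \<Rightarrow> real) \<Rightarrow> nat set \<Rightarrow> real" where
  "wt w L = V2 L * (\<Prod>x\<in>L. w x)"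

definition Zsum :: "(nat \<Rightarrow> real) \<Rightarrow> nat set \<Rightarrow> real" where
  "Zsum w S = (\<Sum>L\<in>Pow S. wt w L)"

lemma cratio_commute_abs: "\<bar>cratio x y\<bar> = \<bar>cratio y x\<bar>"
  unfolding cratio_def by (simp add: abs_minus_commute add.commute)

lemma V2_insert:
  assumes "finite L" "e \<notin> L"
  shows "V2 (insert e L) = V2 L * (\<Prod>y\<in>L. (cratio e y)\<^sup>2)"
proof -
  have "V2 (insert e L) = (\<Prod>y\<in>L. \<bar>cratio e y\<bar>) * (\<Prod>x\<in>L. \<Prod>y\<in>insert e L - {x}. \<bar>cratio x y\<bar>)"
    using assms by (simp add: V2_def)
  also have "(\<Prod>x\<in>L. \<Prod>y\<in>insert e L - {x}. \<bar>cratio x y\<bar>) = (\<Prod>x\<in>L. \<bar>cratio e x\<bar> * (\<Prod>y\<in>L - {x}. \<bar>cratio x y\<bar>))"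
  proof (rule prod.cong[OF refl])
    fix x assume "x \<in> L"
    then have "insert e L - {x} = insert e (L - {x})" using assms by auto
    then show "(\<Prod>y\<in>insert e L - {x}. \<bar>cratio x y\<bar>) = \<bar>cratio e x\<bar> * (\<Prod>y\<in>L - {x}. \<bar>cratio x y\<bar>)"
      using assms by (simp add: cratio_commute_abs)
  qed
  finally have "V2 (insert e L) = (\<Prod>y\<in>L. \<bar>cratio e y\<bar>) * (\<Prod>x\<in>L. \<bar>cratio e x\<bar> * (\<Prod>y\<in>L - {x}. \<bar>cratio x y\<bar>))" .
  moreover have "(\<Prod>y\<in>L. (cratio e y)\<^sup>2) = (\<Prod>y\<in>L. \<bar>cratio e y\<bar>) * (\<Prod>y\<in>L. \<bar>cratio e y\<bar>)"
    by (simp add: power2_eq_square flip: prod.distrib)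
  ultimately show ?thesis
    by (simp add: prod.distrib V2_def)
qed

lemma wt_insert:
  assumes "finite L" "e \<notin> L"
  shows "wt w (insert e L) = w e * wt (\<lambda>z. w z * (cratio e z)\<^sup>2) L"
  using assms by (simp add: wt_def V2_insert prod.distrib)

lemma sum_Pow_insert:
  fixes f :: "'a set \<Rightarrow> 'b::comm_monoid_add"
  assumes "finite S" "e \<notin> S"
  shows "(\<Sum>L\<in>Pow (insert e S). f L) = (\<Sum>L\<in>Pow S. f L) + (\<Sum>L\<in>Pow S. f (insert e L))"
proof -
  have inj: "inj_on (insert e) (Pow S)" using assms by (auto simp: inj_on_def)
  have "Pow S \<inter> insert e ` Pow S = {}" using assms by auto
  then show ?thesis
    unfolding Pow_insert using assms inj
    by (subst sum.union_disjoint) (auto simp: sum.reindex)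
qed

lemma Zsum_insert:
  assumes "finite S" "e \<notin> S"
  shows "Zsum w (insert e S) = Zsum w S + w e * Zsum (\<lambda>z. w z * (cratio e z)\<^sup>2) S"
proof -
  have "(\<Sum>L\<in>Pow S. wt w (insert e L)) = (\<Sum>L\<in>Pow S. w e * wt (\<lambda>z. w z * (cratio e z)\<^sup>2) L)"
    using assms by (intro sum.cong refl wt_insert) (auto intro: finite_subset)
  then show ?thesis
    unfolding Zsum_def sum_Pow_insert[OF assms] by (simp add: sum_distrib_left)
qed

lemma Zsum_empty [simp]: "Zsum w {} = 1"
  by (simp add: Zsum_def wt_def V2_def)

lemma Zsum_ge_1:
  assumes "finite S" "\<And>x. w x \<ge> 0"
  shows "Zsum w S \<ge> 1"
  using assms
proof (induction S arbitrary: w rule: finite_induct)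
  case (insert e S)
  have "Zsum (\<lambda>z. w z * (cratio e z)\<^sup>2) S \<ge> 1" using insert by simp
  then have "w e * Zsum (\<lambda>z. w z * (cratio e z)\<^sup>2) S \<ge> 0" using insert.prems by simp
  moreover have "Zsum w S \<ge> 1" using insert by simp
  ultimately show ?case using insert.hyps by (simp add: Zsum_insert)
qed simp

text \<open>The minor of the Cauchy kernel \<open>1 / (x + y)\<close> with rows \<open>x, a\<close>
  and columns \<open>y, b\<close>.\<close>

lemma cauchy_minor:
  fixes x y a b :: real
  assumes "x > 0" "y > 0" "a > 0" "b > 0"
  shows "1 / ((x+y)*(a+b)) - 1 / ((x+b)*(a+y)) = (x-a)*(y-b) / ((x+y)*(a+b)*(x+b)*(a+y))"
proof -
  have "x+y \<noteq> 0" "a+b \<noteq> 0" "x+b \<noteq> 0" "a+y \<noteq> 0" using assms by auto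
  then show ?thesis by (simp add: divide_simps) (simp add: algebra_simps)
qed

text \<open>A rank-one update of a kernel preserves the two-by-two minor formula.\<close>
lemma minor_update:
  fixes z :: real
  assumes nz: "z \<noteq> 0" "d \<noteq> 0"
    and P: "z * P = xy * ab - xb * ay"
    and Qxy: "z * Qxy = k * (xy * d - xe * ey)" and Qab: "z * Qab = k * (ab * d - ae * eb)"
    and Qxb: "z * Qxb = k * (xb * d - xe * eb)" and Qay: "z * Qay = k * (ay * d - ae * ey)"
    and R: "k * d * R = Qxy * Qab - Qxb * Qay" and k: "k \<noteq> 0"
  shows "(z + w * (k * d)) * (P + w * R) = (xy + w * Qxy) * (ab + w * Qab) - (xb + w * Qxb) * (ay + w * Qay)"
proof -
  have e: "P = (xy * ab - xb * ay) / z" "Qxy = k * (xy * d - xe * ey) / z" "Qab = k * (ab * d - ae * eb) / z"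
     "Qxb = k * (xb * d - xe * eb) / z" "Qay = k * (ay * d - ae * ey) / z"
    using P Qxy Qab Qxb Qay nz by (auto simp: field_simps)
  have R2: "R = (Qxy * Qab - Qxb * Qay) / (k * d)" using R nz k by (auto simp: field_simps)
  have R3: "R = k * (xy * ab * d - xy * ae * eb - ab * xe * ey - xb * ay * d + xb * ae * ey + ay * xe * eb) / z^2"
    unfolding R2 e using nz k
    by (simp add: divide_simps power2_eq_square) (simp add: algebra_simps)
  show ?thesis unfolding R3 e using nz
    by (simp add: divide_simps power2_eq_square) (simp add: algebra_simps)
qed

text \<open>The minor formula for the determinantal process with kernel \<open>1 / (x + y)\<close>, stated without
  determinants: inserting a site \<open>e\<close> or conditioning on \<open>e\<close> only changes the weights, by the
  factor \<open>(cratio e z)\<^sup>2\<close>, so the induction closes when the weights are arbitrary.\<close>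
lemma Zsum_minor:
  assumes "finite S" "0 \<notin> S" "\<And>z. w z \<ge> 0" "x > 0" "y > 0" "a > 0" "b > 0"
  shows "Zsum w S * (Zsum (\<lambda>z. w z * (cratio x z * cratio y z * cratio a z * cratio b z)) S *
            (1 / ((real x+real y)*(real a+real b)) - 1 / ((real x+real b)*(real a+real y)))) =
         Zsum (\<lambda>z. w z * (cratio x z * cratio y z)) S / (real x + real y) * (Zsum (\<lambda>z. w z * (cratio a z * cratio b z)) S / (real a + real b))
       - Zsum (\<lambda>z. w z * (cratio x z * cratio b z)) S / (real x + real b) * (Zsum (\<lambda>z. w z * (cratio a z * cratio y z)) S / (real a + real y))"
  using assms
proof (induction S arbitrary: w x y a b rule: finite_induct)
  case empty
  then show ?case by (simp add: field_simps)
next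
  case (insert e S)
  have e: "e > 0" "0 \<notin> S" using insert.prems by auto
  define w' where "w' = (\<lambda>z. w z * (cratio e z)\<^sup>2)"
  define Z where "Z = (\<lambda>f. Zsum (\<lambda>z. w z * f z) S)"
  define D where "D = (\<lambda>x y. Zsum (\<lambda>z. w z * (cratio x z * cratio y z)) S / (real x + real y))"
  \<comment> \<open>\<open>Q x y\<close> is the coefficient of \<open>w e\<close> in
    \<open>D x y\<close> once \<open>e\<close> is inserted: the two ratio factors leave their values
    at \<open>e\<close>, and the remaining weights become \<open>w'\<close>.\<close>
  define Q where "Q = (\<lambda>x y. cratio x e * cratio y e * Zsum (\<lambda>z. w' z * (cratio x z * cratio y z)) S / (real x + real y))"
  have w': "\<And>z. w' z \<ge> 0" using insert.prems by (simp add: w'_def)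
  have z1: "Zsum w S \<ge> 1" "Zsum w' S \<ge> 1" using insert Zsum_ge_1 w' by auto
  have Dee: "Zsum w' S = 2 * real e * D e e"
    using e by (simp add: D_def w'_def power2_eq_square)
  \<comment> \<open>The induction hypothesis at \<open>x, y, e, e\<close>: the doubled ratio to
    \<open>e\<close> is exactly the change from \<open>w\<close> to \<open>w'\<close>, so
    \<open>Q\<close> is a minor of the old entries.\<close>
  have Qe: "Zsum w S * Q x y = (2 * real e) * (D x y * D e e - D x e * D e y)" if "x > 0" "y > 0" for x y
  proof -
    have *: "1 / ((real x+real y)*(real e+real e)) - 1 / ((real x+real e)*(real e+real y))
       = cratio x e * cratio y e / ((real x + real y) * (2 * real e))"
      using that e by (subst cauchy_minor) (auto simp: cratio_def divide_simps)
    have "Zsum w S * (Zsum (\<lambda>z. w z * (cratio x z * cratio y z * cratio e z * cratio e z)) S * (cratio x e * cratio y e / ((real x + real y) * (2 * real e))))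
        = D x y * D e e - D x e * D e y"
      using insert.IH[of w x y e e] insert.prems that e unfolding * D_def by simp
    moreover have "Zsum (\<lambda>z. w z * (cratio x z * cratio y z * cratio e z * cratio e z)) S = Zsum (\<lambda>z. w' z * (cratio x z * cratio y z)) S"
      by (simp add: w'_def power2_eq_square mult_ac)
    ultimately have "Zsum w S * Q x y / (2 * real e) = D x y * D e e - D x e * D e y"
      by (simp add: Q_def mult_ac)
    then show ?thesis using e by (simp add: divide_simps mult_ac)
  qed
  let ?C = "1 / ((real x+real y)*(real a+real b)) - 1 / ((real x+real b)*(real a+real y))"
  define P where "P = Zsum (\<lambda>z. w z * (cratio x z * cratio y z * cratio a z * cratio b z)) S * ?C"
  define R where "R = cratio x e * cratio y e * cratio a e * cratio b e * Zsum (\<lambda>z. w' z * (cratio x z * cratio y z * cratio a z * cratio b z)) S * ?C"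
  have hP: "Zsum w S * P = D x y * D a b - D x b * D a y"
    using insert.IH[of w x y a b] insert.prems e unfolding P_def D_def by simp
  have hR0: "Zsum w' S * (Zsum (\<lambda>z. w' z * (cratio x z * cratio y z * cratio a z * cratio b z)) S * ?C) =
     Zsum (\<lambda>z. w' z * (cratio x z * cratio y z)) S / (real x + real y) * (Zsum (\<lambda>z. w' z * (cratio a z * cratio b z)) S / (real a + real b))
       - Zsum (\<lambda>z. w' z * (cratio x z * cratio b z)) S / (real x + real b) * (Zsum (\<lambda>z. w' z * (cratio a z * cratio y z)) S / (real a + real y))"
    using insert.IH[of w' x y a b] insert.prems e w' by simp
  have hR: "2 * real e * D e e * R = Q x y * Q a b - Q x b * Q a y"
  proof -
    have "2 * real e * D e e * R = (cratio x e * cratio y e * cratio a e * cratio b e) * (Zsum w' S * (Zsum (\<lambda>z. w' z * (cratio x z * cratio y z * cratio a z * cratio b z)) S * ?C))"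
      unfolding R_def Dee by (simp add: mult_ac)
    then show ?thesis unfolding hR0 Q_def by (simp add: algebra_simps)
  qed
  have main: "(Zsum w S + w e * (2 * real e * D e e)) * (P + w e * R)
     = (D x y + w e * Q x y) * (D a b + w e * Q a b) - (D x b + w e * Q x b) * (D a y + w e * Q a y)"
  proof (rule minor_update[where k = "2 * real e" and d = "D e e" and xe = "D x e" and ey = "D e y" and ae = "D a e" and eb = "D e b"])
    show "Zsum w S \<noteq> 0" "D e e \<noteq> 0" using z1 Dee by auto
    show "2 * real e \<noteq> 0" using e by simp
  qed (use hP hR Qe insert.prems in auto)
  have i0: "Zsum w (insert e S) = Zsum w S + w e * (2 * real e * D e e)"
    using insert.hyps by (simp add: Zsum_insert flip: Dee w'_def)
  have i2: "Zsum (\<lambda>z. w z * (cratio x z * cratio y z)) (insert e S) / (real x + real y) = D x y + w e * Q x y" for x y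
  proof -
    have "(\<lambda>z. w z * (cratio x z * cratio y z) * (cratio e z)\<^sup>2) = (\<lambda>z. w' z * (cratio x z * cratio y z))"
      by (simp add: w'_def mult_ac)
    then show ?thesis using insert.hyps by (simp add: Zsum_insert D_def Q_def add_divide_distrib mult_ac)
  qed
  have i4: "Zsum (\<lambda>z. w z * (cratio x z * cratio y z * cratio a z * cratio b z)) (insert e S) * ?C = P + w e * R"
  proof -
    have "(\<lambda>z. w z * (cratio x z * cratio y z * cratio a z * cratio b z) * (cratio e z)\<^sup>2) = (\<lambda>z. w' z * (cratio x z * cratio y z * cratio a z * cratio b z))"
      by (simp add: w'_def mult_ac)
    note eq = this
    have *: "Zsum (\<lambda>z. w z * (cratio x z * cratio y z * cratio a z * cratio b z)) (insert e S) =
        Zsum (\<lambda>z. w z * (cratio x z * cratio y z * cratio a z * cratio b z)) S +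
        w e * (cratio x e * cratio y e * cratio a e * cratio b e * Zsum (\<lambda>z. w' z * (cratio x z * cratio y z * cratio a z * cratio b z)) S)"
      unfolding Zsum_insert[OF insert.hyps(1,2)] eq by (simp only: mult.assoc)
    show ?thesis unfolding P_def R_def * by (simp only: distrib_right mult.assoc)
  qed
  show ?case unfolding i0 i2 i4 using main .
qed

text \<open>\<open>Zsum_minor\<close> with rows and columns both \<open>x, y\<close>: by symmetry of
  the kernel the subtracted product is the square of the off-diagonal entry, hence nonnegative, and
  may be dropped.\<close>

lemma Zsum_neg_corr:
  assumes "finite S" "0 \<notin> S" "\<And>z. w z \<ge> 0" "x > 0" "y > 0"
  shows "(cratio x y)\<^sup>2 * Zsum w S * Zsum (\<lambda>z. w z * (cratio x z)\<^sup>2 * (cratio y z)\<^sup>2) S \<le> Zsum (\<lambda>z. w z * (cratio x z)\<^sup>2) S * Zsum (\<lambda>z. w z * (cratio y z)\<^sup>2) S"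
proof -
  let ?A = "Zsum (\<lambda>z. w z * (cratio x z)\<^sup>2) S * Zsum (\<lambda>z. w z * (cratio y z)\<^sup>2) S"
  let ?Q = "Zsum (\<lambda>z. w z * (cratio x z * cratio y z)) S / (real x + real y)"
  let ?B = "Zsum w S * Zsum (\<lambda>z. w z * (cratio x z)\<^sup>2 * (cratio y z)\<^sup>2) S"
  have e: "1 / ((real x+real x)*(real y+real y)) - 1 / ((real x+real y)*(real y+real x)) = (cratio x y)\<^sup>2 / (4 * real x * real y)"
  proof -
    have p: "real x > 0" "real y > 0" using assms by auto
    have s: "(cratio x y)\<^sup>2 = (real x - real y)\<^sup>2 / (real x + real y)\<^sup>2" by (simp add: cratio_def power_divide)
    have n: "real x + real y \<noteq> 0" "real x \<noteq> 0" "real y \<noteq> 0" "real y + real x \<noteq> 0" using p by auto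
    show ?thesis unfolding cauchy_minor[OF p(1,1,2,2)] s using n
      by (simp add: divide_simps power2_eq_square)
  qed
  have "?B * ((cratio x y)\<^sup>2 / (4 * real x * real y)) = ?A / (4 * real x * real y) - ?Q * ?Q"
    using Zsum_minor[OF assms(1,2), of w x x y y] assms unfolding e
    by (simp add: power2_eq_square mult_ac add.commute)
  also have "\<dots> \<le> ?A / (4 * real x * real y)" by simp
  finally have "(?B * (cratio x y)\<^sup>2) / (4 * real x * real y) \<le> ?A / (4 * real x * real y)" by simp
  then have "?B * (cratio x y)\<^sup>2 \<le> ?A" using assms by (subst (asm) divide_le_cancel) auto
  then show ?thesis by (simp add: mult_ac)
qed

lemma wt_neg_corr:
  assumes S: "finite S" "0 \<notin> S" and w: "\<And>z. w z \<ge> 0" and xy: "x \<in> S" "y \<in> S" "x \<noteq> y"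
  shows "(\<Sum>L\<in>Pow S. wt w L) * (\<Sum>L | L \<subseteq> S \<and> x \<in> L \<and> y \<in> L. wt w L) \<le>
     (\<Sum>L | L \<subseteq> S \<and> x \<in> L. wt w L) * (\<Sum>L | L \<subseteq> S \<and> y \<in> L. wt w L)"
proof -
  define T where "T = S - {x,y}"
  have T: "finite T" "0 \<notin> T" "x \<notin> T" "y \<notin> T" "x \<notin> insert y T" and SE: "S = insert x (insert y T)"
    using S xy by (auto simp: T_def)
  have x0: "x > 0" "y > 0" using S xy by (auto intro: Nat.gr0I)
  let ?A = "Zsum w T" and ?B = "w x * Zsum (\<lambda>z. w z * (cratio x z)\<^sup>2) T" and ?C = "w y * Zsum (\<lambda>z. w z * (cratio y z)\<^sup>2) T"
    and ?D = "w x * w y * (cratio x y)\<^sup>2 * Zsum (\<lambda>z. w z * (cratio x z)\<^sup>2 * (cratio y z)\<^sup>2) T"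
  have wtx: "(\<Sum>L\<in>Pow T. wt w (insert x L)) = ?B" "(\<Sum>L\<in>Pow T. wt w (insert y L)) = ?C"
    using T by (auto simp: Zsum_def sum_distrib_left intro!: sum.cong wt_insert intro: finite_subset)
  have wtxy: "(\<Sum>L\<in>Pow T. wt w (insert x (insert y L))) = ?D"
    unfolding Zsum_def sum_distrib_left
  proof (rule sum.cong[OF refl])
    fix L assume "L \<in> Pow T"
    then have "finite L" "y \<notin> L" "x \<notin> insert y L" using T by (auto intro: finite_subset)
    then show "wt w (insert x (insert y L)) = w x * w y * (cratio x y)\<^sup>2 * wt (\<lambda>z. w z * (cratio x z)\<^sup>2 * (cratio y z)\<^sup>2) L"
      by (simp add: wt_insert)
  qed
  have sp: "(\<Sum>L\<in>Pow S. f L) = (\<Sum>L\<in>Pow T. f L) + (\<Sum>L\<in>Pow T. f (insert y L)) + (\<Sum>L\<in>Pow T. f (insert x L)) + (\<Sum>L\<in>Pow T. f (insert x (insert y L)))"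
    for f :: "nat set \<Rightarrow> real"
    unfolding SE using T by (simp add: sum_Pow_insert)
  have flt: "(\<Sum>L | L \<subseteq> S \<and> Q L. wt w L) = (\<Sum>L\<in>Pow S. if Q L then wt w L else 0)" for Q
    using S by (auto simp: sum.If_cases Pow_def Collect_conj_eq)
  have z0: "(\<Sum>L\<in>Pow T. if z \<in> L \<and> Q L then wt w L else 0) = 0" if "z \<notin> T" for Q z
    using that by (intro sum.neutral) auto
  have 0: "(\<Sum>L\<in>Pow S. wt w L) = ?A + ?C + ?B + ?D" 
    unfolding sp wtx wtxy by (simp add: Zsum_def)
  have nx: "(\<Sum>L\<in>Pow T. if x \<in> L then f L else 0) = 0" "(\<Sum>L\<in>Pow T. if y \<in> L then f L else 0) = 0"
     "(\<Sum>L\<in>Pow T. if x \<in> L \<and> Q L then f L else 0) = 0" "(\<Sum>L\<in>Pow T. if Q L \<and> y \<in> L then f L else 0) = 0" 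
    for f :: "nat set \<Rightarrow> real" and Q
    using T by (auto intro!: sum.neutral)
  have 1: "(\<Sum>L | L \<subseteq> S \<and> x \<in> L. wt w L) = ?B + ?D"
    unfolding flt sp using xy by (simp add: nx wtx wtxy)
  have 2: "(\<Sum>L | L \<subseteq> S \<and> y \<in> L. wt w L) = ?C + ?D"
    unfolding flt sp using xy by (simp add: nx wtx wtxy)
  have 3: "(\<Sum>L | L \<subseteq> S \<and> x \<in> L \<and> y \<in> L. wt w L) = ?D"
    unfolding flt sp using xy by (simp add: nx wtx wtxy)
  \<comment> \<open>\<open>?A\<close>, \<open>?B\<close>, \<open>?C\<close>, \<open>?D\<close> are
    the masses of the subsets containing neither point, only \<open>x\<close>, only
    \<open>y\<close>, or both; the claim \<open>(A + B + C + D) * D \<le> (B + D) * (C + D)\<close>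
    reduces to this.\<close>
  have "?A * ?D \<le> ?B * ?C"
  proof -
    have "(w x * w y) * ((cratio x y)\<^sup>2 * Zsum w T * Zsum (\<lambda>z. w z * (cratio x z)\<^sup>2 * (cratio y z)\<^sup>2) T)
        \<le> (w x * w y) * (Zsum (\<lambda>z. w z * (cratio x z)\<^sup>2) T * Zsum (\<lambda>z. w z * (cratio y z)\<^sup>2) T)"
      using w by (intro mult_left_mono Zsum_neg_corr T x0) auto
    then show ?thesis by (simp add: mult_ac)
  qed
  then show ?thesis unfolding 0 1 2 3 by (simp add: algebra_simps)
qed

section \<open>The loop equation\<close>

text \<open>The residue at \<open>t = - a x\<close> of the product of
  \<open>(t + b y) / (t + a y)\<close> over \<open>y\<close> in \<open>S\<close>.\<close>

definition pf_coeff :: "('i \<Rightarrow> real) \<Rightarrow> ('i \<Rightarrow> real) \<Rightarrow> 'i set \<Rightarrow> 'i \<Rightarrow> real" where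
  "pf_coeff a b S x = (b x - a x) * (\<Prod>y\<in>S - {x}. (b y - a x) / (a y - a x))"

lemma pf_coeff_insert:
  assumes "finite S" "e \<notin> S" "x \<in> S"
  shows "pf_coeff a b (insert e S) x = pf_coeff a b S x * ((b e - a x) / (a e - a x))"
proof -
  have "insert e S - {x} = insert e (S - {x})" using assms by auto
  then show ?thesis using assms by (simp add: pf_coeff_def)
qed

text \<open>The second claim is the coefficient of \<open>1 / t\<close> at infinity. Both go through
  one induction: the residue at an inserted \<open>e\<close> is the product formula for
  \<open>S\<close> evaluated at \<open>t = - a e\<close>, and the new sum of residues needs that
  value.\<close>

lemma partial_fractions_aux:
  fixes a b :: "'i \<Rightarrow> real"
  assumes "finite S" "inj_on a S"
  shows "(\<forall>t. (\<forall>x\<in>S. t + a x \<noteq> 0) \<longrightarrow>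
           (\<Prod>y\<in>S. (t + b y) / (t + a y)) = 1 + (\<Sum>x\<in>S. pf_coeff a b S x / (t + a x)))
       \<and> (\<Sum>x\<in>S. pf_coeff a b S x) = (\<Sum>x\<in>S. b x - a x)"
  using assms
proof (induction S rule: finite_induct)
  case (insert e S)
  define d where "d = b e - a e"
  define c where "c = pf_coeff a b S"
  define s where "s = (\<Sum>x\<in>S. c x / (a e - a x))"
  have ne: "a e - a x \<noteq> 0" if "x \<in> S" for x
    using insert.prems insert.hyps that by (auto simp: inj_on_def)
  have IH1: "(\<Prod>y\<in>S. (t + b y) / (t + a y)) = 1 + (\<Sum>x\<in>S. c x / (t + a x))" if "\<forall>x\<in>S. t + a x \<noteq> 0" for t
    using insert that by (auto simp: c_def)
  have IH2: "(\<Sum>x\<in>S. c x) = (\<Sum>x\<in>S. b x - a x)"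
    using insert by (auto simp: c_def)
  have ce: "pf_coeff a b (insert e S) e = d * (1 - s)"
  proof -
    have "(\<Prod>y\<in>S. (b y - a e) / (a y - a e)) = (\<Prod>y\<in>S. (- a e + b y) / (- a e + a y))"
      by (simp add: add.commute)
    also have "\<dots> = 1 + (\<Sum>x\<in>S. c x / (- a e + a x))"
      using ne by (intro IH1) force
    also have "(\<Sum>x\<in>S. c x / (- a e + a x)) = - s"
      unfolding s_def sum_negf[symmetric] by (intro sum.cong refl) (metis minus_diff_eq minus_divide_right uminus_add_conv_diff)
    finally show ?thesis using insert.hyps by (simp add: pf_coeff_def d_def)
  qed
  have coeff: "pf_coeff a b (insert e S) x = c x + d * (c x / (a e - a x))" if "x \<in> S" for x
    using ne[OF that] insert.hyps that unfolding c_def d_def by (simp add: pf_coeff_insert field_simps)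
  have "(\<Sum>x\<in>insert e S. pf_coeff a b (insert e S) x) = (\<Sum>x\<in>insert e S. b x - a x)"
  proof -
    have "(\<Sum>x\<in>S. pf_coeff a b (insert e S) x) = (\<Sum>x\<in>S. c x) + d * s"
      by (simp add: coeff sum.distrib s_def sum_distrib_left)
    then show ?thesis using insert.hyps by (simp add: ce IH2 algebra_simps) (simp add: d_def)
  qed
  moreover have "(\<Prod>y\<in>insert e S. (t + b y) / (t + a y)) = 1 + (\<Sum>x\<in>insert e S. pf_coeff a b (insert e S) x / (t + a x))"
    if t: "\<forall>x\<in>insert e S. t + a x \<noteq> 0" for t
  proof -
    have te: "t + a e \<noteq> 0" using t by simp
    have x: "pf_coeff a b (insert e S) x / (t + a x) = (c x / (t + a x)) * ((t + b e) / (t + a e)) + d * (c x / (a e - a x)) / (t + a e)"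
      if "x \<in> S" for x
    proof -
      have "t + a x \<noteq> 0" using t that by simp
      then show ?thesis using te ne[OF that] unfolding coeff[OF that] d_def
        by (simp add: divide_simps) (simp add: algebra_simps)
    qed
    have "(\<Sum>x\<in>insert e S. pf_coeff a b (insert e S) x / (t + a x))
        = d * (1 - s) / (t + a e) + ((\<Sum>x\<in>S. c x / (t + a x)) * ((t + b e) / (t + a e)) + d * s / (t + a e))"
      using insert.hyps by (simp add: ce x sum.distrib sum_distrib_right sum_distrib_left s_def sum_divide_distrib)
    moreover have "(\<Prod>y\<in>insert e S. (t + b y) / (t + a y)) = ((t + b e) / (t + a e)) * (1 + (\<Sum>x\<in>S. c x / (t + a x)))"
      using insert.hyps t by (simp add: IH1)
    moreover have "(t + b e) / (t + a e) = 1 + d / (t + a e)" using te by (simp add: d_def field_simps)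
    ultimately show ?thesis by (simp add: algebra_simps diff_divide_distrib add_divide_distrib)
  qed
  ultimately show ?case by blast
qed simp

lemmas partial_fractions = partial_fractions_aux[THEN conjunct1, rule_format]
  and sum_pf_coeff = partial_fractions_aux[THEN conjunct2]

definition lo :: "nat \<Rightarrow> real" where "lo y = real y * (real y - 1)"
definition hi :: "nat \<Rightarrow> real" where "hi y = real y * (real y + 1)"

text \<open>Since \<open>lo (Suc y) = hi y\<close>, consecutive parts telescope, and the pole that a
  part \<open>x\<close> gives to \<open>Fratio\<close> is the pole that a part \<open>x - 1\<close>
  gives to its reciprocal.\<close>

definition Fratio :: "real \<Rightarrow> nat set \<Rightarrow> real" where
  "Fratio T L = (\<Prod>y\<in>L. (T + hi y) / (T + lo y))"

lemma hi_minus_lo: "hi y - lo y = 2 * real y"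
  by (simp add: hi_def lo_def algebra_simps)

lemma lo_nonneg: "lo y \<ge> 0"
  by (cases y) (simp_all add: lo_def)

lemma hi_nonneg: "hi y \<ge> 0"
  by (simp add: hi_def)

lemma lo_Suc: "lo (Suc y) = hi y"
  by (simp add: lo_def hi_def algebra_simps)

lemma inj_hi: "inj_on hi S"
proof -
  have "strict_mono hi" unfolding strict_mono_Suc_iff by (simp add: hi_def algebra_simps)
  then show ?thesis by (meson inj_on_subset strict_mono_imp_inj_on subset_UNIV)
qed

lemma inj_lo: "0 \<notin> S \<Longrightarrow> inj_on lo S"
proof (rule inj_onI)
  fix x y assume *: "0 \<notin> S" "x \<in> S" "y \<in> S" "lo x = lo y"
  then obtain x' y' where "x = Suc x'" "y = Suc y'" by (metis not0_implies_Suc)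
  then show "x = y" using * inj_hi[of UNIV] by (simp add: lo_Suc inj_on_def)
qed

text \<open>At each pole, \<open>T / (T + lo x) = 1 - lo x / (T + lo x)\<close> and
  \<open>(m + T) / (T + hi x) = 1 + (m - hi x) / (T + hi x)\<close>. The constant parts add up to
  the residue sums, which are plus and minus twice the size of \<open>L\<close>; so the size is the
  only statistic outside the poles.\<close>

lemma pole_expansion:
  assumes "finite L" "0 \<notin> L" "T > 0"
  shows "T * Fratio T L - r * (m + T) / Fratio T L = (1 - r) * T - r * m + 2 * (1 + r) * (\<Sum>x\<in>L. real x)
     - (\<Sum>x\<in>L. pf_coeff lo hi L x * lo x / (T + lo x)) + r * (\<Sum>x\<in>L. (- pf_coeff hi lo L x) * (m - hi x) / (T + hi x))"
proof -
  have n1: "T + lo x \<noteq> 0" and n2: "T + hi x \<noteq> 0" for x using assms lo_nonneg[of x] hi_nonneg[of x] by auto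
  have F1: "Fratio T L = 1 + (\<Sum>x\<in>L. pf_coeff lo hi L x / (T + lo x))"
    unfolding Fratio_def using n1 assms inj_lo by (intro partial_fractions) auto
  have "inverse (Fratio T L) = (\<Prod>y\<in>L. (T + lo y) / (T + hi y))"
    unfolding Fratio_def by (simp flip: prod_inversef)
  then have F2: "inverse (Fratio T L) = 1 + (\<Sum>x\<in>L. pf_coeff hi lo L x / (T + hi x))"
    using n2 assms inj_hi by (simp add: partial_fractions)
  have s1: "(\<Sum>x\<in>L. pf_coeff lo hi L x) = 2 * (\<Sum>x\<in>L. real x)"
    using assms inj_lo by (simp add: sum_pf_coeff hi_minus_lo sum_distrib_left)
  have "lo y - hi y = - 2 * real y" for y using hi_minus_lo[of y] by simp
  then have s2: "(\<Sum>x\<in>L. pf_coeff hi lo L x) = - 2 * (\<Sum>x\<in>L. real x)"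
    using assms inj_hi by (simp add: sum_pf_coeff sum_distrib_left sum_negf)
  have "T * (\<Sum>x\<in>L. pf_coeff lo hi L x / (T + lo x)) = (\<Sum>x\<in>L. pf_coeff lo hi L x - pf_coeff lo hi L x * lo x / (T + lo x))"
    unfolding sum_distrib_left using n1 by (intro sum.cong refl) (simp add: field_simps)
  also have "\<dots> = 2 * (\<Sum>x\<in>L. real x) - (\<Sum>x\<in>L. pf_coeff lo hi L x * lo x / (T + lo x))"
    by (simp add: sum_subtractf s1)
  finally have e1: "T * Fratio T L = T + 2 * (\<Sum>x\<in>L. real x) - (\<Sum>x\<in>L. pf_coeff lo hi L x * lo x / (T + lo x))"
    by (simp add: F1 algebra_simps)
  have "(m + T) * (\<Sum>x\<in>L. pf_coeff hi lo L x / (T + hi x)) = (\<Sum>x\<in>L. pf_coeff hi lo L x - (- pf_coeff hi lo L x) * (m - hi x) / (T + hi x))"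
    unfolding sum_distrib_left using n2 by (intro sum.cong refl) (simp add: divide_simps, simp add: algebra_simps)
  also have "\<dots> = - 2 * (\<Sum>x\<in>L. real x) - (\<Sum>x\<in>L. (- pf_coeff hi lo L x) * (m - hi x) / (T + hi x))"
    by (simp only: sum_subtractf s2)
  finally have e2: "(m + T) / Fratio T L = m + T - 2 * (\<Sum>x\<in>L. real x) - (\<Sum>x\<in>L. (- pf_coeff hi lo L x) * (m - hi x) / (T + hi x))"
    by (simp add: F2 divide_inverse distrib_left)
  have "T * Fratio T L - r * (m + T) / Fratio T L = T * Fratio T L - r * ((m + T) / Fratio T L)" by simp
  then show ?thesis unfolding e1 e2 by (simp add: algebra_simps)
qed

lemma wt_mult:
  "wt (\<lambda>z. w z * f z) L = wt w L * (\<Prod>z\<in>L. f z)"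
  by (simp add: wt_def prod.distrib)

text \<open>Up to \<open>2 * x\<close>, a residue is the quotient of the interactions that the rest
  \<open>U\<close> has with \<open>x - 1\<close> and with \<open>x\<close>. Against the squared
  interaction in \<open>wt\<close> it exchanges one of the two equal factors.\<close>

lemma pf_coeff_ratio:
  assumes "finite U" "x \<ge> 2" "x \<notin> U" "x - 1 \<notin> U" "0 \<notin> U"
  shows "pf_coeff lo hi (insert x U) x = 2 * real x * (\<Prod>y\<in>U. cratio (x - 1) y / cratio x y)"
    and "- pf_coeff hi lo (insert (x - 1) U) (x - 1) = 2 * real (x - 1) * (\<Prod>y\<in>U. cratio x y / cratio (x - 1) y)"
proof -
  obtain k where k: "x = Suc k" "k > 0" using assms by (cases x) auto
  have f: "(hi y - hi k) / (lo y - hi k) = cratio k y / cratio (Suc k) y"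
      and f': "(lo y - hi k) / (hi y - hi k) = cratio (Suc k) y / cratio k y" if "y \<in> U" for y
  proof -
    have "y \<noteq> k" "y \<noteq> Suc k" "y > 0" using that assms k by (auto intro: Nat.gr0I)
    then have n: "real y \<noteq> real k" "real y \<noteq> real k + 1" "real k + real y \<noteq> 0" "1 + real k + real y \<noteq> 0"
      by (auto simp flip: of_nat_Suc)
    have h: "hi y - hi k = (real y - real k) * (1 + real k + real y)" "lo y - hi k = (real y - 1 - real k) * (real k + real y)"
      by (simp_all add: hi_def lo_def algebra_simps)
    show "(hi y - hi k) / (lo y - hi k) = cratio k y / cratio (Suc k) y" "(lo y - hi k) / (hi y - hi k) = cratio (Suc k) y / cratio k y"
      unfolding h cratio_def using n by (simp_all add: divide_simps) (simp_all add: algebra_simps)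
  qed
  show "pf_coeff lo hi (insert x U) x = 2 * real x * (\<Prod>y\<in>U. cratio (x - 1) y / cratio x y)"
  proof -
    have "(\<Prod>y\<in>U. (hi y - lo x) / (lo y - lo x)) = (\<Prod>y\<in>U. cratio (x - 1) y / cratio x y)"
      using f by (intro prod.cong refl) (simp add: k lo_Suc)
    then show ?thesis using assms by (simp add: pf_coeff_def hi_minus_lo)
  qed
  show "- pf_coeff hi lo (insert (x - 1) U) (x - 1) = 2 * real (x - 1) * (\<Prod>y\<in>U. cratio x y / cratio (x - 1) y)"
  proof -
    have "lo k - hi k = - (2 * real k)" using hi_minus_lo[of k] by simp
    then show ?thesis using assms f' by (simp add: pf_coeff_def k cong: prod.cong)
  qed
qed

lemma pf_coeff_zero:
  assumes "finite L" "x \<in> L" "y \<in> L" "y \<noteq> x" "b y = a x"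
  shows "pf_coeff a b L x = 0"
  using assms unfolding pf_coeff_def by (auto intro!: bexI[of _ y])

text \<open>Moving a part \<open>x\<close> of \<open>L\<close> to \<open>x - 1\<close> pairs the poles of the two sides at \<open>lo x = hi (x - 1)\<close>.\<close>
lemma loop_cancel:
  fixes w :: "nat \<Rightarrow> real" and M :: nat
  assumes w: "\<And>x. 2 \<le> x \<Longrightarrow> x \<le> M \<Longrightarrow> w x * (real x)\<^sup>2 = r * w (x - 1) * (real M * (real M + 1) - lo x)"
  shows "(\<Sum>L\<in>Pow {1..M}. wt w L * (\<Sum>x\<in>L. pf_coeff lo hi L x * lo x / (T + lo x)))
       = (\<Sum>L\<in>Pow {1..M}. wt w L * (r * (\<Sum>x\<in>L. (- pf_coeff hi lo L x) * (real M * (real M + 1) - hi x) / (T + hi x))))"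
proof -
  define A where "A = {(L,x). L \<subseteq> {1..M} \<and> x \<in> L \<and> 2 \<le> x \<and> x - 1 \<notin> L}"
  define B where "B = {(L,x). L \<subseteq> {1..M} \<and> x \<in> L \<and> x < M \<and> Suc x \<notin> L}"
  define f where "f = (\<lambda>(L,x). wt w L * (pf_coeff lo hi L x * lo x / (T + lo x)))"
  define h where "h = (\<lambda>(L,x). wt w L * (r * ((- pf_coeff hi lo L x) * (real M * (real M + 1) - hi x) / (T + hi x))))"
  have fin: "finite L" if "L \<subseteq> {1..M}" for L using that finite_subset by blast
  have "(\<Sum>L\<in>Pow {1..M}. wt w L * (\<Sum>x\<in>L. pf_coeff lo hi L x * lo x / (T + lo x))) = (\<Sum>z\<in>Sigma (Pow {1..M}) (\<lambda>L. L). f z)"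
    unfolding sum_distrib_left f_def by (subst sum.Sigma) (auto intro: finite_subset[OF _ finite_atLeastAtMost])
  \<comment> \<open>Only parts that can move down contribute: the pole of the part 1 is killed by
    \<open>lo 1 = 0\<close>, that of \<open>x\<close> with \<open>x - 1\<close> in \<open>L\<close>
    by the zero \<open>hi (x - 1) = lo x\<close> of the numerator.\<close>
  also have "\<dots> = sum f A"
  proof (rule sum.mono_neutral_right)
    show "finite (Sigma (Pow {1..M}) (\<lambda>L. L))" by (intro finite_SigmaI) (auto intro: finite_subset[OF _ finite_atLeastAtMost])
    show "\<forall>i\<in>Sigma (Pow {1..M}) (\<lambda>L. L) - A. f i = 0"
    proof
      fix i assume "i \<in> Sigma (Pow {1..M}) (\<lambda>L. L) - A"
      then obtain L x where i: "i = (L,x)" "L \<subseteq> {1..M}" "x \<in> L" "\<not> (2 \<le> x \<and> x - 1 \<notin> L)" by (auto simp: A_def)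
      have "x \<ge> 1" using i by auto
      consider "x = 1" | "x \<ge> 2" "x - 1 \<in> L" using i \<open>x \<ge> 1\<close> by force
      then show "f i = 0"
      proof cases
        case 1 then show ?thesis by (simp add: i f_def lo_def)
      next
        case 2
        then have "hi (x - 1) = lo x" by (simp add: hi_def lo_def)
        then show ?thesis using 2 i pf_coeff_zero[of L x "x - 1" hi lo] fin by (simp add: f_def)
      qed
    qed
  qed (auto simp: A_def)
  also have "\<dots> = sum h B"
  proof (rule sum.reindex_bij_witness[of _ "\<lambda>(L,x). (insert (Suc x) (L - {x}), Suc x)" "\<lambda>(L,x). (insert (x-1) (L - {x}), x - 1)"], goal_cases)
    case (5 z)
    then obtain L x where z: "z = (L,x)" "L \<subseteq> {1..M}" "x \<in> L" "2 \<le> x" "x - 1 \<notin> L" by (auto simp: A_def)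
    define U where "U = L - {x}"
    have U: "finite U" "x \<notin> U" "x - 1 \<notin> U" "0 \<notin> U" and L: "L = insert x U" using z fin by (auto simp: U_def)
    have nz: "cratio x y \<noteq> 0" "cratio (x - 1) y \<noteq> 0" if "y \<in> U" for y
    proof -
      have "real y \<noteq> real x" "real (x - 1) \<noteq> real y" using U that unfolding of_nat_eq_iff by auto
      moreover have "real x + real y \<noteq> 0" "real (x - 1) + real y \<noteq> 0" using z(4) by auto
      ultimately show "cratio x y \<noteq> 0" "cratio (x - 1) y \<noteq> 0" unfolding cratio_def by auto
    qed
    have xM: "x \<le> M" using z by auto
    define m where "m = real M * (real M + 1)"
    have lx: "hi (x - 1) = lo x" using z(4) by (simp add: hi_def lo_def)
    \<comment> \<open>The common value of both weighted residues: a square at \<open>x\<close>, or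
      at \<open>x - 1\<close>, has one factor exchanged for the other site.\<close>
    define pp where "pp = (\<Prod>y\<in>U. cratio x y * cratio (x - 1) y)"
    have p1: "(\<Prod>y\<in>U. (cratio x y)\<^sup>2) * (\<Prod>y\<in>U. cratio (x - 1) y / cratio x y) = pp"
      unfolding pp_def prod.distrib[symmetric] using nz by (intro prod.cong refl) (simp add: power2_eq_square)
    have p2: "(\<Prod>y\<in>U. (cratio (x - 1) y)\<^sup>2) * (\<Prod>y\<in>U. cratio x y / cratio (x - 1) y) = pp"
      unfolding pp_def prod.distrib[symmetric] using nz by (intro prod.cong refl) (simp add: power2_eq_square)
    have "f z = w x * (wt w U * (\<Prod>y\<in>U. (cratio x y)\<^sup>2)) * (2 * real x * (\<Prod>y\<in>U. cratio (x - 1) y / cratio x y) * lo x / (T + lo x))"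
      using U z(4) unfolding f_def z L by (simp add: wt_insert wt_mult pf_coeff_ratio)
    also have "\<dots> = 2 * wt w U * (w x * real x * lo x) / (T + lo x) * ((\<Prod>y\<in>U. (cratio x y)\<^sup>2) * (\<Prod>y\<in>U. cratio (x - 1) y / cratio x y))"
      by simp
    also have "\<dots> = 2 * wt w U * (w x * real x * lo x) / (T + lo x) * pp" unfolding p1 ..
    also have "w x * real x * lo x = w x * (real x)\<^sup>2 * (real x - 1)"
      by (simp add: lo_def power2_eq_square)
    also have "\<dots> = r * w (x - 1) * (m - lo x) * (real x - 1)"
      using w[OF z(4) xM] by (simp add: m_def)
    finally have f1: "f z = 2 * wt w U * (r * w (x - 1) * (m - lo x) * (real x - 1)) / (T + lo x) * pp" .
    have "h (insert (x-1) U, x - 1) = w (x-1) * (wt w U * (\<Prod>y\<in>U. (cratio (x - 1) y)\<^sup>2)) *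
        (r * (2 * real (x - 1) * (\<Prod>y\<in>U. cratio x y / cratio (x - 1) y) * (m - lo x) / (T + lo x)))"
    proof -
      have W: "wt w (insert (x-1) U) = w (x-1) * (wt w U * (\<Prod>y\<in>U. (cratio (x - 1) y)\<^sup>2))"
        using U by (simp add: wt_insert wt_mult)
      show ?thesis
        unfolding h_def split_conv W pf_coeff_ratio(2)[OF U(1) z(4) U(2-4)] lx m_def[symmetric] ..
    qed
    also have "\<dots> = 2 * wt w U * (r * w (x - 1) * (m - lo x) * (real x - 1)) / (T + lo x) * ((\<Prod>y\<in>U. (cratio (x - 1) y)\<^sup>2) * (\<Prod>y\<in>U. cratio x y / cratio (x - 1) y))"
      using z(4) by (simp add: of_nat_diff)
    finally have "h (insert (x-1) U, x - 1) = f z" unfolding f1 p2 .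
    then show ?case by (simp add: z U_def)
  next
    case (2 z)
    then obtain L x where z: "z = (L,x)" "L \<subseteq> {1..M}" "x \<in> L" "2 \<le> x" "x - 1 \<notin> L" by (auto simp: A_def)
    then obtain k where k: "x = Suc k" "k \<ge> 1" by (cases x) auto
    have "x \<le> M" using z by auto
    then show ?case using z k by (auto simp: B_def)
  qed (auto simp: A_def B_def)
  \<comment> \<open>A part \<open>M\<close> drops out because \<open>M * (M + 1) - hi M = 0\<close>,
    so no move leaves \<open>{1..M}\<close>; a part below an occupied site drops out as
    before.\<close>
  also have "\<dots> = (\<Sum>z\<in>Sigma (Pow {1..M}) (\<lambda>L. L). h z)"
  proof (rule sum.mono_neutral_left)
    show "finite (Sigma (Pow {1..M}) (\<lambda>L. L))" by (intro finite_SigmaI) (auto intro: finite_subset[OF _ finite_atLeastAtMost])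
    show "\<forall>i\<in>Sigma (Pow {1..M}) (\<lambda>L. L) - B. h i = 0"
    proof
      fix i assume "i \<in> Sigma (Pow {1..M}) (\<lambda>L. L) - B"
      then obtain L x where i: "i = (L,x)" "L \<subseteq> {1..M}" "x \<in> L" "\<not> (x < M \<and> Suc x \<notin> L)" by (auto simp: B_def)
      have "x \<le> M" using i by auto
      consider "x = M" | "Suc x \<in> L" using i \<open>x \<le> M\<close> by force
      then show "h i = 0"
      proof cases
        case 1 then show ?thesis by (simp add: i h_def hi_def)
      next
        case 2
        then show ?thesis using 2 i pf_coeff_zero[of L x "Suc x" lo hi] fin by (simp add: h_def lo_Suc)
      qed
    qed
  qed (auto simp: B_def)
  also have "\<dots> = (\<Sum>L\<in>Pow {1..M}. wt w L * (r * (\<Sum>x\<in>L. (- pf_coeff hi lo L x) * (real M * (real M + 1) - hi x) / (T + hi x))))"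
    unfolding sum_distrib_left h_def by (subst sum.Sigma) (auto intro: finite_subset[OF _ finite_atLeastAtMost])
  finally show ?thesis .
qed

text \<open>Averaging \<open>pole_expansion\<close> cancels the two pole sums by
  \<open>loop_cancel\<close>; the hypothesis \<open>mean\<close> then turns the size term into the
  missing \<open>r * M * (M + 1)\<close>, leaving only \<open>(1 - r) * T\<close>.\<close>

lemma loop_equation:
  fixes w :: "nat \<Rightarrow> real" and M :: nat
  assumes w: "\<And>x. 2 \<le> x \<Longrightarrow> x \<le> M \<Longrightarrow> w x * (real x)\<^sup>2 = r * w (x - 1) * (real M * (real M + 1) - lo x)"
    and mean: "2 * (1 + r) * (\<Sum>L\<in>Pow {1..M}. wt w L * (\<Sum>x\<in>L. real x)) = r * (real M * (real M + 1)) * (\<Sum>L\<in>Pow {1..M}. wt w L)"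
    and T: "T > 0"
  shows "T * (\<Sum>L\<in>Pow {1..M}. wt w L * Fratio T L) - r * (real M * (real M + 1) + T) * (\<Sum>L\<in>Pow {1..M}. wt w L / Fratio T L)
     = (1 - r) * T * (\<Sum>L\<in>Pow {1..M}. wt w L)"
proof -
  let ?m = "real M * (real M + 1)"
  have "T * (\<Sum>L\<in>Pow {1..M}. wt w L * Fratio T L) - r * (?m + T) * (\<Sum>L\<in>Pow {1..M}. wt w L / Fratio T L)
    = (\<Sum>L\<in>Pow {1..M}. wt w L * (T * Fratio T L - r * (?m + T) / Fratio T L))"
    by (simp add: sum_distrib_left sum_subtractf right_diff_distrib mult_ac)
  also have "\<dots> = (\<Sum>L\<in>Pow {1..M}. wt w L * ((1 - r) * T - r * ?m) + 2 * (1 + r) * (wt w L * (\<Sum>x\<in>L. real x))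
     - wt w L * (\<Sum>x\<in>L. pf_coeff lo hi L x * lo x / (T + lo x)) + wt w L * (r * (\<Sum>x\<in>L. (- pf_coeff hi lo L x) * (?m - hi x) / (T + hi x))))"
  proof (rule sum.cong[OF refl])
    have alg: "v * (c - e + 2 * (1 + r) * s - A + r * B) = v * (c - e) + 2 * (1 + r) * (v * s) - v * A + v * (r * B)"
      for v c e s A B :: real by (simp add: algebra_simps)
    fix L assume "L \<in> Pow {1..M}"
    then have L: "finite L" "0 \<notin> L" by (auto intro: finite_subset)
    show "wt w L * (T * Fratio T L - r * (?m + T) / Fratio T L) = wt w L * ((1 - r) * T - r * ?m) + 2 * (1 + r) * (wt w L * (\<Sum>x\<in>L. real x))
     - wt w L * (\<Sum>x\<in>L. pf_coeff lo hi L x * lo x / (T + lo x)) + wt w L * (r * (\<Sum>x\<in>L. (- pf_coeff hi lo L x) * (?m - hi x) / (T + hi x)))"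
      unfolding pole_expansion[OF L T] by (rule alg)
  qed
  also have "\<dots> = ((1 - r) * T - r * ?m) * (\<Sum>L\<in>Pow {1..M}. wt w L) + 2 * (1 + r) * (\<Sum>L\<in>Pow {1..M}. wt w L * (\<Sum>x\<in>L. real x))"
  proof -
    have "(\<Sum>L\<in>Pow {1..M}. wt w L * (\<Sum>x\<in>L. pf_coeff lo hi L x * lo x / (T + lo x)))
       = (\<Sum>L\<in>Pow {1..M}. wt w L * (r * (\<Sum>x\<in>L. (- pf_coeff hi lo L x) * (?m - hi x) / (T + hi x))))"
      by (rule loop_cancel[OF w])
    moreover have "(\<Sum>L\<in>Pow {1..M}. wt w L * c) = c * (\<Sum>L\<in>Pow {1..M}. wt w L)"
      for c :: real by (simp add: sum_distrib_left mult.commute)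
    from this[of "(1 - r) * T - r * ?m"] have "(\<Sum>L\<in>Pow {1..M}. wt w L * ((1 - r) * T - r * ?m)) = ((1 - r) * T - r * ?m) * (\<Sum>L\<in>Pow {1..M}. wt w L)" .
    ultimately show ?thesis unfolding sum.distrib sum_subtractf sum_distrib_left[symmetric, of "2 * (1 + r)"] by linarith
  qed
  also have "\<dots> = (1 - r) * T * (\<Sum>L\<in>Pow {1..M}. wt w L)"
    unfolding mean by (simp add: algebra_simps)
  finally show ?thesis .
qed

section \<open>Growth words of strict partitions\<close>

definition add_part :: "nat \<Rightarrow> nat set \<Rightarrow> nat set" where
  "add_part i L = insert i (L - {i - 1})"

text \<open>A strict partition is the set of its parts. The reservoir of parts \<open>0\<close> is implicit, which is why
  the letter \<open>1\<close> needs no part to move.\<close>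
definition addable :: "nat \<Rightarrow> nat set \<Rightarrow> bool" where
  "addable i L \<longleftrightarrow> 1 \<le> i \<and> i \<notin> L \<and> (i = 1 \<or> i - 1 \<in> L)"

definition run :: "nat set \<Rightarrow> nat list \<Rightarrow> nat set" where
  "run L w = foldl (\<lambda>L i. add_part i L) L w"

primrec ok :: "nat \<Rightarrow> nat set \<Rightarrow> nat list \<Rightarrow> bool" where
  "ok M L [] = True"
| "ok M L (i # w) = (i \<le> M \<and> addable i L \<and> ok M (add_part i L) w)"

text \<open>Removing 0 returns a part that has shrunk to nothing to the implicit reservoir.\<close>

definition drop_part :: "nat \<Rightarrow> nat set \<Rightarrow> nat set" where
  "drop_part i L = insert (i - 1) (L - {i}) - {0}"

lemma run_simps [simp]: "run L [] = L" "run L (i # w) = run (add_part i L) w" "run L (u @ v) = run (run L u) v"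
  by (simp_all add: run_def)

lemma ok_append: "ok M L (u @ v) \<longleftrightarrow> ok M L u \<and> ok M (run L u) v"
  by (induction u arbitrary: L) auto

lemma add_part_subset: "L \<subseteq> {1..M} \<Longrightarrow> i \<le> M \<Longrightarrow> addable i L \<Longrightarrow> add_part i L \<subseteq> {1..M}"
  by (auto simp: add_part_def addable_def)

lemma sum_add_part:
  assumes "finite L" "0 \<notin> L" "addable i L"
  shows "\<Sum>(add_part i L) = Suc (\<Sum>L)"
proof (cases "i = 1")
  case True
  then show ?thesis using assms by (simp add: add_part_def addable_def)
next
  case False
  then have i: "i - 1 \<in> L" "i \<notin> L" "i \<ge> 1" using assms by (auto simp: addable_def)
  have "\<Sum>L = (i - 1) + \<Sum>(L - {i - 1})" using assms i by (simp add: sum.remove)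
  moreover have "\<Sum>(add_part i L) = i + \<Sum>(L - {i - 1})" using assms i by (simp add: add_part_def)
  ultimately show ?thesis using i by simp
qed

lemma run_subset: "L \<subseteq> {1..M} \<Longrightarrow> ok M L w \<Longrightarrow> run L w \<subseteq> {1..M}"
proof (induction w arbitrary: L)
  case (Cons i w)
  then show ?case using Cons.IH[of "add_part i L"] add_part_subset[of L M i] by simp
qed simp

lemma sum_run: "L \<subseteq> {1..M} \<Longrightarrow> ok M L w \<Longrightarrow> \<Sum>(run L w) = \<Sum>L + length w"
proof (induction w arbitrary: L)
  case (Cons i w)
  then have "finite L" "0 \<notin> L" by (auto intro: finite_subset)
  then show ?case using Cons add_part_subset[of L M i] sum_add_part[of L i] by simp
qed simp

lemma ok_letters: "ok M L w \<Longrightarrow> set w \<subseteq> {1..M}"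
  by (induction w arbitrary: L) (auto simp: addable_def)

lemma finite_ok: "finite {w. length w = k \<and> ok M L w}"
proof (rule finite_subset)
  show "{w. length w = k \<and> ok M L w} \<subseteq> {w. set w \<subseteq> {1..M} \<and> length w = k}"
    using ok_letters by blast
  show "finite {w. set w \<subseteq> {1..M} \<and> length w = k}"
    by (rule finite_lists_length_eq) simp
qed

lemma drop_part_add_part:
  assumes "0 \<notin> K" "0 \<notin> L"
  shows "addable i K \<and> add_part i K = L \<longleftrightarrow> i \<in> L \<and> i - 1 \<notin> L \<and> K = drop_part i L"
proof
  assume *: "addable i K \<and> add_part i K = L"
  then have "i \<ge> 1" "i \<notin> K" "i = 1 \<or> i - 1 \<in> K" "L = insert i (K - {i - 1})" by (auto simp: addable_def add_part_def)
  then show "i \<in> L \<and> i - 1 \<notin> L \<and> K = drop_part i L" using assms by (auto simp: drop_part_def)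
next
  assume *: "i \<in> L \<and> i - 1 \<notin> L \<and> K = drop_part i L"
  then have "i \<ge> 1" using assms by (cases i) auto
  then show "addable i K \<and> add_part i K = L" using * assms by (auto simp: addable_def add_part_def drop_part_def)
qed

section \<open>Counting the growth words that reach or leave a shape\<close>

definition words_to :: "nat \<Rightarrow> nat \<Rightarrow> nat set \<Rightarrow> nat" where
  "words_to M m L = card {w. length w = m \<and> ok M {} w \<and> run {} w = L}"

definition words_from :: "nat \<Rightarrow> nat \<Rightarrow> nat set \<Rightarrow> nat" where
  "words_from M k L = card {w. length w = k \<and> ok M L w}"

lemma words_from_Suc: "words_from M (Suc k) L = (\<Sum>i | i \<in> {1..M} \<and> addable i L. words_from M k (add_part i L))"
proof -
  have "{w. length w = Suc k \<and> ok M L w} = (\<Union>i\<in>{i. i \<in> {1..M} \<and> addable i L}. (#) i ` {w. length w = k \<and> ok M (add_part i L) w})"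
    (is "?A = ?B")
  proof
    show "?A \<subseteq> ?B"
    proof
      fix w assume w: "w \<in> ?A"
      then obtain i v where "w = i # v" by (cases w) auto
      then show "w \<in> ?B" using w by (auto simp: addable_def)
    qed
  qed auto
  also have "card \<dots> = (\<Sum>i\<in>{i. i \<in> {1..M} \<and> addable i L}. card ((#) i ` {w. length w = k \<and> ok M (add_part i L) w}))"
    by (rule card_UN_disjoint) (auto intro: finite_ok)
  finally show ?thesis by (simp add: words_from_def card_image)
qed

lemma words_to_Suc:
  assumes L: "L \<subseteq> {1..M}"
  shows "words_to M (Suc m) L = (\<Sum>i | i \<in> L \<and> i - 1 \<notin> L. words_to M m (drop_part i L))"
proof -
  have fL: "finite L" using L finite_subset by blast
  have "{w. length w = Suc m \<and> ok M {} w \<and> run {} w = L} =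
     (\<Union>i\<in>{i. i \<in> L \<and> i - 1 \<notin> L}. (\<lambda>u. u @ [i]) ` {w. length w = m \<and> ok M {} w \<and> run {} w = drop_part i L})"
    (is "?A = ?B")
  proof -
    have *: "u @ [i] \<in> ?A \<longleftrightarrow> i \<in> L \<and> i - 1 \<notin> L \<and> u \<in> {w. length w = m \<and> ok M {} w \<and> run {} w = drop_part i L}" for u i
    proof -
      have "ok M {} u \<Longrightarrow> 0 \<notin> run {} u" using run_subset[of "{}" M u] by auto
      then have "u @ [i] \<in> ?A \<longleftrightarrow> length u = m \<and> ok M {} u \<and> i \<le> M \<and> (addable i (run {} u) \<and> add_part i (run {} u) = L)"
        by (auto simp: ok_append)
      also have "\<dots> \<longleftrightarrow> length u = m \<and> ok M {} u \<and> i \<le> M \<and> (i \<in> L \<and> i - 1 \<notin> L \<and> run {} u = drop_part i L)"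
      proof (cases "ok M {} u")
        case True
        then have "0 \<notin> run {} u" "0 \<notin> L" using run_subset[of "{}" M u] L by auto
        then show ?thesis using drop_part_add_part[of "run {} u" L i] by simp
      qed simp
      finally show ?thesis using L by auto
    qed
    show ?thesis
    proof (rule set_eqI)
      fix w :: "nat list"
      show "w \<in> ?A \<longleftrightarrow> w \<in> ?B"
      proof (cases w rule: rev_exhaust)
        case (snoc u i)
        have "u @ [i] \<in> ?B \<longleftrightarrow> i \<in> L \<and> i - 1 \<notin> L \<and> u \<in> {w. length w = m \<and> ok M {} w \<and> run {} w = drop_part i L}"
          by blast
        then show ?thesis unfolding snoc using *[of u i] by (simp only:)
      qed auto
    qed
  qed
  also have "card \<dots> = (\<Sum>i | i \<in> L \<and> i - 1 \<notin> L. card ((\<lambda>u. u @ [i]) ` {w. length w = m \<and> ok M {} w \<and> run {} w = drop_part i L}))"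
  proof (intro card_UN_disjoint ballI)
    show "finite {i. i \<in> L \<and> i - 1 \<notin> L}" using fL by simp
    have "finite {w. length w = m \<and> ok M {} w \<and> run {} w = K}" for K
      by (rule finite_subset[OF _ finite_ok[of m M "{}"]]) auto
    then show "finite ((\<lambda>u. u @ [i]) ` {w. length w = m \<and> ok M {} w \<and> run {} w = drop_part i L})" for i
      by (rule finite_imageI)
  qed auto
  also have "\<dots> = (\<Sum>i | i \<in> L \<and> i - 1 \<notin> L. words_to M m (drop_part i L))"
    by (intro sum.cong refl) (auto simp: words_to_def card_image inj_on_def)
  finally show ?thesis by (simp add: words_to_def)
qed

text \<open>Schur's formula for the number of standard shifted tableaux; the square root turns the
  product over ordered pairs into one over unordered pairs.\<close>

definition word_count :: "nat set \<Rightarrow> real" where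
  "word_count L = fact (\<Sum>L) * sqrt (V2 L) / (\<Prod>x\<in>L. fact x)"

lemma V2_pos:
  assumes "finite L" "0 \<notin> L"
  shows "V2 L > 0"
  unfolding V2_def
proof (intro prod_pos)
  fix x y assume "x \<in> L" "y \<in> L - {x}"
  then have "real x \<noteq> real y" "real x > 0" using assms by (auto intro: Nat.gr0I)
  then show "\<bar>cratio x y\<bar> > 0" by (simp add: cratio_def)
qed

lemma sqrt_V2_insert:
  assumes "finite L" "e \<notin> L"
  shows "sqrt (V2 (insert e L)) = sqrt (V2 L) * (\<Prod>y\<in>L. \<bar>cratio e y\<bar>)"
proof -
  have "(\<Prod>y\<in>L. (cratio e y)\<^sup>2) = (\<Prod>y\<in>L. \<bar>cratio e y\<bar>)\<^sup>2"
    by (simp add: prod_power_distrib)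
  then show ?thesis using assms by (simp add: V2_insert real_sqrt_mult prod_nonneg)
qed

text \<open>Lowering \<open>i\<close> to \<open>i - 1\<close> changes Schur's product by the same
  quotient of interactions that occurs in a residue of \<open>Fratio\<close>. For
  \<open>i = 1\<close> the part disappears instead of moving, which needs its own
  computation.\<close>

lemma word_count_drop_part:
  assumes "finite L" "0 \<notin> L" "i \<in> L" "i - 1 \<notin> L"
  shows "word_count (drop_part i L) * (2 * real (\<Sum>L)) = word_count L * pf_coeff lo hi L i"
proof -
  define U where "U = L - {i}"
  have U: "finite U" "i \<notin> U" "i - 1 \<notin> U" "0 \<notin> U" and L: "L = insert i U" using assms by (auto simp: U_def)
  have fz: "(\<Prod>x\<in>U. fact x :: real) \<noteq> 0" using U by simp
  have "i \<ge> 1" using assms by (cases i) auto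
  then consider "i = 1" | "i \<ge> 2" by linarith
  then show ?thesis
  proof cases
    case 1
    then have p: "drop_part i L = U" unfolding drop_part_def L using U by auto
    have y: "y \<ge> 2" if "y \<in> U" for y using that U 1 by (metis One_nat_def Suc_leI Suc_1 le_neq_implies_less less_eq_Suc_le neq0_conv)
    have "(\<Prod>y\<in>U. \<bar>cratio 1 y\<bar>) * (\<Prod>y\<in>U. (hi y - lo 1) / (lo y - lo 1)) = 1"
      unfolding prod.distrib[symmetric]
    proof (rule prod.neutral, rule)
      fix z assume "z \<in> U"
      then have "real z \<ge> 2" using y by force
      then show "\<bar>cratio 1 z\<bar> * ((hi z - lo 1) / (lo z - lo 1)) = 1"
        by (simp add: cratio_def hi_def lo_def divide_simps)
    qed
    then have e: "(\<Prod>y\<in>U. \<bar>cratio 1 y\<bar>) * pf_coeff lo hi L 1 = 2"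
      using U 1 unfolding L by (simp add: pf_coeff_def hi_def lo_def)
    have s: "\<Sum>L = Suc (\<Sum>U)" using U 1 by (simp add: L)
    have "word_count L = fact (Suc (\<Sum>U)) * (sqrt (V2 U) * (\<Prod>y\<in>U. \<bar>cratio 1 y\<bar>)) / (\<Prod>x\<in>U. fact x)"
      unfolding word_count_def s using U 1 by (simp add: L sqrt_V2_insert)
    then have "word_count L * pf_coeff lo hi L i = fact (Suc (\<Sum>U)) * sqrt (V2 U) / (\<Prod>x\<in>U. fact x) * ((\<Prod>y\<in>U. \<bar>cratio 1 y\<bar>) * pf_coeff lo hi L 1)"
      using 1 by simp
    then show ?thesis unfolding e s p word_count_def by simp
  next
    case 2
    then have p: "drop_part i L = insert (i - 1) U" unfolding drop_part_def L using U by auto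
    have "\<bar>cratio i y\<bar> * (cratio (i - 1) y / cratio i y) = \<bar>cratio (i - 1) y\<bar>" if "y \<in> U" for y
    proof -
      obtain k where k: "i = Suc k" "k \<ge> 1" using 2 by (cases i) auto
      have "y \<noteq> k" "y \<noteq> Suc k" using U that k by auto
      then consider "real y < real k" | "real y > real k + 1" by linarith
      then show ?thesis using k by cases (simp_all add: cratio_def abs_if divide_simps)
    qed
    then have e: "(\<Prod>y\<in>U. \<bar>cratio i y\<bar>) * (\<Prod>y\<in>U. cratio (i - 1) y / cratio i y) = (\<Prod>y\<in>U. \<bar>cratio (i - 1) y\<bar>)"
      unfolding prod.distrib[symmetric] by (intro prod.cong refl) blast
    have fi: "fact i = real i * fact (i - 1)" using 2 by (simp add: fact_reduce)
    have s: "\<Sum>L = Suc ((i - 1) + \<Sum>U)" "\<Sum>(insert (i - 1) U) = (i - 1) + \<Sum>U" using U 2 by (auto simp: L)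
    have "word_count L * pf_coeff lo hi L i = fact (\<Sum>L) * (sqrt (V2 U) * (\<Prod>y\<in>U. \<bar>cratio i y\<bar>)) / (real i * fact (i - 1) * (\<Prod>x\<in>U. fact x))
        * (2 * real i * (\<Prod>y\<in>U. cratio (i - 1) y / cratio i y))"
      unfolding word_count_def
      unfolding L sqrt_V2_insert[OF U(1,2)] pf_coeff_ratio(1)[OF U(1) 2 U(2-4)] prod.insert[OF U(1,2)] fi ..
    also have "\<dots> = 2 * fact (\<Sum>L) * sqrt (V2 U) / (fact (i - 1) * (\<Prod>x\<in>U. fact x)) * ((\<Prod>y\<in>U. \<bar>cratio i y\<bar>) * (\<Prod>y\<in>U. cratio (i - 1) y / cratio i y))"
      using 2 by (simp add: field_simps)
    also have "\<dots> = 2 * fact (\<Sum>L) * sqrt (V2 (insert (i - 1) U)) / (\<Prod>x\<in>insert (i - 1) U. fact x)"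
      using U unfolding e by (simp add: sqrt_V2_insert)
    also have "\<dots> = word_count (drop_part i L) * (2 * real (\<Sum>L))"
      unfolding word_count_def p s by simp
    finally show ?thesis by simp
  qed
qed

text \<open>The branching rule of shifted tableaux is the statement that the residues of
  \<open>Fratio\<close> sum to \<open>2 * \<Sum>L\<close>; parts that cannot be lowered have residue
  0.\<close>

lemma word_count_rec:
  assumes "finite L" "0 \<notin> L" "L \<noteq> {}"
  shows "word_count L = (\<Sum>i | i \<in> L \<and> i - 1 \<notin> L. word_count (drop_part i L))"
proof -
  obtain z where z: "z \<in> L" "z > 0" using assms by (metis ex_in_conv neq0_conv)
  then have pos: "real (\<Sum>L) > 0" using assms by (simp add: sum_pos2[of L z])
  have "(\<Sum>i | i \<in> L \<and> i - 1 \<notin> L. word_count (drop_part i L)) * (2 * real (\<Sum>L)) = (\<Sum>i | i \<in> L \<and> i - 1 \<notin> L. word_count L * pf_coeff lo hi L i)"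
    unfolding sum_distrib_right using assms by (intro sum.cong refl word_count_drop_part) auto
  also have "\<dots> = (\<Sum>i\<in>L. word_count L * pf_coeff lo hi L i)"
  proof (rule sum.mono_neutral_left)
    show "\<forall>i\<in>L - {i \<in> L. i - 1 \<notin> L}. word_count L * pf_coeff lo hi L i = 0"
    proof
      fix i assume i: "i \<in> L - {i \<in> L. i - 1 \<notin> L}"
      then have "i \<noteq> 0" using assms by auto
      then have "hi (i - 1) = lo i" "i - 1 \<noteq> i" by (auto simp: hi_def lo_def of_nat_diff)
      then show "word_count L * pf_coeff lo hi L i = 0" using i pf_coeff_zero[of L i "i - 1" hi lo] assms by simp
    qed
  qed (use assms in auto)
  also have "\<dots> = word_count L * (2 * real (\<Sum>L))"
    using assms inj_lo by (simp add: sum_pf_coeff hi_minus_lo flip: sum_distrib_left)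
  finally show ?thesis using pos by simp
qed

lemma drop_part_props:
  assumes "L \<subseteq> {1..M}" "i \<in> L" "i - 1 \<notin> L"
  shows "drop_part i L \<subseteq> {1..M}" "\<Sum>L = Suc (\<Sum>(drop_part i L))"
proof -
  show 1: "drop_part i L \<subseteq> {1..M}"
  proof
    fix z assume "z \<in> drop_part i L"
    then have "z \<noteq> 0" "z = i - 1 \<or> z \<in> L" by (auto simp: drop_part_def)
    then show "z \<in> {1..M}" using assms by fastforce
  qed
  have "addable i (drop_part i L) \<and> add_part i (drop_part i L) = L"
  proof -
    have "0 \<notin> L" "0 \<notin> drop_part i L" using assms by (auto simp: drop_part_def)
    then show ?thesis using drop_part_add_part[of "drop_part i L" L i] assms by simp
  qed
  then show "\<Sum>L = Suc (\<Sum>(drop_part i L))" using sum_add_part[of "drop_part i L" i] 1 finite_subset[OF 1] by (auto simp: drop_part_def)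
qed

lemma sum_eq_0_set: "finite L \<Longrightarrow> 0 \<notin> L \<Longrightarrow> \<Sum>L = 0 \<longleftrightarrow> L = {}" for L :: "nat set"
  by (auto simp: sum_eq_0_iff)

lemma words_to_eq:
  assumes "L \<subseteq> {1..M}"
  shows "real (words_to M m L) = (if \<Sum>L = m then word_count L else 0)"
  using assms
proof (induction m arbitrary: L)
  case 0
  have "finite L" "0 \<notin> L" using 0 by (auto intro: finite_subset)
  then have "\<Sum>L = 0 \<longleftrightarrow> L = {}" by (rule sum_eq_0_set)
  moreover have "{w. length w = 0 \<and> ok M {} w \<and> run {} w = L} = (if L = {} then {[]} else {})" by auto
  ultimately show ?case by (auto simp: words_to_def word_count_def V2_def)
next
  case (Suc m)
  have L: "finite L" "0 \<notin> L" using Suc.prems by (auto intro: finite_subset)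
  have "real (words_to M (Suc m) L) = (\<Sum>i | i \<in> L \<and> i - 1 \<notin> L. real (words_to M m (drop_part i L)))"
    using words_to_Suc[OF Suc.prems] by simp
  also have "\<dots> = (\<Sum>i | i \<in> L \<and> i - 1 \<notin> L. if \<Sum>L = Suc m then word_count (drop_part i L) else 0)"
    using Suc.prems drop_part_props by (intro sum.cong refl) (auto simp: Suc.IH)
  also have "\<dots> = (if \<Sum>L = Suc m then word_count L else 0)"
    using L word_count_rec[of L] by (cases "L = {}") simp_all
  finally show ?case .
qed

text \<open>A letter \<open>i\<close> that raises a part of \<open>L\<close> lowers the part
  \<open>i\<close> of the complement, so leaving \<open>L\<close> obeys the branching rule of the
  complement.\<close>

lemma words_from_eq:
  assumes "L \<subseteq> {1..M}" "\<Sum>L + k = \<Sum>{1..M}"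
  shows "real (words_from M k L) = word_count ({1..M} - L)"
  using assms
proof (induction k arbitrary: L)
  case 0
  have "\<Sum>{1..M} = \<Sum>L + \<Sum>({1..M} - L)" using 0 by (simp add: sum.subset_diff)
  then have "\<Sum>({1..M} - L) = 0" using 0 by simp
  then have e: "{1..M} - L = {}" by (subst (asm) sum_eq_0_set) auto
  have "{w. length w = 0 \<and> ok M L w} = {[]}" by auto
  then show ?case unfolding e by (simp add: words_from_def word_count_def V2_def)
next
  case (Suc k)
  let ?c = "\<lambda>L. {1..M} - L"
  have L: "finite L" "0 \<notin> L" using Suc.prems by (auto intro: finite_subset)
  have "\<Sum>{1..M} = \<Sum>L + \<Sum>(?c L)" using Suc.prems by (simp add: sum.subset_diff)
  then have ne: "?c L \<noteq> {}" using Suc.prems by (metis add_left_cancel nat.distinct(1) sum.empty)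
  have idx: "{i. i \<in> {1..M} \<and> addable i L} = {i. i \<in> ?c L \<and> i - 1 \<notin> ?c L}"
    by (fastforce simp: addable_def)
  have "real (words_from M (Suc k) L) = (\<Sum>i | i \<in> {1..M} \<and> addable i L. real (words_from M k (add_part i L)))"
    by (simp add: words_from_Suc)
  also have "\<dots> = (\<Sum>i | i \<in> {1..M} \<and> addable i L. word_count (drop_part i (?c L)))"
  proof (rule sum.cong[OF refl])
    fix i assume "i \<in> {i. i \<in> {1..M} \<and> addable i L}"
    then have i: "i \<le> M" "addable i L" "i \<ge> 1" by auto
    have "real (words_from M k (add_part i L)) = word_count (?c (add_part i L))"
      using Suc.prems add_part_subset[OF _ i(1,2)] sum_add_part[OF L i(2)] by (intro Suc.IH) auto
    moreover have "?c (add_part i L) = drop_part i (?c L)"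
      using i Suc.prems(1) by (auto simp: add_part_def drop_part_def addable_def)
    ultimately show "real (words_from M k (add_part i L)) = word_count (drop_part i (?c L))" by simp
  qed
  also have "\<dots> = word_count (?c L)" unfolding idx using ne by (subst word_count_rec[of "?c L"]) auto
  finally show ?case .
qed

section \<open>One-site weights from a shape and its complement\<close>

definition cross_prod :: "nat \<Rightarrow> nat \<Rightarrow> real" where
  "cross_prod M x = (\<Prod>y\<in>{1..M} - {x}. \<bar>cratio x y\<bar>)"

lemma cross_prod_pos: "x \<ge> 1 \<Longrightarrow> cross_prod M x > 0"
  unfolding cross_prod_def by (intro prod_pos) (auto simp: cratio_def)

text \<open>Let \<open>c\<close> be the interaction between \<open>L\<close> and its complement
  \<open>K\<close>. Then \<open>V2 {1..M} = V2 L * V2 K * c^2\<close>, while the product of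
  \<open>cross_prod\<close> over \<open>L\<close> is \<open>V2 L * c\<close>; eliminating
  \<open>c\<close> and \<open>V2 K\<close> leaves a full power of \<open>V2 L\<close> and factors of
  single sites.\<close>

lemma word_count_complement:
  assumes "L \<subseteq> {1..M}"
  shows "word_count L / fact (\<Sum>L) * (word_count ({1..M} - L) / fact (\<Sum>({1..M} - L)))
     = sqrt (V2 {1..M}) / (\<Prod>x\<in>{1..M}. fact x) * (V2 L / (\<Prod>x\<in>L. cross_prod M x))"
proof -
  define S where "S = {1..M}"
  define K where "K = S - L"
  define c where "c = (\<Prod>x\<in>L. \<Prod>y\<in>K. \<bar>cratio x y\<bar>)"
  have fin: "finite L" "finite K" and z: "0 \<notin> L" "0 \<notin> K" and S: "S = L \<union> K" "L \<inter> K = {}"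
    using assms by (auto simp: S_def K_def intro: finite_subset)
  have c': "c = (\<Prod>x\<in>K. \<Prod>y\<in>L. \<bar>cratio x y\<bar>)"
    unfolding c_def by (subst prod.swap) (simp add: cratio_commute_abs)
  have in1: "(\<Prod>y\<in>S - {x}. \<bar>cratio x y\<bar>) = (\<Prod>y\<in>L - {x}. \<bar>cratio x y\<bar>) * (\<Prod>y\<in>K. \<bar>cratio x y\<bar>)" if "x \<in> L" for x
  proof -
    have "S - {x} = (L - {x}) \<union> K" using that S by auto
    then show ?thesis using fin S by (subst prod.union_disjoint[symmetric]) auto
  qed
  have in2: "(\<Prod>y\<in>S - {x}. \<bar>cratio x y\<bar>) = (\<Prod>y\<in>K - {x}. \<bar>cratio x y\<bar>) * (\<Prod>y\<in>L. \<bar>cratio x y\<bar>)" if "x \<in> K" for x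
  proof -
    have "S - {x} = (K - {x}) \<union> L" using that S by auto
    then show ?thesis using fin S by (subst prod.union_disjoint[symmetric]) auto
  qed
  have q: "(\<Prod>x\<in>L. cross_prod M x) = V2 L * c"
    unfolding cross_prod_def S_def[symmetric] V2_def c_def prod.distrib[symmetric] by (intro prod.cong refl in1)
  have "V2 S = (\<Prod>x\<in>L. \<Prod>y\<in>S - {x}. \<bar>cratio x y\<bar>) * (\<Prod>x\<in>K. \<Prod>y\<in>S - {x}. \<bar>cratio x y\<bar>)"
    unfolding V2_def using fin S by (simp add: prod.union_disjoint)
  also have "(\<Prod>x\<in>L. \<Prod>y\<in>S - {x}. \<bar>cratio x y\<bar>) = V2 L * c"
    unfolding V2_def c_def prod.distrib[symmetric] by (intro prod.cong refl in1)
  also have "(\<Prod>x\<in>K. \<Prod>y\<in>S - {x}. \<bar>cratio x y\<bar>) = V2 K * c"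
    unfolding V2_def c' prod.distrib[symmetric] by (intro prod.cong refl in2)
  finally have V: "V2 S = V2 L * V2 K * c\<^sup>2" by (simp add: power2_eq_square)
  have "(\<Prod>x\<in>L. cross_prod M x) > 0" using z assms by (intro prod_pos cross_prod_pos) auto
  then have c0: "c > 0" using q V2_pos[OF fin(1) z(1)] by (simp add: zero_less_mult_iff)
  have vL: "V2 L > 0" using V2_pos fin z by blast
  have sq: "sqrt (V2 S) = sqrt (V2 L) * sqrt (V2 K) * c"
    unfolding V using c0 by (simp add: real_sqrt_mult)
  have pf: "(\<Prod>x\<in>S. fact x :: real) = (\<Prod>x\<in>L. fact x) * (\<Prod>x\<in>K. fact x)"
    using fin S by (simp add: prod.union_disjoint)
  show ?thesis unfolding S_def[symmetric] K_def[symmetric] sq pf q word_count_def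
    using c0 vL by (simp add: field_simps)
qed

text \<open>The numerators give \<open>(x - 1)!\<close> and \<open>(M - x)!\<close>; the
  denominators give \<open>(x + M)! / x!\<close> with the factor \<open>2 * x\<close> at
  \<open>y = x\<close> taken out.\<close>

lemma cross_prod_closed:
  assumes "1 \<le> x" "x \<le> M"
  shows "cross_prod M x * fact (x + M) = fact (x - 1) * fact (M - x) * (2 * real x) * fact x"
proof -
  have a: "(\<Prod>y\<in>{1..M}. real x + real y) * fact x = fact (x + M)" for M
  proof (induction M)
    case (Suc M)
    have "(\<Prod>y\<in>{1..Suc M}. real x + real y) * fact x = (real x + real (Suc M)) * ((\<Prod>y\<in>{1..M}. real x + real y) * fact x)"
      by (simp add: mult_ac)
    also have "\<dots> = fact (x + Suc M)" unfolding Suc.IH by simp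
    finally show ?case .
  qed simp
  have b: "(\<Prod>y\<in>{1..<Suc k}. \<bar>real (Suc k) - real y\<bar>) = fact k" for k
  proof -
    have "(\<Prod>y\<in>{1..<Suc k}. \<bar>real (Suc k) - real y\<bar>) = (\<Prod>y\<in>{1..k}. real (k + 1 - y))"
      by (intro prod.cong) (auto simp: of_nat_diff)
    also have "\<dots> = (\<Prod>y\<in>{1..k}. real y)" 
      by (subst (2) prod.atLeastAtMost_rev) (simp add: add.commute)
    also have "\<dots> = fact k" by (simp add: fact_prod)
    finally show ?thesis .
  qed
  have c: "(\<Prod>y\<in>{x<..x + k}. \<bar>real x - real y\<bar>) = fact k" for k
  proof (induction k)
    case (Suc k)
    have "{x<..x + Suc k} = insert (x + Suc k) {x<..x + k}" by auto
    then show ?case using Suc by simp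
  qed simp
  obtain k where k: "x = Suc k" using assms by (cases x) auto
  have sp: "{1..M} - {x} = {1..<x} \<union> {x<..M}" using assms by auto
  have "(\<Prod>y\<in>{1..M} - {x}. \<bar>real x - real y\<bar>) = (\<Prod>y\<in>{1..<x}. \<bar>real x - real y\<bar>) * (\<Prod>y\<in>{x<..M}. \<bar>real x - real y\<bar>)"
    unfolding sp by (rule prod.union_disjoint) auto
  also have "\<dots> = fact (x - 1) * fact (M - x)"
    using b[of k] c[of "M - x"] assms by (simp add: k)
  finally have n: "(\<Prod>y\<in>{1..M} - {x}. \<bar>real x - real y\<bar>) = fact (x - 1) * fact (M - x)" .
  have d: "(\<Prod>y\<in>{1..M}. real x + real y) = 2 * real x * (\<Prod>y\<in>{1..M} - {x}. real x + real y)"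
    using assms by (subst prod.remove[of _ x]) auto
  have pos: "(\<Prod>y\<in>{1..M} - {x}. real x + real y) > 0" using assms by (intro prod_pos) auto
  have "cross_prod M x = (\<Prod>y\<in>{1..M} - {x}. \<bar>real x - real y\<bar>) / (\<Prod>y\<in>{1..M} - {x}. real x + real y)"
    unfolding cross_prod_def cratio_def prod_dividef[symmetric] by (intro prod.cong refl) (simp add: abs_divide)
  then have "cross_prod M x * (\<Prod>y\<in>{1..M} - {x}. real x + real y) = fact (x - 1) * fact (M - x)"
    using pos n by (simp add: field_simps)
  then show ?thesis using a[of M, symmetric] unfolding d by simp
qed

text \<open>In the quotient of two closed forms the factorials leave
  \<open>(M + x) * (M + 1 - x)\<close>, which equals \<open>M * (M + 1) - lo x\<close>. This is the
  ratio of neighbouring weights on which the cancellation of poles rests.\<close>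

lemma cross_prod_rec:
  assumes "2 \<le> x" "x \<le> M"
  shows "cross_prod M (x - 1) * (real x)\<^sup>2 = cross_prod M x * (real M * (real M + 1) - lo x)"
proof -
  obtain k where k: "x = Suc k" "k \<ge> 1" using assms by (cases x) auto
  obtain j where j: "M = Suc k + j" using assms k le_Suc_ex by blast
  have 1: "cross_prod M (Suc k) * fact (Suc k + M) = fact k * fact j * (2 * real (Suc k)) * fact (Suc k)"
    using cross_prod_closed[of "Suc k" M] by (simp add: j del: fact_Suc of_nat_Suc)
  have 2: "cross_prod M k * fact (k + M) = fact (k - 1) * fact (Suc j) * (2 * real k) * fact k"
    using cross_prod_closed[of k M] k by (simp add: j del: fact_Suc)
  have 3: "fact k = real k * fact (k - 1)" using k by (simp add: fact_reduce)
  have 4: "real M * (real M + 1) - lo x = (real k + 1 + real M) * real (Suc j)"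
    by (simp add: lo_def k j algebra_simps)
  have f: "fact (Suc k + M) = (real k + 1 + real M) * fact (k + M)" by (simp add: algebra_simps)
  have "cross_prod M (Suc k) * ((real k + 1 + real M) * real (Suc j)) * fact (k + M)
      = real (Suc j) * (fact k * fact j * (2 * real (Suc k)) * fact (Suc k))"
    unfolding 1[symmetric] f by simp
  also have "\<dots> = (fact (k - 1) * fact (Suc j) * (2 * real k) * fact k) * (real (Suc k))\<^sup>2"
    by (simp add: 3 power2_eq_square)
  also have "\<dots> = cross_prod M k * (real (Suc k))\<^sup>2 * fact (k + M)" unfolding 2[symmetric] by simp
  finally show ?thesis unfolding 4 by (simp add: k)
qed

section \<open>The shape at a binomial time\<close>

definition networks :: "nat \<Rightarrow> nat list set" where
  "networks M = {w. length w = \<Sum>{1..M} \<and> ok M {} w}"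

definition shape :: "nat list \<Rightarrow> nat \<Rightarrow> nat set" where
  "shape w m = run {} (take m w)"

text \<open>The word is uniform and the time is an independent binomial variable; with a deterministic
  time the law of the shape would not be a product-form gas.\<close>
definition EE :: "nat \<Rightarrow> real \<Rightarrow> (nat set \<Rightarrow> real) \<Rightarrow> real" where
  "EE M p f = (\<Sum>m\<le>\<Sum>{1..M}. Bernstein (\<Sum>{1..M}) m p * ((\<Sum>w\<in>networks M. f (shape w m)) / card (networks M)))"

definition PP :: "nat \<Rightarrow> real \<Rightarrow> nat set \<Rightarrow> real" where
  "PP M p L = EE M p (\<lambda>K. if K = L then 1 else 0)"

lemma finite_networks: "finite (networks M)"
  unfolding networks_def by (rule finite_ok)

lemma card_networks_eq: "real (card (networks M)) = word_count {1..M}"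
proof -
  have "card (networks M) = words_from M (\<Sum>{1..M}) {}" by (simp add: networks_def words_from_def)
  then show ?thesis using words_from_eq[of "{}" M "\<Sum>{1..M}"] by simp
qed

lemma word_count_pos: "finite L \<Longrightarrow> 0 \<notin> L \<Longrightarrow> word_count L > 0"
  unfolding word_count_def by (intro divide_pos_pos mult_pos_pos prod_pos) (auto simp: V2_pos)

lemma card_networks: "real (card (networks M)) > 0"
  unfolding card_networks_eq by (rule word_count_pos) auto

lemma ok_take_drop: "ok M L w \<longleftrightarrow> ok M L (take m w) \<and> ok M (run L (take m w)) (drop m w)"
  using ok_append[of M L "take m w" "drop m w"] by simp

lemma shape_subset:
  assumes "w \<in> networks M"
  shows "shape w m \<subseteq> {1..M}"
proof -
  have "ok M {} (take m w)" using assms ok_take_drop[of M "{}" w m] by (simp add: networks_def)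
  then show ?thesis unfolding shape_def by (intro run_subset) simp_all
qed

lemma sum_shape: "w \<in> networks M \<Longrightarrow> m \<le> \<Sum>{1..M} \<Longrightarrow> \<Sum>(shape w m) = m"
proof -
  assume w: "w \<in> networks M" "m \<le> \<Sum>{1..M}"
  then have "ok M {} (take m w)" using ok_take_drop[of M "{}" w m] by (simp add: networks_def)
  then show ?thesis using sum_run[of "{}" M "take m w"] w by (simp add: shape_def networks_def min_def)
qed

lemma EE_eq_sum: "EE M p f = (\<Sum>L\<in>Pow {1..M}. PP M p L * f L)"
proof -
  have "(\<Sum>L\<in>Pow {1..M}. PP M p L * f L) =
     (\<Sum>L\<in>Pow {1..M}. \<Sum>m\<le>\<Sum>{1..M}. Bernstein (\<Sum>{1..M}) m p * ((\<Sum>w\<in>networks M. (if shape w m = L then f L else 0)) / card (networks M)))"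
    unfolding PP_def EE_def sum_distrib_right sum_divide_distrib sum_distrib_left
    by (intro sum.cong refl) auto
  also have "\<dots> = (\<Sum>m\<le>\<Sum>{1..M}. Bernstein (\<Sum>{1..M}) m p * ((\<Sum>w\<in>networks M. \<Sum>L\<in>Pow {1..M}. (if shape w m = L then f L else 0)) / card (networks M)))"
  proof -
    have "(\<Sum>w\<in>networks M. \<Sum>L\<in>Pow {1..M}. (if shape w m = L then f L else 0)) = (\<Sum>L\<in>Pow {1..M}. \<Sum>w\<in>networks M. (if shape w m = L then f L else 0))" for m
      by (rule sum.swap)
    then show ?thesis by (subst sum.swap) (simp only: sum_distrib_left sum_divide_distrib)
  qed
  also have "\<dots> = EE M p f"
  proof -
    have "(\<Sum>L\<in>Pow {1..M}. (if shape w m = L then f L else 0)) = f (shape w m)" if "w \<in> networks M" for w m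
      using shape_subset[OF that, of m] by (simp add: sum.delta del: atLeastAtMost_iff)
    then show ?thesis unfolding EE_def by simp
  qed
  finally show ?thesis by simp
qed

lemma count_split:
  assumes "m \<le> \<Sum>{1..M}"
  shows "card {w \<in> networks M. shape w m = L} = words_to M m L * words_from M (\<Sum>{1..M} - m) L"
proof -
  have "bij_betw (\<lambda>(u,v). u @ v) ({u. length u = m \<and> ok M {} u \<and> run {} u = L} \<times> {v. length v = \<Sum>{1..M} - m \<and> ok M L v})
      {w \<in> networks M. shape w m = L}"
  proof (rule bij_betw_byWitness[where f' = "\<lambda>w. (take m w, drop m w)"], goal_cases)
    case 3
    show ?case using assms by (auto simp: networks_def ok_append shape_def)
  next
    case 4
    have "ok M {} (take m w) \<and> ok M (run {} (take m w)) (drop m w)" if "ok M {} w" for w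
      using that ok_take_drop[of M "{}" w m] by simp
    then show ?case using assms by (auto simp: networks_def shape_def)
  qed (auto simp: networks_def)
  then have "card {w \<in> networks M. shape w m = L} = card ({u. length u = m \<and> ok M {} u \<and> run {} u = L} \<times> {v. length v = \<Sum>{1..M} - m \<and> ok M L v})"
    by (simp add: bij_betw_same_card)
  then show ?thesis by (simp add: card_cartesian_product words_to_def words_from_def)
qed

definition site_weight :: "nat \<Rightarrow> real \<Rightarrow> nat \<Rightarrow> real" where
  "site_weight M r x = r ^ x / cross_prod M x"

lemma site_weight_nonneg: "r \<ge> 0 \<Longrightarrow> site_weight M r x \<ge> 0"
  unfolding site_weight_def cross_prod_def by (intro divide_nonneg_nonneg prod_nonneg) auto

lemma site_weight_rec:
  assumes "2 \<le> x" "x \<le> M"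
  shows "site_weight M r x * (real x)\<^sup>2 = r * site_weight M r (x - 1) * (real M * (real M + 1) - lo x)"
proof -
  have q: "cross_prod M x > 0" "cross_prod M (x - 1) > 0" using assms by (auto intro: cross_prod_pos)
  have r: "r ^ x = r * r ^ (x - 1)" using assms by (cases x) auto
  have e: "(real x)\<^sup>2 / cross_prod M x = (real M * (real M + 1) - lo x) / cross_prod M (x - 1)"
    using q cross_prod_rec[OF assms] by (simp add: frac_eq_eq mult.commute)
  have "site_weight M r x * (real x)\<^sup>2 = r * r ^ (x - 1) * ((real x)\<^sup>2 / cross_prod M x)"
    unfolding site_weight_def r by simp
  then show ?thesis unfolding e site_weight_def by simp
qed

text \<open>The binomial coefficient of the time absorbs the factorials of the two sizes in Schur's
  formulas, and the powers of \<open>p\<close> and \<open>1 - p\<close> become \<open>r ^ x\<close>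
  for each part with \<open>r = p / (1 - p)\<close>. Hence the law factorizes over sites and
  pairs.\<close>

lemma PP_eq:
  assumes p: "0 < p" "p < 1"
  shows "\<exists>K>0. \<forall>L\<in>Pow {1..M}. PP M p L = K * wt (site_weight M (p / (1 - p))) L"
proof -
  let ?N = "\<Sum>{1..M}"
  let ?r = "p / (1 - p)"
  define K where "K = (1 - p) ^ ?N * fact ?N / card (networks M) * (sqrt (V2 {1..M}) / (\<Prod>x\<in>{1..M}. fact x))"
  have "K > 0" unfolding K_def using p card_networks[of M]
    by (intro mult_pos_pos divide_pos_pos prod_pos) (auto simp: V2_pos)
  moreover have "PP M p L = K * wt (site_weight M ?r) L" if L: "L \<in> Pow {1..M}" for L
  proof -
    let ?s = "\<Sum>L"
    have N: "?N = ?s + \<Sum>({1..M} - L)" using L by (simp add: sum.subset_diff)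
    then have sN: "?s \<le> ?N" and cN: "\<Sum>({1..M} - L) = ?N - ?s" by auto
    have "PP M p L = (\<Sum>m\<le>?N. Bernstein ?N m p * (real (card {w \<in> networks M. shape w m = L}) / card (networks M)))"
      unfolding PP_def EE_def using finite_networks by (intro sum.cong refl) (auto simp: sum.If_cases Int_def)
    also have "\<dots> = (\<Sum>m\<le>?N. if m = ?s then Bernstein ?N ?s p * (word_count L * word_count ({1..M} - L) / card (networks M)) else 0)"
      using L sN by (intro sum.cong refl) (auto simp: count_split words_to_eq words_from_eq)
    also have "\<dots> = Bernstein ?N ?s p * (word_count L * word_count ({1..M} - L) / card (networks M))"
      using sN by simp
    also have "Bernstein ?N ?s p = fact ?N / (fact ?s * fact (?N - ?s)) * ((1 - p) ^ ?N * ?r ^ ?s)"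
    proof -
      have "p ^ ?s * (1 - p) ^ (?N - ?s) = (1 - p) ^ ?N * ?r ^ ?s"
        using p sN by (simp add: power_divide power_diff)
      then show ?thesis using sN by (simp add: Bernstein_def binomial_fact mult.assoc)
    qed
    also have "\<dots> * (word_count L * word_count ({1..M} - L) / card (networks M)) =
        (1 - p) ^ ?N * fact ?N / card (networks M) * ?r ^ ?s * (word_count L / fact ?s * (word_count ({1..M} - L) / fact (?N - ?s)))"
      by (simp add: mult_ac)
    also have "(word_count L / fact ?s * (word_count ({1..M} - L) / fact (?N - ?s))) = sqrt (V2 {1..M}) / (\<Prod>x\<in>{1..M}. fact x) * (V2 L / (\<Prod>x\<in>L. cross_prod M x))"
      using word_count_complement[of L M] L unfolding cN by simp
    also have "(1 - p) ^ ?N * fact ?N / card (networks M) * ?r ^ ?s * (sqrt (V2 {1..M}) / (\<Prod>x\<in>{1..M}. fact x) * (V2 L / (\<Prod>x\<in>L. cross_prod M x)))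
       = K * (V2 L * (?r ^ ?s / (\<Prod>x\<in>L. cross_prod M x)))"
      unfolding K_def by (simp add: mult_ac)
    also have "?r ^ ?s / (\<Prod>x\<in>L. cross_prod M x) = (\<Prod>x\<in>L. site_weight M ?r x)"
      unfolding site_weight_def by (simp add: power_sum prod_dividef)
    finally show ?thesis by (simp add: wt_def)
  qed
  ultimately show ?thesis by blast
qed

lemma EE_const:
  assumes "0 \<le> p" "p \<le> 1"
  shows "EE M p (\<lambda>_. c) = c"
proof -
  have "EE M p (\<lambda>_. c) = (\<Sum>m\<le>\<Sum>{1..M}. Bernstein (\<Sum>{1..M}) m p) * c"
    unfolding EE_def sum_distrib_right using card_networks[of M] by (intro sum.cong refl) simp
  then show ?thesis by simp
qed

text \<open>The size of the shape is the time, so its mean is the mean of the binomial variable.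
  This is the one moment that the loop equation takes as input.\<close>

lemma EE_size:
  shows "EE M p (\<lambda>L. \<Sum>x\<in>L. real x) = real (\<Sum>{1..M}) * p"
proof -
  have "EE M p (\<lambda>L. \<Sum>x\<in>L. real x) = (\<Sum>m\<le>\<Sum>{1..M}. Bernstein (\<Sum>{1..M}) m p * real m)"
    unfolding EE_def
  proof (intro sum.cong refl arg_cong2[where f = "(*)"])
    fix m assume m: "m \<in> {..\<Sum>{1..M}}"
    have "(\<Sum>w\<in>networks M. \<Sum>x\<in>shape w m. real x) = (\<Sum>w\<in>networks M. real m)"
    proof (intro sum.cong refl)
      fix w assume "w \<in> networks M"
      then have "\<Sum>(shape w m) = m" using m by (intro sum_shape) auto
      then show "(\<Sum>x\<in>shape w m. real x) = real m" by (simp flip: of_nat_sum)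
    qed
    then show "(\<Sum>w\<in>networks M. \<Sum>x\<in>shape w m. real x) / card (networks M) = real m"
      using card_networks[of M] by simp
  qed
  then show ?thesis using sum_k_Bernstein[of "\<Sum>{1..M}" p] by (simp add: mult.commute)
qed

lemma EE_add: "EE M p (\<lambda>L. f L + h L) = EE M p f + EE M p h"
  unfolding EE_eq_sum by (simp add: algebra_simps sum.distrib)

lemma EE_diff: "EE M p (\<lambda>L. f L - h L) = EE M p f - EE M p h"
  unfolding EE_eq_sum by (simp add: algebra_simps sum_subtractf)

lemma EE_cmult: "EE M p (\<lambda>L. c * f L) = c * EE M p f"
  unfolding EE_eq_sum by (simp add: sum_distrib_left mult_ac)

lemma EE_sum: "EE M p (\<lambda>L. \<Sum>i\<in>I. f i L) = (\<Sum>i\<in>I. EE M p (f i))"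
  unfolding EE_eq_sum sum_distrib_left by (rule sum.swap)

lemma EE_mono:
  assumes "0 \<le> p" "p \<le> 1" "\<And>L. L \<subseteq> {1..M} \<Longrightarrow> f L \<le> h L"
  shows "EE M p f \<le> EE M p h"
  unfolding EE_def using assms shape_subset
  by (intro sum_mono mult_left_mono divide_right_mono) (auto simp: Bernstein_nonneg)

lemma EE_cong:
  assumes "\<And>L. L \<subseteq> {1..M} \<Longrightarrow> f L = h L"
  shows "EE M p f = EE M p h"
  unfolding EE_eq_sum using assms by (intro sum.cong refl) auto

text \<open>\<open>loop_equation\<close> at \<open>r = p / (1 - p)\<close>, multiplied by
  \<open>1 - p\<close>; its hypothesis \<open>mean\<close> is \<open>EE_size\<close> together with
  \<open>(1 + r) * p = r\<close> and \<open>2 * N = M * (M + 1)\<close>.\<close>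

lemma EE_loop:
  assumes p: "0 < p" "p < 1" and T: "T > 0"
  shows "(1 - p) * T * EE M p (Fratio T) - p * (real M * (real M + 1) + T) * EE M p (\<lambda>L. 1 / Fratio T L) = (1 - 2 * p) * T"
proof -
  obtain K where K: "K > 0" "\<And>L. L \<in> Pow {1..M} \<Longrightarrow> PP M p L = K * wt (site_weight M (p / (1 - p))) L"
    using PP_eq[OF p] by blast
  let ?r = "p / (1 - p)"
  let ?w = "site_weight M ?r"
  have E: "EE M p f = K * (\<Sum>L\<in>Pow {1..M}. wt ?w L * f L)" for f
    unfolding EE_eq_sum sum_distrib_left by (intro sum.cong refl) (use K in auto)
  have Z: "K * (\<Sum>L\<in>Pow {1..M}. wt ?w L) = 1" using E[of "\<lambda>_. 1"] EE_const[of p M 1] p by simp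
  have N: "2 * real (\<Sum>{1..M}) = real M * (real M + 1)"
    by (induction M) (simp_all add: algebra_simps)
  have "K * (\<Sum>L\<in>Pow {1..M}. wt ?w L * (\<Sum>x\<in>L. real x)) = real (\<Sum>{1..M}) * p"
    using E[of "\<lambda>L. \<Sum>x\<in>L. real x"] EE_size[of M p] by simp
  then have "2 * (1 + ?r) * (K * (\<Sum>L\<in>Pow {1..M}. wt ?w L * (\<Sum>x\<in>L. real x))) = 2 * (1 + ?r) * (real (\<Sum>{1..M}) * p)"
    by (rule arg_cong)
  then have "K * (2 * (1 + ?r) * (\<Sum>L\<in>Pow {1..M}. wt ?w L * (\<Sum>x\<in>L. real x))) = (1 + ?r) * p * (2 * real (\<Sum>{1..M}))"
    by (simp only: mult_ac)
  also have "(1 + ?r) * p = ?r" using p by (simp add: field_simps)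
  also have "?r * (2 * real (\<Sum>{1..M})) = K * (?r * (real M * (real M + 1)) * (\<Sum>L\<in>Pow {1..M}. wt ?w L))"
    unfolding N using Z by (simp add: mult_ac)
  finally have mean: "2 * (1 + ?r) * (\<Sum>L\<in>Pow {1..M}. wt ?w L * (\<Sum>x\<in>L. real x)) = ?r * (real M * (real M + 1)) * (\<Sum>L\<in>Pow {1..M}. wt ?w L)"
    using K(1) mult_left_cancel[of K] by blast
  have gen: "(1 - p) * T * (K * a) - ((1 - p) * r) * c * (K * b) = K * (1 - p) * (T * a - r * c * b)" for a b c r
    by (simp add: algebra_simps)
  have L: "T * (\<Sum>L\<in>Pow {1..M}. wt ?w L * Fratio T L) - ?r * (real M * (real M + 1) + T) * (\<Sum>L\<in>Pow {1..M}. wt ?w L / Fratio T L)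
     = (1 - ?r) * T * (\<Sum>L\<in>Pow {1..M}. wt ?w L)"
    by (rule loop_equation[OF site_weight_rec mean T])
  have "(1 - p) * T * EE M p (Fratio T) - ((1 - p) * ?r) * (real M * (real M + 1) + T) * EE M p (\<lambda>L. 1 / Fratio T L)
     = ((1 - p) * (1 - ?r)) * T * (K * (\<Sum>L\<in>Pow {1..M}. wt ?w L))"
  proof -
    have "EE M p (\<lambda>L. 1 / Fratio T L) = K * (\<Sum>L\<in>Pow {1..M}. wt ?w L / Fratio T L)" unfolding E by simp
    then show ?thesis unfolding E[of "Fratio T"] by (simp only: gen L) (simp only: mult_ac)
  qed
  moreover have "(1 - p) * ?r = p" "(1 - p) * (1 - ?r) = 1 - 2 * p" using p by (auto simp: field_simps)
  ultimately show ?thesis unfolding Z by simp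
qed

section \<open>Variance of linear statistics\<close>

definition marginal :: "nat \<Rightarrow> real \<Rightarrow> nat \<Rightarrow> real" where
  "marginal M p y = EE M p (\<lambda>L. if y \<in> L then 1 else 0)"

lemma marginal_bounds: "0 \<le> p \<Longrightarrow> p \<le> 1 \<Longrightarrow> 0 \<le> marginal M p y \<and> marginal M p y \<le> 1"
  unfolding marginal_def using EE_mono[of p M "\<lambda>L. 0" "\<lambda>L. if y \<in> L then 1 else 0"] EE_mono[of p M "\<lambda>L. if y \<in> L then 1 else 0" "\<lambda>L. 1"]
  by (auto simp: EE_const)

lemma sum_over_subset:
  fixes f :: "nat \<Rightarrow> real"
  assumes "L \<subseteq> {1..M}"
  shows "(\<Sum>y\<in>L. f y) = (\<Sum>y\<in>{1..M}. f y * (if y \<in> L then 1 else 0))"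
proof -
  have "(\<Sum>y\<in>{1..M}. f y * (if y \<in> L then 1 else 0)) = (\<Sum>y\<in>{1..M}. if y \<in> L then f y else 0)"
    by (intro sum.cong) auto
  also have "\<dots> = (\<Sum>y\<in>{1..M} \<inter> L. f y)" by (simp add: sum.inter_restrict)
  also have "{1..M} \<inter> L = L" using assms by auto
  finally show ?thesis by simp
qed

lemma EE_linear_stat: "EE M p (\<lambda>L. \<Sum>y\<in>L. \<phi> y) = (\<Sum>y\<in>{1..M}. \<phi> y * marginal M p y)"
proof -
  have "EE M p (\<lambda>L. \<Sum>y\<in>L. \<phi> y) = EE M p (\<lambda>L. \<Sum>y\<in>{1..M}. \<phi> y * (if y \<in> L then 1 else 0))"
    by (rule EE_cong) (rule sum_over_subset)
  then show ?thesis by (simp add: EE_sum EE_cmult marginal_def del: mult.right_neutral mult_zero_right mult_1_right if_distrib)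
qed

lemma pair_neg_corr:
  assumes p: "0 < p" "p < 1" and xy: "x \<in> {1..M}" "y \<in> {1..M}" "x \<noteq> y"
  shows "EE M p (\<lambda>L. if x \<in> L \<and> y \<in> L then 1 else 0) \<le> marginal M p x * marginal M p y"
proof -
  obtain K where K: "K > 0" "\<And>L. L \<in> Pow {1..M} \<Longrightarrow> PP M p L = K * wt (site_weight M (p / (1 - p))) L"
    using PP_eq[OF p] by blast
  let ?w = "site_weight M (p / (1 - p))"
  have E: "EE M p f = K * (\<Sum>L\<in>Pow {1..M}. wt ?w L * f L)" for f
    unfolding EE_eq_sum sum_distrib_left by (intro sum.cong refl) (use K in auto)
  have Z: "K * (\<Sum>L\<in>Pow {1..M}. wt ?w L) = 1" using E[of "\<lambda>_. 1"] EE_const[of p M 1] p by simp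
  have I: "EE M p (\<lambda>L. if Q L then 1 else 0) = K * (\<Sum>L | L \<subseteq> {1..M} \<and> Q L. wt ?w L)" for Q
  proof -
    have "(\<Sum>L\<in>Pow {1..M}. wt ?w L * (if Q L then 1 else 0)) = (\<Sum>L\<in>Pow {1..M}. if Q L then wt ?w L else 0)"
      by (intro sum.cong) auto
    also have "\<dots> = (\<Sum>L | L \<subseteq> {1..M} \<and> Q L. wt ?w L)"
      by (simp add: sum.inter_filter[symmetric] Pow_def)
    finally show ?thesis unfolding E by simp
  qed
  have "(\<Sum>L\<in>Pow {1..M}. wt ?w L) * (\<Sum>L | L \<subseteq> {1..M} \<and> x \<in> L \<and> y \<in> L. wt ?w L) \<le>
     (\<Sum>L | L \<subseteq> {1..M} \<and> x \<in> L. wt ?w L) * (\<Sum>L | L \<subseteq> {1..M} \<and> y \<in> L. wt ?w L)"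
    using xy p by (intro wt_neg_corr site_weight_nonneg) auto
  then have "(K * K) * ((\<Sum>L\<in>Pow {1..M}. wt ?w L) * (\<Sum>L | L \<subseteq> {1..M} \<and> x \<in> L \<and> y \<in> L. wt ?w L)) \<le>
     (K * K) * ((\<Sum>L | L \<subseteq> {1..M} \<and> x \<in> L. wt ?w L) * (\<Sum>L | L \<subseteq> {1..M} \<and> y \<in> L. wt ?w L))"
    using K(1) by (intro mult_left_mono) auto
  then have "(K * (\<Sum>L\<in>Pow {1..M}. wt ?w L)) * (K * (\<Sum>L | L \<subseteq> {1..M} \<and> x \<in> L \<and> y \<in> L. wt ?w L)) \<le>
     (K * (\<Sum>L | L \<subseteq> {1..M} \<and> x \<in> L. wt ?w L)) * (K * (\<Sum>L | L \<subseteq> {1..M} \<and> y \<in> L. wt ?w L))"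
    by (simp add: mult_ac)
  then show ?thesis unfolding Z marginal_def I by simp
qed

text \<open>For nonnegative \<open>\<phi>\<close> the covariances of distinct sites are at most 0,
  so only the diagonal remains, where an indicator has second moment at most 1.\<close>

lemma variance_bound:
  assumes p: "0 < p" "p < 1" and \<phi>: "\<And>y. y \<in> {1..M} \<Longrightarrow> \<phi> y \<ge> 0"
  shows "EE M p (\<lambda>L. ((\<Sum>y\<in>L. \<phi> y) - EE M p (\<lambda>L. \<Sum>y\<in>L. \<phi> y))\<^sup>2) \<le> (\<Sum>y\<in>{1..M}. (\<phi> y)\<^sup>2)"
proof -
  let ?S = "{1..M}"
  let ?m = "marginal M p"
  define \<mu> where "\<mu> = EE M p (\<lambda>L. \<Sum>y\<in>L. \<phi> y)"
  have mu: "\<mu> = (\<Sum>y\<in>?S. \<phi> y * ?m y)" unfolding \<mu>_def by (rule EE_linear_stat)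
  have "EE M p (\<lambda>L. (\<Sum>y\<in>L. \<phi> y)\<^sup>2) = EE M p (\<lambda>L. \<Sum>x\<in>?S. \<Sum>y\<in>?S. \<phi> x * \<phi> y * (if x \<in> L \<and> y \<in> L then 1 else 0))"
  proof (rule EE_cong)
    fix L assume L: "L \<subseteq> {1..M}"
    show "(\<Sum>y\<in>L. \<phi> y)\<^sup>2 = (\<Sum>x\<in>?S. \<Sum>y\<in>?S. \<phi> x * \<phi> y * (if x \<in> L \<and> y \<in> L then 1 else 0))"
      unfolding sum_over_subset[OF L] power2_eq_square sum_product by (intro sum.cong refl) auto
  qed
  also have "\<dots> = (\<Sum>x\<in>?S. \<Sum>y\<in>?S. \<phi> x * \<phi> y * EE M p (\<lambda>L. if x \<in> L \<and> y \<in> L then 1 else 0))"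
    by (simp add: EE_sum EE_cmult del: mult.right_neutral mult_zero_right mult_1_right if_distrib)
  also have "\<dots> \<le> (\<Sum>x\<in>?S. \<Sum>y\<in>?S. (\<phi> x * ?m x) * (\<phi> y * ?m y) + (if x = y then (\<phi> x)\<^sup>2 else 0))"
  proof (intro sum_mono)
    fix x y assume xy: "x \<in> ?S" "y \<in> ?S"
    have b: "0 \<le> ?m x" "?m x \<le> 1" using marginal_bounds[of p M x] p by auto
    show "\<phi> x * \<phi> y * EE M p (\<lambda>L. if x \<in> L \<and> y \<in> L then 1 else 0) \<le> (\<phi> x * ?m x) * (\<phi> y * ?m y) + (if x = y then (\<phi> x)\<^sup>2 else 0)"
    proof (cases "x = y")
      case True
      have "(\<phi> x)\<^sup>2 * ?m x \<le> (\<phi> x)\<^sup>2 * 1" using b by (intro mult_left_mono) auto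
      moreover have "0 \<le> (\<phi> x * ?m x)\<^sup>2" by simp
      ultimately have "(\<phi> x)\<^sup>2 * ?m x \<le> (\<phi> x * ?m x)\<^sup>2 + (\<phi> x)\<^sup>2" by linarith
      then show ?thesis using True by (simp add: marginal_def power2_eq_square)
    next
      case False
      have "\<phi> x * \<phi> y * EE M p (\<lambda>L. if x \<in> L \<and> y \<in> L then 1 else 0) \<le> \<phi> x * \<phi> y * (?m x * ?m y)"
        using \<phi> xy False by (intro mult_left_mono pair_neg_corr p) auto
      then show ?thesis using False by (simp add: mult_ac)
    qed
  qed
  also have "\<dots> = \<mu>\<^sup>2 + (\<Sum>y\<in>?S. (\<phi> y)\<^sup>2)"
    by (simp add: sum.distrib mu power2_eq_square sum_product)
  finally have "EE M p (\<lambda>L. (\<Sum>y\<in>L. \<phi> y)\<^sup>2) \<le> \<mu>\<^sup>2 + (\<Sum>y\<in>?S. (\<phi> y)\<^sup>2)" .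
  moreover have "EE M p (\<lambda>L. ((\<Sum>y\<in>L. \<phi> y) - \<mu>)\<^sup>2) = EE M p (\<lambda>L. (\<Sum>y\<in>L. \<phi> y)\<^sup>2) - \<mu>\<^sup>2"
  proof -
    have "EE M p (\<lambda>L. ((\<Sum>y\<in>L. \<phi> y) - \<mu>)\<^sup>2) = EE M p (\<lambda>L. (\<Sum>y\<in>L. \<phi> y)\<^sup>2 - (2 * \<mu>) * (\<Sum>y\<in>L. \<phi> y) + \<mu>\<^sup>2)"
      by (rule EE_cong) (simp add: power2_diff)
    also have "\<dots> = EE M p (\<lambda>L. (\<Sum>y\<in>L. \<phi> y)\<^sup>2) - 2 * \<mu> * \<mu> + \<mu>\<^sup>2"
      using p by (simp add: EE_add EE_diff EE_cmult EE_const flip: \<mu>_def)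
    finally show ?thesis by (simp add: power2_eq_square)
  qed
  ultimately show ?thesis unfolding \<mu>_def[symmetric] by linarith
qed

section \<open>Test functions determining a density\<close>

text \<open>The limit of \<open>n * ln\<close> of one factor of \<open>F\<close> at
  \<open>T = \<tau>^2 * n^2\<close> and part \<open>y = v * n\<close>.\<close>

definition kern :: "real \<Rightarrow> real \<Rightarrow> real" where
  "kern \<tau> v = 2 * v / (\<tau>\<^sup>2 + v\<^sup>2)"

context
  fixes d :: "nat \<Rightarrow> nat \<Rightarrow> real" and C :: real
  assumes d_bound: "\<And>n y. \<bar>d n y\<bar> \<le> C"
begin

text \<open>In the application \<open>d n y\<close> is the probability that \<open>y\<close> is a
  part minus the candidate density. Test functions are written \<open>v * \<psi> (v^2)\<close>
  because every \<open>kern \<tau>\<close> has this form, which reduces the question to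
  approximating \<open>\<psi>\<close> uniformly on \<open>[0, 1]\<close>.\<close>

definition wsum :: "(real \<Rightarrow> real) \<Rightarrow> nat \<Rightarrow> real" where
  "wsum \<psi> n = (\<Sum>y=1..n. d n y * (real y / real n * \<psi> ((real y / real n)\<^sup>2))) / real n"

lemma C_nonneg: "C \<ge> 0"
  using d_bound[of 0 0] by linarith

lemma wsum_bound:
  assumes "\<And>u. 0 \<le> u \<Longrightarrow> u \<le> 1 \<Longrightarrow> \<bar>\<psi> u\<bar> \<le> e"
  shows "\<bar>wsum \<psi> n\<bar> \<le> C * e"
proof -
  have e: "e \<ge> 0" using assms[of 0] by linarith
  have "\<bar>\<Sum>y=1..n. d n y * (real y / real n * \<psi> ((real y / real n)\<^sup>2))\<bar> \<le> (\<Sum>y=1..n. C * e)"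
  proof (rule order_trans[OF sum_abs], rule sum_mono)
    fix y assume y: "y \<in> {1..n}"
    then have v: "0 \<le> real y / real n" "real y / real n \<le> 1" by auto
    then have "(real y / real n)\<^sup>2 \<le> 1" by (simp add: power_le_one)
    then have "\<bar>\<psi> ((real y / real n)\<^sup>2)\<bar> \<le> e" by (intro assms) auto
    then have "\<bar>real y / real n\<bar> * \<bar>\<psi> ((real y / real n)\<^sup>2)\<bar> \<le> 1 * e" using v by (intro mult_mono) auto
    then show "\<bar>d n y * (real y / real n * \<psi> ((real y / real n)\<^sup>2))\<bar> \<le> C * e"
      unfolding abs_mult using d_bound C_nonneg by (intro mult_mono) auto
  qed
  from divide_right_mono[OF this, of "real n"]
  have "\<bar>wsum \<psi> n\<bar> \<le> (\<Sum>y=1..n. C * e) / real n"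
    unfolding wsum_def abs_divide abs_of_nat by simp
  also have "\<dots> = (real n * (C * e)) / real n" by simp
  also have "\<dots> \<le> C * e" using e C_nonneg by (cases "n = 0") auto
  finally show ?thesis .
qed

lemma wsum_add: "wsum (\<lambda>u. \<psi> u + \<eta> u) n = wsum \<psi> n + wsum \<eta> n"
  unfolding wsum_def by (simp add: algebra_simps sum.distrib add_divide_distrib)

lemma wsum_cmult: "wsum (\<lambda>u. c * \<psi> u) n = c * wsum \<psi> n"
  unfolding wsum_def by (simp add: sum_distrib_left mult_ac)

lemma wsum_sum: "finite I \<Longrightarrow> wsum (\<lambda>u. \<Sum>i\<in>I. c i * \<psi> i u) n = (\<Sum>i\<in>I. c i * wsum (\<psi> i) n)"
proof (induction I rule: finite_induct)
  case empty then show ?case by (simp add: wsum_def)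
next
  case (insert i I)
  then show ?case by (simp add: wsum_add wsum_cmult)
qed

lemma wsum_closure:
  assumes "\<And>e. e > 0 \<Longrightarrow> \<exists>\<psi>. wsum \<psi> \<longlonglongrightarrow> 0 \<and> (\<forall>u. 0 \<le> u \<and> u \<le> 1 \<longrightarrow> \<bar>\<phi> u - \<psi> u\<bar> \<le> e)"
  shows "wsum \<phi> \<longlonglongrightarrow> 0"
proof (rule LIMSEQ_I)
  fix r :: real assume r: "r > 0"
  define e where "e = r / (2 * (C + 1))"
  have e: "e > 0" "C * e < r / 2" using r C_nonneg by (auto simp: e_def field_simps)
  obtain \<psi> where \<psi>: "wsum \<psi> \<longlonglongrightarrow> 0" "\<And>u. 0 \<le> u \<Longrightarrow> u \<le> 1 \<Longrightarrow> \<bar>\<phi> u - \<psi> u\<bar> \<le> e"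
    using assms[OF e(1)] by blast
  obtain N where N: "\<And>n. n \<ge> N \<Longrightarrow> norm (wsum \<psi> n - 0) < r / 2"
    using LIMSEQ_D[OF \<psi>(1), of "r/2"] r by auto
  have "norm (wsum \<phi> n - 0) < r" if "n \<ge> N" for n
  proof -
    have "wsum \<phi> n = wsum (\<lambda>u. \<phi> u - \<psi> u) n + wsum \<psi> n"
      by (simp flip: wsum_add)
    moreover have "\<bar>wsum (\<lambda>u. \<phi> u - \<psi> u) n\<bar> \<le> C * e" using \<psi>(2) by (rule wsum_bound)
    ultimately show ?thesis using N[OF that] e by simp
  qed
  then show "\<exists>N. \<forall>n\<ge>N. norm (wsum \<phi> n - 0) < r" by blast
qed

text \<open>The kernels supply \<open>1 / (1 + s * u)\<close> for \<open>s > 0\<close>, with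
  \<open>\<tau> = 1 / sqrt s\<close>. Letting \<open>s\<close> tend to 0 extracts the powers of
  \<open>u\<close> one after the other, and Weierstrass approximation gives all continuous
  functions.\<close>

lemma wsum_continuous:
  assumes ker: "\<And>\<tau>. \<tau> > 0 \<Longrightarrow> (\<lambda>n. (\<Sum>y=1..n. d n y * kern \<tau> (real y / real n)) / real n) \<longlonglongrightarrow> 0"
    and cont: "continuous_on {0..1} \<phi>"
  shows "wsum \<phi> \<longlonglongrightarrow> 0"
proof -
  have A: "wsum (\<lambda>u. 1 / (1 + s * u)) \<longlonglongrightarrow> 0" if s: "s > 0" for s
  proof -
    have e: "real y / real n * (1 / (1 + s * (real y / real n)\<^sup>2)) = 1 / (2 * s) * kern (1 / sqrt s) (real y / real n)" for y n
    proof -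
      have "1 + s * v\<^sup>2 > 0" for v :: real using s by (simp add: add_pos_nonneg)
      then have "v * (1 / (1 + s * v\<^sup>2)) = 1 / (2 * s) * kern (1 / sqrt s) v" for v
        using s by (simp add: kern_def power_divide divide_simps) (simp add: algebra_simps)
      then show ?thesis .
    qed
    have "wsum (\<lambda>u. 1 / (1 + s * u)) n = 1 / (2 * s) * ((\<Sum>y=1..n. d n y * kern (1 / sqrt s) (real y / real n)) / real n)" for n
      unfolding wsum_def e by (simp add: sum_distrib_left mult_ac)
    then have f: "wsum (\<lambda>u. 1 / (1 + s * u)) = (\<lambda>n. 1 / (2 * s) * ((\<Sum>y=1..n. d n y * kern (1 / sqrt s) (real y / real n)) / real n))"
      by (rule ext)
    have "(\<lambda>n. (\<Sum>y=1..n. d n y * kern (1 / sqrt s) (real y / real n)) / real n) \<longlonglongrightarrow> 0"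
      using s by (intro ker) simp
    then show ?thesis unfolding f by (rule tendsto_mult_right_zero)
  qed
  have B: "wsum (\<lambda>u. u ^ j) \<longlonglongrightarrow> 0" for j
  proof (induction j rule: less_induct)
    case (less j)
    show ?case
    proof (rule wsum_closure)
      fix e :: real assume e: "e > 0"
      \<comment> \<open>Subtracting the first \<open>j\<close> terms of the geometric series from
        \<open>1 / (1 + e * u)\<close> leaves \<open>(- e * u) ^ j / (1 + e * u)\<close>; dividing
        by \<open>(- e) ^ j\<close> gives \<open>u ^ j / (1 + e * u)\<close>, within
        \<open>e\<close> of \<open>u ^ j\<close>.\<close>
      define c where "c = (1 / (- e) ^ j)"
      define \<psi> where "\<psi> = (\<lambda>u. c * (1 / (1 + e * u)) + (\<Sum>i\<in>{..<j}. (- c * (- e) ^ i) * u ^ i))"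
      have "wsum \<psi> = (\<lambda>n. c * wsum (\<lambda>u. 1 / (1 + e * u)) n + (\<Sum>i\<in>{..<j}. (- c * (- e) ^ i) * wsum (\<lambda>u. u ^ i) n))"
        unfolding \<psi>_def by (rule ext) (simp only: wsum_add wsum_cmult wsum_sum finite_lessThan)
      moreover have "\<dots> \<longlonglongrightarrow> c * 0 + (\<Sum>i\<in>{..<j}. (- c * (- e) ^ i) * 0)"
        using less A[OF e] by (intro tendsto_intros) auto
      ultimately have "wsum \<psi> \<longlonglongrightarrow> 0" by simp
      moreover have "\<bar>u ^ j - \<psi> u\<bar> \<le> e" if u: "0 \<le> u" "u \<le> 1" for u
      proof -
        have p: "1 + e * u > 0" using e u by (simp add: add_pos_nonneg)
        have "(1 - (- e * u)) * (\<Sum>i<j. (- e * u) ^ i) = 1 - (- e * u) ^ j"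
          by (rule one_diff_power_eq[symmetric])
        then have "(1 + e * u) * (\<Sum>i<j. (- e * u) ^ i) = 1 - (- e * u) ^ j" by simp
        then have g: "(\<Sum>i<j. (- e * u) ^ i) = (1 - (- e * u) ^ j) / (1 + e * u)"
          using p by (simp add: field_simps)
        have "(\<Sum>i\<in>{..<j}. (- c * (- e) ^ i) * u ^ i) = - c * (\<Sum>i<j. (- e * u) ^ i)"
          by (simp only: sum_distrib_left power_mult_distrib mult.assoc)
        then have "\<psi> u = c * ((- e * u) ^ j / (1 + e * u))"
          unfolding \<psi>_def g by (simp add: diff_divide_distrib algebra_simps)
        also have "\<dots> = u ^ j / (1 + e * u)"
          using e unfolding c_def power_mult_distrib by simp
        finally have "u ^ j - \<psi> u = u ^ j * (e * u) / (1 + e * u)" using p by (simp add: field_simps)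
        moreover have "0 \<le> u ^ j * (e * u) / (1 + e * u)" using p e u by simp
        moreover have "u ^ j * (e * u) / (1 + e * u) \<le> e"
        proof -
          have "u ^ j * (e * u) \<le> 1 * (e * 1)" using u e by (intro mult_mono power_le_one) auto
          also have "\<dots> \<le> e * (1 + e * u)" using u e by (simp add: algebra_simps)
          finally show ?thesis using p by (simp add: pos_divide_le_eq)
        qed
        ultimately show ?thesis by linarith
      qed
      ultimately show "\<exists>\<psi>. wsum \<psi> \<longlonglongrightarrow> 0 \<and> (\<forall>u. 0 \<le> u \<and> u \<le> 1 \<longrightarrow> \<bar>u ^ j - \<psi> u\<bar> \<le> e)" by blast
    qed
  qed
  show ?thesis
  proof (rule wsum_closure)
    fix e :: real assume e: "e > 0"
    obtain P where P: "real_polynomial_function P" "\<And>u. u \<in> {0..1} \<Longrightarrow> \<bar>\<phi> u - P u\<bar> < e"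
      using Stone_Weierstrass_real_polynomial_function[OF _ cont e] by auto
    obtain a N where aN: "P = (\<lambda>x. \<Sum>i\<le>N. a i * x ^ i)"
      using P(1) unfolding real_polynomial_function_iff_sum by blast
    have "wsum P = (\<lambda>n. \<Sum>i\<le>N. a i * wsum (\<lambda>x. x ^ i) n)"
      unfolding aN by (rule ext) (rule wsum_sum, simp)
    moreover have "\<dots> \<longlonglongrightarrow> (\<Sum>i\<le>N. a i * 0)" by (intro tendsto_intros B)
    ultimately have "wsum P \<longlonglongrightarrow> 0" by simp
    then show "\<exists>\<psi>. wsum \<psi> \<longlonglongrightarrow> 0 \<and> (\<forall>u. 0 \<le> u \<and> u \<le> 1 \<longrightarrow> \<bar>\<phi> u - \<psi> u\<bar> \<le> e)"
      using P(2) by (intro exI[of _ P]) (auto intro: less_imp_le)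
  qed
qed

text \<open>The indicator of \<open>v > x\<close> differs from a continuous ramp only on a window of
  width \<open>\<delta>\<close>, which holds at most \<open>\<delta> * n + 1\<close> grid points,
  each with a coefficient of size at most \<open>C\<close>.\<close>

lemma tail_sum_tendsto:
  assumes ker: "\<And>\<tau>. \<tau> > 0 \<Longrightarrow> (\<lambda>n. (\<Sum>y=1..n. d n y * kern \<tau> (real y / real n)) / real n) \<longlonglongrightarrow> 0"
    and x: "x > 0"
  shows "(\<lambda>n. (\<Sum>y=1..n. if x < real y / real n then d n y else 0) / real n) \<longlonglongrightarrow> 0"
proof (rule LIMSEQ_I)
  fix r :: real assume r: "r > 0"
  define \<delta> where "\<delta> = r / (4 * (C + 1))"
  have \<delta>: "\<delta> > 0" "C * \<delta> \<le> r / 4" using r C_nonneg by (auto simp: \<delta>_def field_simps)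
  \<comment> \<open>Here \<open>v * \<psi> (v^2)\<close> rises linearly from 0 at \<open>x\<close>
    to 1 at \<open>x + \<delta>\<close>; dividing by \<open>max (sqrt u) x\<close> instead of
    \<open>sqrt u\<close> keeps \<open>\<psi>\<close> continuous at 0, where the numerator vanishes
    anyway.\<close>
  define \<psi> where "\<psi> = (\<lambda>u. max 0 (min 1 ((sqrt u - x) / \<delta>)) / max (sqrt u) x)"
  have "continuous_on {0..1} \<psi>" unfolding \<psi>_def using x \<delta> by (intro continuous_intros) auto
  then have "wsum \<psi> \<longlonglongrightarrow> 0" using ker by (rule wsum_continuous[rotated])
  then obtain N1 where N1: "\<And>n. n \<ge> N1 \<Longrightarrow> norm (wsum \<psi> n - 0) < r / 2"
    using LIMSEQ_D[of "wsum \<psi>" 0 "r/2"] r by auto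
  obtain N2 :: nat where N2: "real N2 > 4 * (C + 1) / r" using reals_Archimedean2 by blast
  have "norm ((\<Sum>y=1..n. if x < real y / real n then d n y else 0) / real n - 0) < r" if n: "n \<ge> max 1 (max N1 N2)" for n
  proof -
    let ?v = "\<lambda>y. real y / real n"
    let ?I = "\<lambda>y. if x < ?v y then d n y else 0"
    have n0: "real n > 0" using n by simp
    have nN2: "C / real n < r / 4"
    proof -
      have "4 * (C + 1) / r < real n" using N2 n by linarith
      then have "4 * (C + 1) < real n * r" using r by (simp add: field_simps)
      then show ?thesis using n0 C_nonneg by (simp add: field_simps)
    qed
    have in_win: "\<bar>?I y - d n y * (?v y * \<psi> ((?v y)\<^sup>2))\<bar> \<le> (if x < ?v y \<and> ?v y \<le> x + \<delta> then C else 0)" if y: "y \<in> {1..n}" for y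
    proof -
      have v: "?v y \<ge> 0" by simp
      have ps: "v * \<psi> (v\<^sup>2) = (if x < v then max 0 (min 1 ((v - x) / \<delta>)) else 0)" if "v \<ge> 0" for v
      proof (cases "x < v")
        case True
        then show ?thesis using that x unfolding \<psi>_def by (simp add: max_absorb1)
      next
        case False
        then have "(v - x) / \<delta> \<le> 0" using \<delta> by (simp add: divide_nonpos_pos)
        then show ?thesis using False that unfolding \<psi>_def by (simp add: max_def min_def)
      qed
      note ps = ps[OF v]
      show ?thesis
      proof (cases "x < ?v y \<and> ?v y \<le> x + \<delta>")
        case True
        define z where "z = max 0 (min 1 ((?v y - x) / \<delta>))"
        have z: "0 \<le> z" "z \<le> 1" by (auto simp: z_def)
        have "\<bar>d n y - d n y * z\<bar> = \<bar>d n y\<bar> * \<bar>1 - z\<bar>" by (simp add: abs_mult[symmetric] algebra_simps)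
        also have "\<dots> \<le> C * 1" using d_bound z C_nonneg by (intro mult_mono) auto
        finally show ?thesis using True unfolding ps z_def by simp
      next
        case False
        show ?thesis
        proof (cases "x < ?v y")
          case True
          then have "(?v y - x) / \<delta> \<ge> 1" using False \<delta> by (simp add: field_simps)
          then have "max 0 (min 1 ((?v y - x) / \<delta>)) = 1" by (simp add: min_def max_def)
          then show ?thesis using True False unfolding ps by simp
        qed (use False ps in auto)
      qed
    qed
    have "\<bar>(\<Sum>y=1..n. ?I y) - (\<Sum>y=1..n. d n y * (?v y * \<psi> ((?v y)\<^sup>2)))\<bar> \<le> (\<Sum>y=1..n. if x < ?v y \<and> ?v y \<le> x + \<delta> then C else 0)"
      unfolding sum_subtractf[symmetric] by (rule order_trans[OF sum_abs]) (intro sum_mono in_win)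
    also have "\<dots> = C * real (card {y\<in>{1..n}. x < ?v y \<and> ?v y \<le> x + \<delta>})"
      by (simp add: sum.If_cases Int_def mult.commute)
    also have "\<dots> \<le> C * (\<delta> * real n + 1)"
    proof (rule mult_left_mono[OF _ C_nonneg])
      let ?lo = "nat \<lfloor>x * real n\<rfloor>" and ?hi = "nat \<lfloor>(x + \<delta>) * real n\<rfloor>"
      have "{y\<in>{1..n}. x < ?v y \<and> ?v y \<le> x + \<delta>} \<subseteq> {?lo<..?hi}"
      proof
        fix y assume "y \<in> {y\<in>{1..n}. x < ?v y \<and> ?v y \<le> x + \<delta>}"
        then have "x * real n < real y" "real y \<le> (x + \<delta>) * real n" using n0 by (auto simp: field_simps)
        then show "y \<in> {?lo<..?hi}" using x n0 \<delta>
          by (auto simp: nat_less_iff floor_less_iff le_nat_floor)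
      qed
      then have "card {y\<in>{1..n}. x < ?v y \<and> ?v y \<le> x + \<delta>} \<le> card {?lo<..?hi}" by (rule card_mono[rotated]) simp
      then have "card {y\<in>{1..n}. x < ?v y \<and> ?v y \<le> x + \<delta>} \<le> ?hi - ?lo" by simp
      moreover have "real (?hi - ?lo) \<le> \<delta> * real n + 1"
      proof -
        have "x * real n \<le> (x + \<delta>) * real n" using \<delta> n0 by (intro mult_right_mono) auto
        then have "?lo \<le> ?hi" by (intro nat_mono floor_mono)
        then have "real (?hi - ?lo) = real ?hi - real ?lo" by (simp add: of_nat_diff)
        moreover have "real ?hi \<le> (x + \<delta>) * real n" using x \<delta> n0 by simp
        moreover have "real ?lo \<ge> x * real n - 1" using x n0 by linarith
        ultimately show ?thesis by (simp add: algebra_simps)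
      qed
      ultimately show "real (card {y\<in>{1..n}. x < ?v y \<and> ?v y \<le> x + \<delta>}) \<le> \<delta> * real n + 1" by linarith
    qed
    finally have "\<bar>(\<Sum>y=1..n. ?I y) - (\<Sum>y=1..n. d n y * (?v y * \<psi> ((?v y)\<^sup>2)))\<bar> / real n \<le> C * (\<delta> * real n + 1) / real n"
      using n0 by (intro divide_right_mono) auto
    also have "\<dots> = C * \<delta> + C / real n" using n0 by (simp add: field_simps)
    also have "\<dots> < r / 2" using nN2 \<delta> by linarith
    finally have "\<bar>(\<Sum>y=1..n. ?I y) / real n - wsum \<psi> n\<bar> < r / 2"
      using n0 unfolding wsum_def by (simp add: diff_divide_distrib[symmetric] abs_divide)
    moreover have "\<bar>wsum \<psi> n\<bar> < r / 2" using N1[of n] n by simp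
    ultimately show ?thesis unfolding real_norm_def diff_0_right by linarith
  qed
  then show "\<exists>N. \<forall>n\<ge>N. norm ((\<Sum>y=1..n. if x < real y / real n then d n y else 0) / real n - 0) < r" by blast
qed

end

section \<open>The limit profile\<close>

definition clip :: "real \<Rightarrow> real \<Rightarrow> real" where
  "clip x t = max (- sqrt (1 - x\<^sup>2)) (min (sqrt (1 - x\<^sup>2)) t)"

text \<open>The parameter \<open>t\<close> is \<open>1 - 2 * \<alpha>\<close>. Clipping makes the arcsine form valid on the flat pieces of
  the limit shape as well.\<close>
definition profile :: "real \<Rightarrow> real \<Rightarrow> real" where
  "profile t x = x / pi * arcsin (clip x t * x / (sqrt (1 - (clip x t)\<^sup>2) * sqrt (1 - x\<^sup>2)))
     + 1/2 - 1 / pi * arcsin (clip x t / sqrt (1 - x\<^sup>2)) - x / 2"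

text \<open>Minus the derivative of \<open>profile\<close> in \<open>t\<close>: a semicircle in
  \<open>x\<close> of radius \<open>sqrt (1 - t^2)\<close>, continued by 0 over the flat pieces
  through \<open>max 0\<close>.\<close>

definition profile_rate :: "real \<Rightarrow> real \<Rightarrow> real" where
  "profile_rate t x = sqrt (max 0 (1 - t\<^sup>2 - x\<^sup>2)) / (pi * (1 - t\<^sup>2))"

lemma sq_less_1: "\<bar>t\<bar> < 1 \<Longrightarrow> t\<^sup>2 < 1" for t :: real
  by (simp add: abs_square_less_1)

lemma abs_less_sqrt: "\<bar>t\<bar> < sqrt a \<longleftrightarrow> t\<^sup>2 < a" for t a :: real
  by (metis real_sqrt_abs real_sqrt_less_iff)

text \<open>In \<open>arcsin (a / b) = arctan (a / sqrt (b^2 - a^2))\<close> both arcsine terms lead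
  to the same root \<open>sqrt (1 - t^2 - x^2)\<close>. This is the form that gets differentiated
  and compared with \<open>g\<close>.\<close>

lemma profile_arctan:
  assumes "0 \<le> x" "\<bar>t\<bar> < sqrt (1 - x\<^sup>2)"
  shows "profile t x = x / pi * arctan (t * x / sqrt (1 - t\<^sup>2 - x\<^sup>2)) + 1/2 - 1 / pi * arctan (t / sqrt (1 - t\<^sup>2 - x\<^sup>2)) - x / 2"
proof -
  have s: "t\<^sup>2 < 1 - x\<^sup>2" using assms(2) by (simp add: abs_less_sqrt)
  then have p: "1 - x\<^sup>2 > 0" "1 - t\<^sup>2 > 0" "1 - t\<^sup>2 - x\<^sup>2 > 0" using zero_le_power2[of t] zero_le_power2[of x] by linarith+
  have c: "clip x t = t" using assms(2) by (auto simp: clip_def)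
  have at: "arcsin (a / b) = arctan (a / sqrt (b\<^sup>2 - a\<^sup>2))" if "b > 0" "a\<^sup>2 < b\<^sup>2" for a b :: real
  proof -
    have "\<bar>a\<bar> < b" using that power2_less_imp_less[of "\<bar>a\<bar>" b] by simp
    then have ab: "-1 < a / b" "a / b < 1" using that by (auto simp: field_simps)
    have "1 - (a / b)\<^sup>2 = (b\<^sup>2 - a\<^sup>2) / b\<^sup>2" using that by (simp add: power_divide field_simps)
    then have "sqrt (1 - (a / b)\<^sup>2) = sqrt (b\<^sup>2 - a\<^sup>2) / b" using that by (simp add: real_sqrt_divide)
    then show ?thesis using that arcsin_arctan[OF ab] by simp
  qed
  have b1: "(sqrt (1 - t\<^sup>2) * sqrt (1 - x\<^sup>2))\<^sup>2 = (1 - t\<^sup>2) * (1 - x\<^sup>2)" using p by (simp add: power_mult_distrib)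
  have "arcsin (t * x / (sqrt (1 - t\<^sup>2) * sqrt (1 - x\<^sup>2))) = arctan (t * x / sqrt ((1 - t\<^sup>2) * (1 - x\<^sup>2) - (t * x)\<^sup>2))"
    using at[of "sqrt (1 - t\<^sup>2) * sqrt (1 - x\<^sup>2)" "t * x"] p unfolding b1 by (simp add: power_mult_distrib algebra_simps)
  also have "(1 - t\<^sup>2) * (1 - x\<^sup>2) - (t * x)\<^sup>2 = 1 - t\<^sup>2 - x\<^sup>2" by (simp add: power_mult_distrib algebra_simps)
  finally have 1: "arcsin (t * x / (sqrt (1 - t\<^sup>2) * sqrt (1 - x\<^sup>2))) = arctan (t * x / sqrt (1 - t\<^sup>2 - x\<^sup>2))" .
  have 2: "arcsin (t / sqrt (1 - x\<^sup>2)) = arctan (t / sqrt (1 - t\<^sup>2 - x\<^sup>2))"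
    using at[of "sqrt (1 - x\<^sup>2)" t] p s by (simp add: algebra_simps)
  show ?thesis unfolding profile_def c 1 2 ..
qed

lemma clip_upper: "t \<ge> sqrt (1 - x\<^sup>2) \<Longrightarrow> \<bar>x\<bar> \<le> 1 \<Longrightarrow> clip x t = sqrt (1 - x\<^sup>2)"
  by (simp add: clip_def max_def min_def abs_square_le_1 power2_le_iff_abs_le)

lemma clip_lower:
  assumes "t \<le> - sqrt (1 - x\<^sup>2)" "\<bar>x\<bar> \<le> 1" shows "clip x t = - sqrt (1 - x\<^sup>2)"
proof -
  have "sqrt (1 - x\<^sup>2) \<ge> 0" using assms by (simp add: abs_square_le_1)
  then show ?thesis using assms unfolding clip_def by linarith
qed

text \<open>Once \<open>clip\<close> is saturated, \<open>sqrt (1 - (clip x t)^2) = x\<close>, so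
  both arcsine arguments are 1, or both are -1.\<close>

lemma profile_saturated:
  assumes x: "0 < x" "x \<le> 1"
  shows "t \<ge> sqrt (1 - x\<^sup>2) \<Longrightarrow> profile t x = 0"
    and "t \<le> - sqrt (1 - x\<^sup>2) \<Longrightarrow> profile t x = 1 - x"
proof -
  have x2: "x\<^sup>2 \<le> 1" using x by (simp add: power_le_one)
  have c2: "sqrt (1 - (sqrt (1 - x\<^sup>2))\<^sup>2) = x" using x x2 by simp
  show "profile t x = 0" if "t \<ge> sqrt (1 - x\<^sup>2)"
  \<comment> \<open>At \<open>x = 1\<close> the denominators vanish; division by 0 returns 0, and
    the profile is \<open>1/2 - 1/2\<close>.\<close>
  proof (cases "x = 1")
    case True
    have "clip 1 t = 0" using that clip_upper[of 1 t] True by simp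
    then show ?thesis using True by (simp add: profile_def)
  next
    case False
    then have "x\<^sup>2 < 1" using x sq_less_1[of x] by simp
    then have p: "sqrt (1 - x\<^sup>2) > 0" by simp
    have c: "clip x t = sqrt (1 - x\<^sup>2)" using that x by (intro clip_upper) auto
    show ?thesis unfolding profile_def c c2 using p x by simp
  qed
  show "profile t x = 1 - x" if "t \<le> - sqrt (1 - x\<^sup>2)"
  proof (cases "x = 1")
    case True
    have "clip 1 t = 0" using that clip_lower[of t 1] True by simp
    then show ?thesis using True by (simp add: profile_def)
  next
    case False
    then have "x\<^sup>2 < 1" using x sq_less_1[of x] by simp
    then have p: "sqrt (1 - x\<^sup>2) > 0" by simp
    have c: "clip x t = - sqrt (1 - x\<^sup>2)" using that x by (intro clip_lower) auto
    have c2': "sqrt (1 - (- sqrt (1 - x\<^sup>2))\<^sup>2) = x" using c2 by simp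
    show ?thesis unfolding profile_def c c2' using p x by simp
  qed
qed

lemma clip_bounds:
  assumes "\<bar>x\<bar> \<le> 1"
  shows "- sqrt (1 - x\<^sup>2) \<le> clip x t" "clip x t \<le> sqrt (1 - x\<^sup>2)" "(clip x t)\<^sup>2 \<le> 1 - x\<^sup>2" "(clip x t)\<^sup>2 \<le> t\<^sup>2"
proof -
  have x2: "x\<^sup>2 \<le> 1" using assms by (simp add: abs_square_le_1)
  then have s: "sqrt (1 - x\<^sup>2) \<ge> 0" by simp
  show 1: "- sqrt (1 - x\<^sup>2) \<le> clip x t" "clip x t \<le> sqrt (1 - x\<^sup>2)" using s by (auto simp: clip_def)
  then have "\<bar>clip x t\<bar> \<le> sqrt (1 - x\<^sup>2)" by linarith
  then have "(clip x t)\<^sup>2 \<le> (sqrt (1 - x\<^sup>2))\<^sup>2" by (metis abs_ge_zero power2_abs power_mono)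
  then show "(clip x t)\<^sup>2 \<le> 1 - x\<^sup>2" using x2 by simp
  have "\<bar>clip x t\<bar> \<le> \<bar>t\<bar>" using s unfolding clip_def by linarith
  then show "(clip x t)\<^sup>2 \<le> t\<^sup>2" by (simp add: abs_le_square_iff)
qed

lemma unit_interval_quotient:
  fixes a b :: real
  assumes "a\<^sup>2 \<le> b\<^sup>2" "b \<ge> 0"
  shows "-1 \<le> a / b \<and> a / b \<le> 1"
proof -
  have "\<bar>a\<bar> \<le> b" using assms by (metis abs_le_square_iff abs_of_nonneg)
  then show ?thesis by (cases "b = 0") (auto simp: field_simps)
qed

lemma profile_args:
  assumes x: "\<bar>x\<bar> \<le> 1"
  shows "-1 \<le> clip x t * x / (sqrt (1 - (clip x t)\<^sup>2) * sqrt (1 - x\<^sup>2)) \<and> clip x t * x / (sqrt (1 - (clip x t)\<^sup>2) * sqrt (1 - x\<^sup>2)) \<le> 1"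
    and "-1 \<le> clip x t / sqrt (1 - x\<^sup>2) \<and> clip x t / sqrt (1 - x\<^sup>2) \<le> 1"
proof -
  have x2: "x\<^sup>2 \<le> 1" using x by (simp add: abs_square_le_1)
  note b = clip_bounds[OF x, of t]
  have c1: "(clip x t)\<^sup>2 \<le> 1" using b(3) zero_le_power2[of x] by linarith
  show "-1 \<le> clip x t / sqrt (1 - x\<^sup>2) \<and> clip x t / sqrt (1 - x\<^sup>2) \<le> 1"
    using b x2 by (intro unit_interval_quotient) auto
  show "-1 \<le> clip x t * x / (sqrt (1 - (clip x t)\<^sup>2) * sqrt (1 - x\<^sup>2)) \<and> clip x t * x / (sqrt (1 - (clip x t)\<^sup>2) * sqrt (1 - x\<^sup>2)) \<le> 1"
  proof (rule unit_interval_quotient)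
    have "(clip x t * x)\<^sup>2 \<le> (1 - (clip x t)\<^sup>2) * (1 - x\<^sup>2)" using b by (simp add: power_mult_distrib algebra_simps)
    then show "(clip x t * x)\<^sup>2 \<le> (sqrt (1 - (clip x t)\<^sup>2) * sqrt (1 - x\<^sup>2))\<^sup>2" using c1 x2 by (simp add: power_mult_distrib)
  qed (use c1 x2 in simp)
qed

lemma continuous_clip: "continuous_on A (\<lambda>t. clip x t)"
  unfolding clip_def by (intro continuous_intros)

lemma continuous_profile_param:
  assumes x: "0 \<le> x" "x \<le> 1" and ab: "-1 < a" "b < 1"
  shows "continuous_on {a..b} (\<lambda>t. profile t x)"
proof -
  have x1: "\<bar>x\<bar> \<le> 1" using x by simp
  have nz: "sqrt (1 - (clip x t)\<^sup>2) \<noteq> 0" if "t \<in> {a..b}" for t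
  proof -
    have "t\<^sup>2 < 1" using that ab by (intro sq_less_1) auto
    then show ?thesis using clip_bounds(4)[OF x1, of t] by simp
  qed
  show ?thesis
  proof (cases "x = 1")
    case True
    have "clip 1 t = 0" for t using clip_bounds[of 1 t] by simp
    then show ?thesis unfolding True profile_def by simp
  next
    case False
    then have "x\<^sup>2 < 1" using x by (intro sq_less_1) auto
    then have "sqrt (1 - x\<^sup>2) \<noteq> 0" by simp
    then show ?thesis unfolding profile_def using nz profile_args[OF x1]
      by (intro continuous_intros continuous_on_arcsin' continuous_clip) auto
  qed
qed

text \<open>With \<open>s = sqrt (1 - t^2 - x^2)\<close> the arctangents contribute
  \<open>x^2 / (s * (1 - t^2))\<close> and \<open>- 1 / s\<close>, up to \<open>1 / pi\<close>;
  their sum is \<open>- s / (1 - t^2)\<close>, so the singularity at the edge \<open>s = 0\<close>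
  cancels.\<close>

lemma DERIV_profile_param:
  assumes x: "0 \<le> x" and t: "\<bar>t\<bar> < sqrt (1 - x\<^sup>2)"
  shows "((\<lambda>t. profile t x) has_real_derivative - profile_rate t x) (at t)"
proof -
  have s2: "t\<^sup>2 < 1 - x\<^sup>2" using t by (simp add: abs_less_sqrt)
  then have p: "1 - x\<^sup>2 > 0" "1 - t\<^sup>2 > 0" "1 - t\<^sup>2 - x\<^sup>2 > 0" using zero_le_power2[of t] zero_le_power2[of x] by linarith+
  define s where "s = sqrt (1 - t\<^sup>2 - x\<^sup>2)"
  have s: "s > 0" "s\<^sup>2 = 1 - t\<^sup>2 - x\<^sup>2" using p by (auto simp: s_def)
  have ds: "((\<lambda>t. sqrt (1 - t\<^sup>2 - x\<^sup>2)) has_real_derivative - t / s) (at t)"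
    using p unfolding s_def by (auto intro!: derivative_eq_intros simp: field_simps)
  have d1: "((\<lambda>t. t * x / sqrt (1 - t\<^sup>2 - x\<^sup>2)) has_real_derivative x * (1 - x\<^sup>2) / s ^ 3) (at t)"
  proof -
    have "((\<lambda>t. t * x / sqrt (1 - t\<^sup>2 - x\<^sup>2)) has_real_derivative (x * s - t * x * (- t / s)) / (s * s)) (at t)"
      using DERIV_divide[OF DERIV_cmult_right[OF DERIV_ident, of x] ds] s by (simp flip: s_def)
    moreover have "(x * s - t * x * (- t / s)) / (s * s) = x * (s\<^sup>2 + t\<^sup>2) / s ^ 3"
      using s(1) by (simp add: divide_simps power2_eq_square power3_eq_cube) (simp add: algebra_simps)
    ultimately show ?thesis unfolding s(2) by simp
  qed
  have d2: "((\<lambda>t. t / sqrt (1 - t\<^sup>2 - x\<^sup>2)) has_real_derivative (1 - x\<^sup>2) / s ^ 3) (at t)"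
  proof -
    have "((\<lambda>t. t / sqrt (1 - t\<^sup>2 - x\<^sup>2)) has_real_derivative (s - t * (- t / s)) / (s * s)) (at t)"
      using DERIV_divide[OF DERIV_ident ds] s by (simp flip: s_def)
    moreover have "(s - t * (- t / s)) / (s * s) = (s\<^sup>2 + t\<^sup>2) / s ^ 3"
      using s(1) by (simp add: divide_simps power2_eq_square power3_eq_cube)
    ultimately show ?thesis unfolding s(2) by simp
  qed
  have e1: "x * (1 - x\<^sup>2) / s ^ 3 / (1 + (t * x / s)\<^sup>2) = x / (s * (1 - t\<^sup>2))"
  proof -
    have "1 + (t * x / s)\<^sup>2 = (s\<^sup>2 + (t * x)\<^sup>2) / s\<^sup>2" using s(1) by (simp add: power_divide field_simps)
    also have "s\<^sup>2 + (t * x)\<^sup>2 = (1 - t\<^sup>2) * (1 - x\<^sup>2)" unfolding s(2) by (simp add: power_mult_distrib algebra_simps)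
    finally have *: "1 + (t * x / s)\<^sup>2 = (1 - t\<^sup>2) * (1 - x\<^sup>2) / s\<^sup>2" .
    have "x * b / s ^ 3 / (a * b / s\<^sup>2) = x / (s * a)" if "a \<noteq> 0" "b \<noteq> 0" for a b
      using s(1) that by (simp add: divide_simps power2_eq_square power3_eq_cube)
    note key = this
    show ?thesis unfolding * by (rule key) (use p in auto)
  qed
  have e2: "(1 - x\<^sup>2) / s ^ 3 / (1 + (t / s)\<^sup>2) = 1 / s"
  proof -
    have "1 + (t / s)\<^sup>2 = (s\<^sup>2 + t\<^sup>2) / s\<^sup>2" using s(1) by (simp add: power_divide field_simps)
    then have *: "1 + (t / s)\<^sup>2 = (1 - x\<^sup>2) / s\<^sup>2" unfolding s(2) by simp
    have "b / s ^ 3 / (b / s\<^sup>2) = 1 / s" if "b \<noteq> 0" for b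
      using s(1) that by (simp add: divide_simps power2_eq_square power3_eq_cube)
    note key = this
    show ?thesis unfolding * by (rule key) (use p in auto)
  qed
  have f1: "((\<lambda>t. arctan (t * x / sqrt (1 - t\<^sup>2 - x\<^sup>2))) has_real_derivative x / (s * (1 - t\<^sup>2))) (at t)"
    using DERIV_chain2[OF DERIV_arctan d1] unfolding e1[symmetric] s_def[symmetric] by (simp add: field_simps)
  have f2: "((\<lambda>t. arctan (t / sqrt (1 - t\<^sup>2 - x\<^sup>2))) has_real_derivative 1 / s) (at t)"
    using DERIV_chain2[OF DERIV_arctan d2] unfolding e2[symmetric] s_def[symmetric] by (simp add: field_simps)
  have "((\<lambda>t. x / pi * arctan (t * x / sqrt (1 - t\<^sup>2 - x\<^sup>2)) + 1/2 - 1 / pi * arctan (t / sqrt (1 - t\<^sup>2 - x\<^sup>2)) - x / 2)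
      has_real_derivative x / pi * (x / (s * (1 - t\<^sup>2))) + 0 - 1 / pi * (1 / s) - 0) (at t)"
    by (intro DERIV_diff DERIV_add DERIV_cmult DERIV_const f1 f2)
  moreover have "x / pi * (x / (s * (1 - t\<^sup>2))) - 1 / pi * (1 / s) = - profile_rate t x"
  proof -
    have q: "profile_rate t x = s / (pi * (1 - t\<^sup>2))" using p unfolding profile_rate_def s_def by (simp add: max_def)
    have "x / P * (x / (s * a)) - 1 / P * (1 / s) = (x\<^sup>2 - a) / (P * s * a)" if "a \<noteq> 0" "P \<noteq> 0" for a P
      using s(1) that by (simp add: divide_simps power2_eq_square)
    note key = this
    have ss: "- (s * s) = x\<^sup>2 - (1 - t\<^sup>2)" using s(2) by (simp add: power2_eq_square)
    have "x / pi * (x / (s * (1 - t\<^sup>2))) - 1 / pi * (1 / s) = (- (s * s)) / (pi * s * (1 - t\<^sup>2))"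
      unfolding ss by (rule key) (use p in auto)
    then show ?thesis unfolding q using s(1) by simp
  qed
  ultimately have D: "((\<lambda>t. x / pi * arctan (t * x / sqrt (1 - t\<^sup>2 - x\<^sup>2)) + 1/2 - 1 / pi * arctan (t / sqrt (1 - t\<^sup>2 - x\<^sup>2)) - x / 2)
      has_real_derivative - profile_rate t x) (at t)" by simp
  show ?thesis
  proof (rule DERIV_cong_ev[THEN iffD1, OF refl _ refl D])
    have "\<forall>\<^sub>F u in nhds t. u \<in> {- sqrt (1 - x\<^sup>2)<..<sqrt (1 - x\<^sup>2)}"
      using t by (intro eventually_nhds_in_open) auto
    then show "\<forall>\<^sub>F u in nhds t. x / pi * arctan (u * x / sqrt (1 - u\<^sup>2 - x\<^sup>2)) + 1/2 - 1 / pi * arctan (u / sqrt (1 - u\<^sup>2 - x\<^sup>2)) - x / 2 = profile u x"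
      by eventually_elim (use x in \<open>subst profile_arctan; auto\<close>)
  qed
qed

text \<open>The derivative is known inside the curved region and on both flat pieces; the two edges
  \<open>t = -c\<close> and \<open>t = c\<close> are exceptional points, across which
  \<open>profile\<close> is continuous.\<close>

lemma profile_rate_has_integral:
  assumes x: "0 \<le> x" "x \<le> 1" and ab: "-1 < a" "a \<le> b" "b < 1"
  shows "((\<lambda>t. profile_rate t x) has_integral profile a x - profile b x) {a..b}"
proof -
  define c where "c = sqrt (1 - x\<^sup>2)"
  have x2: "x\<^sup>2 \<le> 1" using x by (simp add: power_le_one)
  have "((\<lambda>t. profile_rate t x) has_integral (- profile b x) - (- profile a x)) {a..b}"
  proof (rule fundamental_theorem_of_calculus_interior_strong[where S = "{-c, c}"])
    show "continuous_on {a..b} (\<lambda>t. - profile t x)"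
      using continuous_profile_param[OF x, of a b] ab by (intro continuous_on_minus) auto
    fix t assume t: "t \<in> {a<..<b} - {-c, c}"
    have c0: "c \<ge> 0" using x2 by (simp add: c_def)
    consider "\<bar>t\<bar> < c" | "t > c" | "t < - c" using t by force
    then show "((\<lambda>t. - profile t x) has_vector_derivative profile_rate t x) (at t)"
    proof cases
      case 1
      then have "((\<lambda>t. profile t x) has_real_derivative - profile_rate t x) (at t)" using x by (intro DERIV_profile_param) (auto simp: c_def)
      from DERIV_minus[OF this] show ?thesis by (simp add: has_real_derivative_iff_has_vector_derivative)
    next
      case 2
      have q: "profile_rate t x = 0"
      proof -
        have "c\<^sup>2 \<le> t\<^sup>2" using 2 c0 by (intro power_mono) auto
        then show ?thesis using x2 by (simp add: profile_rate_def c_def)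
      qed
      have "\<forall>\<^sub>F u in nhds t. u \<in> {c<..}" using 2 by (intro eventually_nhds_in_open) auto
      then have "\<forall>\<^sub>F u in nhds t. - profile t x = - profile u x"
        by eventually_elim (use 2 x in \<open>simp add: profile_def clip_upper c_def\<close>)
      from DERIV_cong_ev[THEN iffD1, OF refl this refl DERIV_const]
      show ?thesis unfolding q by (simp add: has_real_derivative_iff_has_vector_derivative)
    next
      case 3
      have q: "profile_rate t x = 0"
      proof -
        have "c\<^sup>2 \<le> (- t)\<^sup>2" using 3 c0 by (intro power_mono) auto
        then show ?thesis using x2 by (simp add: profile_rate_def c_def)
      qed
      have "\<forall>\<^sub>F u in nhds t. u \<in> {..<- c}" using 3 by (intro eventually_nhds_in_open) auto
      then have "\<forall>\<^sub>F u in nhds t. - profile t x = - profile u x"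
        by eventually_elim (use 3 x in \<open>simp add: profile_def clip_lower c_def\<close>)
      from DERIV_cong_ev[THEN iffD1, OF refl this refl DERIV_const]
      show ?thesis unfolding q by (simp add: has_real_derivative_iff_has_vector_derivative)
    qed
  qed (use ab in auto)
  then show ?thesis by simp
qed

lemma profile_0: "0 \<le> x \<Longrightarrow> x \<le> 1 \<Longrightarrow> profile 0 x = (1 - x) / 2"
proof -
  assume x: "0 \<le> x" "x \<le> 1"
  then have "x\<^sup>2 \<le> 1" by (simp add: power_le_one)
  then have "clip x 0 = 0" by (simp add: clip_def)
  then show ?thesis by (simp add: profile_def field_simps)
qed

lemma profile_at_1: "profile t 1 = 0"
proof -
  have "clip 1 t = 0" by (simp add: clip_def)
  then show ?thesis by (simp add: profile_def)
qed

text \<open>The derivatives of the two arctangents cancel, each being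
  \<open>t * x / (s * (1 - x^2))\<close> up to \<open>1 / pi\<close>, so only the derivative of the
  explicit factors \<open>x\<close> remains.\<close>

lemma DERIV_profile_space:
  assumes x: "0 < x" and t: "\<bar>t\<bar> < sqrt (1 - x\<^sup>2)"
  shows "((\<lambda>x. profile t x) has_real_derivative 1 / pi * arctan (t * x / sqrt (1 - t\<^sup>2 - x\<^sup>2)) - 1/2) (at x)"
proof -
  have s2: "t\<^sup>2 < 1 - x\<^sup>2" using t by (simp add: abs_less_sqrt)
  then have p: "1 - x\<^sup>2 > 0" "1 - t\<^sup>2 > 0" "1 - t\<^sup>2 - x\<^sup>2 > 0" using zero_le_power2[of t] zero_le_power2[of x] by linarith+
  define s where "s = sqrt (1 - t\<^sup>2 - x\<^sup>2)"
  have s: "s > 0" "s\<^sup>2 = 1 - t\<^sup>2 - x\<^sup>2" using p by (auto simp: s_def)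
  have ds: "((\<lambda>x. sqrt (1 - t\<^sup>2 - x\<^sup>2)) has_real_derivative - x / s) (at x)"
    using p unfolding s_def by (auto intro!: derivative_eq_intros simp: field_simps)
  have d1: "((\<lambda>x. t * x / sqrt (1 - t\<^sup>2 - x\<^sup>2)) has_real_derivative t * (1 - t\<^sup>2) / s ^ 3) (at x)"
  proof -
    have "((\<lambda>x. t * x / sqrt (1 - t\<^sup>2 - x\<^sup>2)) has_real_derivative (t * s - t * x * (- x / s)) / (s * s)) (at x)"
      using DERIV_divide[OF DERIV_cmult[OF DERIV_ident, of t] ds] s by (simp flip: s_def)
    moreover have "(t * s - t * x * (- x / s)) / (s * s) = t * (s\<^sup>2 + x\<^sup>2) / s ^ 3"
      using s(1) by (simp add: divide_simps power2_eq_square power3_eq_cube) (simp add: algebra_simps)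
    ultimately show ?thesis unfolding s(2) by simp
  qed
  have d2: "((\<lambda>x. t / sqrt (1 - t\<^sup>2 - x\<^sup>2)) has_real_derivative t * x / s ^ 3) (at x)"
  proof -
    have "((\<lambda>x. t / sqrt (1 - t\<^sup>2 - x\<^sup>2)) has_real_derivative (0 * s - t * (- x / s)) / (s * s)) (at x)"
      using DERIV_divide[OF DERIV_const ds, of t] s by (simp flip: s_def)
    moreover have "(0 * s - t * (- x / s)) / (s * s) = t * x / s ^ 3"
      using s(1) by (simp add: divide_simps power2_eq_square power3_eq_cube)
    ultimately show ?thesis by (simp only:)
  qed
  have e1: "t * (1 - t\<^sup>2) / s ^ 3 / (1 + (t * x / s)\<^sup>2) = t / (s * (1 - x\<^sup>2))"
  proof -
    have "1 + (t * x / s)\<^sup>2 = (s\<^sup>2 + (t * x)\<^sup>2) / s\<^sup>2" using s(1) by (simp add: power_divide field_simps)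
    also have "s\<^sup>2 + (t * x)\<^sup>2 = (1 - t\<^sup>2) * (1 - x\<^sup>2)" unfolding s(2) by (simp add: power_mult_distrib algebra_simps)
    finally have *: "1 + (t * x / s)\<^sup>2 = (1 - t\<^sup>2) * (1 - x\<^sup>2) / s\<^sup>2" .
    have "t * a / s ^ 3 / (a * b / s\<^sup>2) = t / (s * b)" if "a \<noteq> 0" "b \<noteq> 0" for a b
      using s(1) that by (simp add: divide_simps power2_eq_square power3_eq_cube)
    note key = this
    show ?thesis unfolding * by (rule key) (use p in auto)
  qed
  have e2: "t * x / s ^ 3 / (1 + (t / s)\<^sup>2) = t * x / (s * (1 - x\<^sup>2))"
  proof -
    have "1 + (t / s)\<^sup>2 = (s\<^sup>2 + t\<^sup>2) / s\<^sup>2" using s(1) by (simp add: power_divide field_simps)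
    then have *: "1 + (t / s)\<^sup>2 = (1 - x\<^sup>2) / s\<^sup>2" unfolding s(2) by simp
    have "t * x / s ^ 3 / (b / s\<^sup>2) = t * x / (s * b)" if "b \<noteq> 0" for b
      using s(1) that by (simp add: divide_simps power2_eq_square power3_eq_cube)
    note key = this
    show ?thesis unfolding * by (rule key) (use p in auto)
  qed
  have f1: "((\<lambda>x. arctan (t * x / sqrt (1 - t\<^sup>2 - x\<^sup>2))) has_real_derivative t / (s * (1 - x\<^sup>2))) (at x)"
    using DERIV_chain2[OF DERIV_arctan d1] unfolding e1[symmetric] s_def[symmetric] by (simp add: field_simps)
  have f2: "((\<lambda>x. arctan (t / sqrt (1 - t\<^sup>2 - x\<^sup>2))) has_real_derivative t * x / (s * (1 - x\<^sup>2))) (at x)"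
    using DERIV_chain2[OF DERIV_arctan d2] unfolding e2[symmetric] s_def[symmetric] by (simp add: field_simps)
  have "((\<lambda>x. x / pi * arctan (t * x / sqrt (1 - t\<^sup>2 - x\<^sup>2)) + 1/2 - 1 / pi * arctan (t / sqrt (1 - t\<^sup>2 - x\<^sup>2)) - x / 2)
      has_real_derivative 1 / pi * arctan (t * x / sqrt (1 - t\<^sup>2 - x\<^sup>2)) + t / (s * (1 - x\<^sup>2)) * (x / pi) + 0
         - 1 / pi * (t * x / (s * (1 - x\<^sup>2))) - 1 / 2) (at x)"
    by (intro DERIV_diff DERIV_add DERIV_mult DERIV_cmult DERIV_const DERIV_cdivide DERIV_ident f1 f2)
  then have D: "((\<lambda>x. x / pi * arctan (t * x / sqrt (1 - t\<^sup>2 - x\<^sup>2)) + 1/2 - 1 / pi * arctan (t / sqrt (1 - t\<^sup>2 - x\<^sup>2)) - x / 2)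
      has_real_derivative 1 / pi * arctan (t * x / s) - 1/2) (at x)"
    by (simp add: s_def mult_ac)
  show ?thesis unfolding s_def[symmetric]
  proof (rule DERIV_cong_ev[THEN iffD1, OF refl _ refl D])
    have "open {u. u\<^sup>2 < 1 - t\<^sup>2}" by (intro open_Collect_less continuous_intros)
    then have "open ({0<..} \<inter> {u. u\<^sup>2 < 1 - t\<^sup>2})" by (intro open_Int) auto
    then have "\<forall>\<^sub>F u in nhds x. u \<in> {0<..} \<inter> {u. u\<^sup>2 < 1 - t\<^sup>2}"
      using x s2 by (intro eventually_nhds_in_open) auto
    then show "\<forall>\<^sub>F u in nhds x. u / pi * arctan (t * u / sqrt (1 - t\<^sup>2 - u\<^sup>2)) + 1/2 - 1 / pi * arctan (t / sqrt (1 - t\<^sup>2 - u\<^sup>2)) - u / 2 = profile t u"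
      by eventually_elim (subst profile_arctan; auto simp: abs_less_sqrt)
  qed
qed

text \<open>The slope lies between -1 and 0: in the curved region because an arctangent is below
  \<open>pi / 2\<close> in absolute value, and on the flat pieces because the profile is 0 or
  \<open>1 - x\<close>. In terms of parts, the limiting density is at most 1.\<close>

lemma profile_lipschitz:
  assumes t: "\<bar>t\<bar> < 1" and x: "0 \<le> x" "x \<le> y" "y \<le> 1"
  shows "\<bar>profile t x - profile t y\<bar> \<le> y - x"
\<comment> \<open>For \<open>t = 0\<close> the edge \<open>b\<close> would be 1, where the
  denominators of \<open>profile\<close> vanish, so this case uses the explicit linear form.\<close>
proof (cases "t = 0")
  case True
  then show ?thesis using x by (simp add: profile_0 field_simps)
next
  case False
  define b where "b = sqrt (1 - t\<^sup>2)"
  have t2: "t\<^sup>2 < 1" using t by (rule sq_less_1)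
  have b: "0 < b" "b < 1" "b\<^sup>2 = 1 - t\<^sup>2" using t2 False by (auto simp: b_def)
  have lo: "\<bar>profile t u - profile t v\<bar> \<le> v - u" if uv: "0 \<le> u" "u \<le> v" "v \<le> b" for u v
  proof (cases "u = v")
    case False
    then have "u < v" using uv by simp
    moreover have "continuous_on {u..v} (profile t)"
    proof -
      have w: "0 \<le> w" "w \<le> b" "\<bar>w\<bar> \<le> 1" if "w \<in> {u..v}" for w using that uv b by auto
      have "w\<^sup>2 < 1" if "w \<in> {u..v}" for w
        using w[OF that] b by (intro sq_less_1) auto
      then have 1: "sqrt (1 - w\<^sup>2) \<noteq> 0" if "w \<in> {u..v}" for w using that by fastforce
      have 2: "sqrt (1 - (clip w t)\<^sup>2) \<noteq> 0" if "w \<in> {u..v}" for w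
        using clip_bounds(4)[OF w(3)[OF that], of t] t2 by auto
      have 3: "continuous_on {u..v} (\<lambda>w. clip w t)" unfolding clip_def by (intro continuous_intros)
      show ?thesis unfolding profile_def
        using 1 2 profile_args w by (intro continuous_intros continuous_on_arcsin' 3) auto
    qed
    moreover have D: "(profile t has_real_derivative 1 / pi * arctan (t * z / sqrt (1 - t\<^sup>2 - z\<^sup>2)) - 1/2) (at z)" if "u < z" "z < v" for z
    proof (rule DERIV_profile_space)
      have "z\<^sup>2 < b\<^sup>2" using that uv by (intro power_strict_mono) auto
      then show "\<bar>t\<bar> < sqrt (1 - z\<^sup>2)" unfolding b abs_less_sqrt by simp
    qed (use that uv in auto)
    ultimately obtain l z where z: "u < z" "z < v" "(profile t has_real_derivative l) (at z)" "profile t v - profile t u = (v - u) * l"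
      using MVT[of u v "profile t"] by (metis real_differentiable_def)
    then have "l = 1 / pi * arctan (t * z / sqrt (1 - t\<^sup>2 - z\<^sup>2)) - 1/2" using D DERIV_unique by blast
    moreover have "\<bar>1 / pi * arctan (t * z / sqrt (1 - t\<^sup>2 - z\<^sup>2))\<bar> \<le> 1 / 2"
      using arctan_bounded[of "t * z / sqrt (1 - t\<^sup>2 - z\<^sup>2)"] pi_gt_zero by (simp add: abs_mult field_simps) linarith
    ultimately have "\<bar>l\<bar> \<le> 1" by linarith
    then have "\<bar>v - u\<bar> * \<bar>l\<bar> \<le> (v - u) * 1" using uv by (intro mult_mono) auto
    then show ?thesis using z(4) by (simp add: abs_mult[symmetric] abs_minus_commute[of "profile t u"])
  qed simp
  have hi: "\<bar>profile t u - profile t v\<bar> \<le> v - u" if uv: "b \<le> u" "u \<le> v" "v \<le> 1" for u v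
  proof -
    have v: "sqrt (1 - w\<^sup>2) \<le> \<bar>t\<bar>" if "b \<le> w" for w
    proof -
      have "b\<^sup>2 \<le> w\<^sup>2" using that b by (intro power_mono) auto
      then have "sqrt (1 - w\<^sup>2) \<le> sqrt (t\<^sup>2)" unfolding b by (intro real_sqrt_le_mono) simp
      then show ?thesis by simp
    qed
    show ?thesis
    proof (cases "t > 0")
      case True
      then have "profile t u = 0" "profile t v = 0" using uv b v[of u] v[of v] profile_saturated(1)[of u t] profile_saturated(1)[of v t] by auto
      then show ?thesis using uv by simp
    next
      case F: False
      then have "profile t u = 1 - u" "profile t v = 1 - v" using uv b v[of u] v[of v] False
        by (auto intro!: profile_saturated(2))
      then show ?thesis using uv by simp
    qed
  qed
  consider "y \<le> b" | "b \<le> x" | "x \<le> b" "b \<le> y" by linarith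
  then show ?thesis
  proof cases
    case 3
    have "\<bar>profile t x - profile t b\<bar> \<le> b - x" using 3 x by (intro lo) auto
    moreover have "\<bar>profile t b - profile t y\<bar> \<le> y - b" using 3 x by (intro hi) auto
    ultimately show ?thesis by linarith
  qed (use lo hi x in auto)
qed

lemma continuous_profile_space:
  assumes "\<bar>t\<bar> < 1"
  shows "continuous_on {0..1} (profile t)"
proof (rule continuous_onI)
  fix x e :: real assume "x \<in> {0..1}" "e > 0"
  have "dist (profile t y) (profile t x) \<le> dist y x" if "y \<in> {0..1}" for y
    using profile_lipschitz[OF assms, of x y] profile_lipschitz[OF assms, of y x] that \<open>x \<in> {0..1}\<close>
    by (cases "x \<le> y") (auto simp: dist_real_def)
  then show "\<exists>d>0. \<forall>y\<in>{0..1}. dist y x < d \<longrightarrow> dist (profile t y) (profile t x) \<le> e"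
    using \<open>e > 0\<close> by (intro exI[of _ e]) force
qed

section \<open>Integrals of the profile against the kernels\<close>

definition kern_deriv :: "real \<Rightarrow> real \<Rightarrow> real" where
  "kern_deriv \<tau> x = 2 * (\<tau>\<^sup>2 - x\<^sup>2) / (\<tau>\<^sup>2 + x\<^sup>2)\<^sup>2"

lemma DERIV_kern: "\<tau> > 0 \<Longrightarrow> (kern \<tau> has_real_derivative kern_deriv \<tau> x) (at x)"
proof -
  assume "\<tau> > 0"
  then have p: "\<tau>\<^sup>2 + x\<^sup>2 > 0" by (simp add: add_pos_nonneg)
  have "((\<lambda>v. 2 * v / (\<tau>\<^sup>2 + v\<^sup>2)) has_real_derivative (2 * (\<tau>\<^sup>2 + x\<^sup>2) - 2 * x * (2 * x)) / ((\<tau>\<^sup>2 + x\<^sup>2) * (\<tau>\<^sup>2 + x\<^sup>2))) (at x)"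
    using p by (auto intro!: derivative_eq_intros)
  then show ?thesis unfolding kern_def[abs_def] kern_deriv_def by (simp add: power2_eq_square algebra_simps)
qed

lemma kern_deriv_bound: "\<tau> > 0 \<Longrightarrow> \<bar>kern_deriv \<tau> x\<bar> \<le> 2 / \<tau>\<^sup>2"
proof -
  assume t: "\<tau> > 0"
  then have p: "\<tau>\<^sup>2 + x\<^sup>2 > 0" "\<tau>\<^sup>2 > 0" by (simp_all add: add_pos_nonneg)
  have "\<bar>kern_deriv \<tau> x\<bar> = 2 * \<bar>\<tau>\<^sup>2 - x\<^sup>2\<bar> / (\<tau>\<^sup>2 + x\<^sup>2)\<^sup>2" unfolding kern_deriv_def abs_divide abs_mult by simp
  also have "\<dots> \<le> 2 * (\<tau>\<^sup>2 + x\<^sup>2) / (\<tau>\<^sup>2 + x\<^sup>2)\<^sup>2"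
    using zero_le_power2[of x] p(2) by (intro divide_right_mono mult_left_mono) (auto simp: abs_le_iff)
  also have "\<dots> = 2 / (\<tau>\<^sup>2 + x\<^sup>2)"
  proof -
    have "2 * W / W\<^sup>2 = 2 / W" if "W > 0" for W :: real using that by (simp add: power2_eq_square)
    from this[OF p(1)] show ?thesis .
  qed
  also have "\<dots> \<le> 2 / \<tau>\<^sup>2" using p by (intro divide_left_mono) auto
  finally show ?thesis .
qed

lemma continuous_kern_deriv: "\<tau> > 0 \<Longrightarrow> continuous_on A (kern_deriv \<tau>)"
  unfolding kern_deriv_def[abs_def]
  by (intro continuous_intros) (metis add_pos_nonneg less_irrefl power2_eq_iff_nonneg zero_le_power2 zero_less_power power_not_zero)

text \<open>With \<open>t = 1 - 2 * p\<close>, the logarithm of the positive root \<open>f\<close>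
  of \<open>(1 - p) * \<tau>^2 * f - p * (1 + \<tau>^2) / f = (1 - 2 * p) * \<tau>^2\<close>, the
  limiting form of the loop equation.\<close>

definition log_root :: "real \<Rightarrow> real \<Rightarrow> real" where
  "log_root \<tau> t = ln ((t + sqrt (1 + (1 - t\<^sup>2) / \<tau>\<^sup>2)) / (1 + t))"

lemma kern_deriv_profile_rate_integral:
  assumes tau: "\<tau> > 0" and t: "\<bar>t\<bar> < 1"
  shows "((\<lambda>x. kern_deriv \<tau> x * profile_rate t x) has_integral (1 - 1 / sqrt (1 + (1 - t\<^sup>2) / \<tau>\<^sup>2)) / (1 - t\<^sup>2)) {0..1}"
proof -
  define \<beta> where "\<beta> = 1 - t\<^sup>2"
  have be: "0 < \<beta>" "\<beta> \<le> 1" using sq_less_1[OF t] by (auto simp: \<beta>_def)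
  define b where "b = sqrt \<beta>"
  have b: "0 < b" "b \<le> 1" "b\<^sup>2 = \<beta>" using be by (auto simp: b_def)
  define r where "r = sqrt (\<tau>\<^sup>2 + \<beta>)"
  have r: "r > 0" "r\<^sup>2 = \<tau>\<^sup>2 + \<beta>" using be by (auto simp: r_def add_nonneg_pos)
  \<comment> \<open>An explicit antiderivative. The first term is integration by parts; its error
    \<open>2 * x^2 / ((\<tau>^2 + x^2) * sqrt (\<beta> - x^2))\<close> splits as
    \<open>2 / sqrt (\<beta> - x^2)\<close> minus
    \<open>2 * \<tau>^2 / ((\<tau>^2 + x^2) * sqrt (\<beta> - x^2))\<close>, and both pieces
    integrate to arcsines.\<close>
  define A where "A = (\<lambda>x. kern \<tau> x * sqrt (\<beta> - x\<^sup>2) + 2 * arcsin (x / b) - (2 * \<tau> / r) * arcsin (x * r / (b * sqrt (\<tau>\<^sup>2 + x\<^sup>2))))"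
  have w0: "\<tau>\<^sup>2 + x\<^sup>2 > 0" for x using tau by (simp add: add_pos_nonneg)
  have arg2: "(x * r)\<^sup>2 \<le> (b * sqrt (\<tau>\<^sup>2 + x\<^sup>2))\<^sup>2" if "x\<^sup>2 \<le> \<beta>" for x
  proof -
    have "(b * sqrt (\<tau>\<^sup>2 + x\<^sup>2))\<^sup>2 - (x * r)\<^sup>2 = \<tau>\<^sup>2 * (\<beta> - x\<^sup>2)"
      using w0[of x] by (simp add: power_mult_distrib b r algebra_simps)
    moreover have "\<tau>\<^sup>2 * (\<beta> - x\<^sup>2) \<ge> 0" using that by simp
    ultimately show ?thesis by linarith
  qed
  have x2: "x\<^sup>2 \<le> \<beta>" if "0 \<le> x" "x \<le> b" for x
    using that b power_mono[of x b 2] by simp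
  have 1: "((\<lambda>x. kern_deriv \<tau> x * sqrt (\<beta> - x\<^sup>2)) has_integral A b - A 0) {0..b}"
  proof (rule fundamental_theorem_of_calculus_interior)
    show "0 \<le> b" using b by simp
    have "continuous_on {0..b} (kern \<tau>)"
      by (rule DERIV_continuous_on[OF has_field_derivative_at_within[OF DERIV_kern[OF tau]]])
    moreover have "\<forall>x\<in>{0..b}. -1 \<le> x / b \<and> x / b \<le> 1" using b by (auto simp: field_simps)
    moreover have "\<forall>x\<in>{0..b}. -1 \<le> x * r / (b * sqrt (\<tau>\<^sup>2 + x\<^sup>2)) \<and> x * r / (b * sqrt (\<tau>\<^sup>2 + x\<^sup>2)) \<le> 1"
      using b x2 by (intro ballI unit_interval_quotient arg2) auto
    moreover have "\<forall>x\<in>{0..b}. b * sqrt (\<tau>\<^sup>2 + x\<^sup>2) \<noteq> 0" using b w0 by (metis less_irrefl mult_eq_0_iff real_sqrt_eq_zero_cancel_iff)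
    ultimately show "continuous_on {0..b} A" unfolding A_def using b
      by (intro continuous_intros continuous_on_arcsin') auto
    fix x assume x: "x \<in> {0<..<b}"
    have "x\<^sup>2 < b\<^sup>2" using x by (intro power_strict_mono) auto
    then have xb: "\<beta> - x\<^sup>2 > 0" using b by simp
    define S where "S = sqrt (\<beta> - x\<^sup>2)"
    define w where "w = sqrt (\<tau>\<^sup>2 + x\<^sup>2)"
    have S: "S > 0" "S\<^sup>2 = \<beta> - x\<^sup>2" using xb by (auto simp: S_def)
    have w: "w > 0" "w\<^sup>2 = \<tau>\<^sup>2 + x\<^sup>2" using w0[of x] by (auto simp: w_def)
    have d1: "((\<lambda>x. sqrt (\<beta> - x\<^sup>2)) has_real_derivative - x / S) (at x)"
      using xb unfolding S_def by (auto intro!: derivative_eq_intros simp: field_simps)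
    have dw: "((\<lambda>x. sqrt (\<tau>\<^sup>2 + x\<^sup>2)) has_real_derivative x / w) (at x)"
      using w0[of x] unfolding w_def by (auto intro!: derivative_eq_intros simp: field_simps)
    have d2: "((\<lambda>x. arcsin (x / b)) has_real_derivative 1 / S) (at x)"
    proof -
      have lt: "-1 < x / b" "x / b < 1" using x b by (auto simp: field_simps)
      have "sqrt (1 - (x / b)\<^sup>2) = S / b"
      proof -
        have "1 - (x / b)\<^sup>2 = (\<beta> - x\<^sup>2) / b\<^sup>2" using b(1) unfolding b(3)[symmetric] by (simp add: power_divide diff_divide_distrib)
        then have "sqrt (1 - (x / b)\<^sup>2) = sqrt (\<beta> - x\<^sup>2) / sqrt (b\<^sup>2)" by (simp only: real_sqrt_divide)
        then show ?thesis using b(1) by (simp add: S_def)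
      qed
      then have "inverse (sqrt (1 - (x / b)\<^sup>2)) * (1 / b) = 1 / S" using b S by (simp add: field_simps)
      then show ?thesis using DERIV_chain2[OF DERIV_arcsin[OF lt] DERIV_cdivide[OF DERIV_ident]] by simp
    qed
    have d3: "((\<lambda>x. arcsin (x * r / (b * sqrt (\<tau>\<^sup>2 + x\<^sup>2)))) has_real_derivative r * \<tau> / (w\<^sup>2 * S)) (at x)"
    proof -
      let ?y = "x * r / (b * w)"
      have "1 - ?y\<^sup>2 = ((b * w)\<^sup>2 - (x * r)\<^sup>2) / (b * w)\<^sup>2" using b(1) w(1) by (simp add: power_divide diff_divide_distrib)
      also have "(b * w)\<^sup>2 - (x * r)\<^sup>2 = (\<tau> * S)\<^sup>2" by (simp add: power_mult_distrib b w S r algebra_simps)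
      finally have y1: "1 - ?y\<^sup>2 = (\<tau> * S / (b * w))\<^sup>2" by (simp add: power_divide)
      have pos: "\<tau> * S / (b * w) > 0" using tau S b w by simp
      have sq: "sqrt (1 - ?y\<^sup>2) = \<tau> * S / (b * w)" unfolding y1 real_sqrt_abs using pos by (rule abs_of_pos)
      have "?y\<^sup>2 < 1" using zero_less_power[OF pos, of 2] unfolding y1[symmetric] diff_gt_0_iff_gt .
      moreover have "-1 < y \<and> y < 1" if "y\<^sup>2 < 1" for y :: real
        using that abs_square_less_1[of y] by linarith
      ultimately have lt: "-1 < ?y" "?y < 1" by blast+
      have dy: "((\<lambda>x. x * r / (b * sqrt (\<tau>\<^sup>2 + x\<^sup>2))) has_real_derivative ((1 * r) * (b * w) - x * r * (b * (x / w))) / ((b * w) * (b * w))) (at x)"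
        unfolding w_def
        by (rule DERIV_divide[OF DERIV_cmult_right[OF DERIV_ident] DERIV_cmult[OF dw[unfolded w_def]]])
           (use b(1) tau in \<open>simp add: add_pos_nonneg\<close>)
      have "((1 * r) * (b * w) - x * r * (b * (x / w))) / ((b * w) * (b * w)) = r * (w\<^sup>2 - x\<^sup>2) / (b * w ^ 3)"
        using b(1) w(1) by (simp add: divide_simps power2_eq_square power3_eq_cube) (simp add: algebra_simps)
      then have dy': "((\<lambda>x. x * r / (b * sqrt (\<tau>\<^sup>2 + x\<^sup>2))) has_real_derivative r * \<tau>\<^sup>2 / (b * w ^ 3)) (at x)"
        using dy unfolding w(2) by simp
      have "inverse (sqrt (1 - ?y\<^sup>2)) * (r * \<tau>\<^sup>2 / (b * w ^ 3)) = r * \<tau> / (w\<^sup>2 * S)"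
        unfolding sq using b(1) w(1) S(1) tau by (simp add: divide_simps power2_eq_square power3_eq_cube)
      moreover have "((\<lambda>x. arcsin (x * r / (b * sqrt (\<tau>\<^sup>2 + x\<^sup>2)))) has_real_derivative inverse (sqrt (1 - ?y\<^sup>2)) * (r * \<tau>\<^sup>2 / (b * w ^ 3))) (at x)"
        unfolding w_def by (rule DERIV_chain2[OF DERIV_arcsin[OF lt, unfolded w_def] dy'[unfolded w_def]])
      ultimately show ?thesis by (simp only:)
    qed
    have "(A has_real_derivative kern_deriv \<tau> x * S + (- x / S) * kern \<tau> x + 2 * (1 / S) - (2 * \<tau> / r) * (r * \<tau> / (w\<^sup>2 * S))) (at x)"
      unfolding A_def S_def by (intro DERIV_diff DERIV_add DERIV_mult DERIV_cmult DERIV_kern tau d1[unfolded S_def] d2[unfolded S_def] d3[unfolded S_def])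
    moreover have "(- x / S) * kern \<tau> x + 2 * (1 / S) - (2 * \<tau> / r) * (r * \<tau> / (w\<^sup>2 * S)) = 0"
    proof -
      have "(- x / S) * (2 * x / W) + 2 * (1 / S) - (2 * \<tau> / r) * (r * \<tau> / (W * S)) = 2 * (W - x\<^sup>2 - \<tau>\<^sup>2) / (W * S)" if "W \<noteq> 0" for W
        using S(1) r(1) that by (simp add: divide_simps power2_eq_square)
      note key = this
      have W: "w\<^sup>2 \<noteq> 0" using w(1) by simp
      show ?thesis unfolding kern_def w(2)[symmetric] key[OF W] by (simp add: w(2))
    qed
    ultimately have "(A has_real_derivative kern_deriv \<tau> x * S) (at x)" by (simp add: algebra_simps)
    then show "(A has_vector_derivative kern_deriv \<tau> x * sqrt (\<beta> - x\<^sup>2)) (at x)"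
      by (simp add: has_real_derivative_iff_has_vector_derivative S_def)
  qed
  have Ab: "A b - A 0 = pi * (1 - \<tau> / r)"
  proof -
    have "b * sqrt (\<tau>\<^sup>2 + b\<^sup>2) = b * r" unfolding b(3) r_def ..
    then have "b * r / (b * sqrt (\<tau>\<^sup>2 + b\<^sup>2)) = 1" using b(1) r(1) by simp
    then show ?thesis unfolding A_def using b by (simp add: kern_def right_diff_distrib)
  qed
  have tr: "\<tau> / r = 1 / sqrt (1 + \<beta> / \<tau>\<^sup>2)"
  proof -
    have "1 + \<beta> / \<tau>\<^sup>2 = (\<tau>\<^sup>2 + \<beta>) / \<tau>\<^sup>2" using tau by (simp add: field_simps)
    then have "sqrt (1 + \<beta> / \<tau>\<^sup>2) = r / \<tau>" using tau by (simp add: real_sqrt_divide r_def)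
    then show ?thesis by simp
  qed
  have "((\<lambda>x. 1 / (pi * \<beta>) * (kern_deriv \<tau> x * sqrt (\<beta> - x\<^sup>2))) has_integral 1 / (pi * \<beta>) * (A b - A 0)) {0..b}"
    using 1 by (rule has_integral_mult_right)
  then have 2: "((\<lambda>x. kern_deriv \<tau> x * profile_rate t x) has_integral 1 / (pi * \<beta>) * (A b - A 0)) {0..b}"
  proof (rule has_integral_eq[rotated])
    fix x assume "x \<in> {0..b}"
    then have "x\<^sup>2 \<le> \<beta>" using x2 by auto
    then show "1 / (pi * \<beta>) * (kern_deriv \<tau> x * sqrt (\<beta> - x\<^sup>2)) = kern_deriv \<tau> x * profile_rate t x"
      by (simp add: profile_rate_def \<beta>_def max_def)
  qed
  have "((\<lambda>x. kern_deriv \<tau> x * profile_rate t x) has_integral 0) {b..1}"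
  proof (rule has_integral_is_0)
    fix x assume "x \<in> {b..1}"
    then have "b\<^sup>2 \<le> x\<^sup>2" using b by (intro power_mono) auto
    then have "1 - t\<^sup>2 - x\<^sup>2 \<le> 0" using b by (simp add: \<beta>_def)
    then show "kern_deriv \<tau> x * profile_rate t x = 0" by (simp add: profile_rate_def)
  qed
  from has_integral_combine[OF _ _ 2 this] b
  have "((\<lambda>x. kern_deriv \<tau> x * profile_rate t x) has_integral 1 / (pi * \<beta>) * (pi * (1 - \<tau> / r))) {0..1}" unfolding Ab by simp
  then show ?thesis unfolding tr by (simp add: \<beta>_def)
qed

text \<open>Because \<open>profile_rate\<close> is continuous in \<open>t\<close>, integrating it
  back yields differentiability also at the edges, which the direct computation leaves out.\<close>

lemma DERIV_profile_param_all:
  assumes t: "\<bar>t\<bar> < 1" and x: "0 \<le> x" "x \<le> 1"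
  shows "((\<lambda>t. profile t x) has_real_derivative - profile_rate t x) (at t)"
proof -
  obtain a b where ab: "-1 < a" "a < t" "t < b" "b < 1"
    using t dense[of "-1" t] dense[of t 1] by (metis abs_less_iff minus_less_iff)
  have "continuous_on {a..b} (\<lambda>t. profile_rate t x)"
  proof -
    have "\<bar>u\<bar> < 1" if "u \<in> {a..b}" for u using that ab by auto
    then have "1 - u\<^sup>2 \<noteq> 0" if "u \<in> {a..b}" for u using that sq_less_1[of u] by fastforce
    then show ?thesis unfolding profile_rate_def by (intro continuous_intros) auto
  qed
  then have "((\<lambda>u. integral {a..u} (\<lambda>t. profile_rate t x)) has_real_derivative profile_rate t x) (at t within {a..b})"
    using ab by (intro integral_has_real_derivative) auto
  then have "((\<lambda>u. integral {a..u} (\<lambda>t. profile_rate t x)) has_real_derivative profile_rate t x) (at t)"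
    using ab by (simp add: at_within_Icc_at)
  then have "((\<lambda>u. profile a x - integral {a..u} (\<lambda>t. profile_rate t x)) has_real_derivative 0 - profile_rate t x) (at t)"
    by (intro DERIV_diff DERIV_const)
  then have D: "((\<lambda>u. profile a x - integral {a..u} (\<lambda>t. profile_rate t x)) has_real_derivative - profile_rate t x) (at t)" by simp
  show ?thesis
  proof (rule DERIV_cong_ev[THEN iffD1, OF refl _ refl D])
    have "\<forall>\<^sub>F u in nhds t. u \<in> {a<..<b}" using ab by (intro eventually_nhds_in_open) auto
    then show "\<forall>\<^sub>F u in nhds t. profile a x - integral {a..u} (\<lambda>t. profile_rate t x) = profile u x"
    proof eventually_elim
      fix u assume "u \<in> {a<..<b}"
      then have "integral {a..u} (\<lambda>t. profile_rate t x) = profile a x - profile u x"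
        using ab x by (intro integral_unique profile_rate_has_integral) auto
      then show "profile a x - integral {a..u} (\<lambda>t. profile_rate t x) = profile u x" by simp
    qed
  qed
qed

text \<open>The derivative is minus the integral of \<open>kern_deriv\<close> against the
  semicircle, so \<open>log_root\<close> can differ from the integral of the profile only by a
  constant in \<open>t\<close>.\<close>

lemma DERIV_log_root:
  assumes tau: "\<tau> > 0" and t: "\<bar>t\<bar> < 1"
  shows "(log_root \<tau> has_real_derivative - ((1 - 1 / sqrt (1 + (1 - t\<^sup>2) / \<tau>\<^sup>2)) / (1 - t\<^sup>2))) (at t)"
proof -
  have t2: "t\<^sup>2 < 1" using t by (rule sq_less_1)
  define R where "R = sqrt (1 + (1 - t\<^sup>2) / \<tau>\<^sup>2)"
  have R2: "R\<^sup>2 = 1 + (1 - t\<^sup>2) / \<tau>\<^sup>2" and R1: "R > 0" unfolding R_def using t2 by (auto simp: add_pos_nonneg)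
  have R3: "R > 1" unfolding R_def using t2 tau by simp
  have p: "1 + t > 0" "t + R > 0" "1 - t > 0" using t R3 by auto
  have dR: "((\<lambda>t. sqrt (1 + (1 - t\<^sup>2) / \<tau>\<^sup>2)) has_real_derivative - t / (\<tau>\<^sup>2 * R)) (at t)"
  proof -
    have q: "1 + (1 - t\<^sup>2) / \<tau>\<^sup>2 > 0" using R2 R1 zero_less_power[OF R1, of 2] by simp
    have "((\<lambda>t. 1 + (1 - t\<^sup>2) / \<tau>\<^sup>2) has_real_derivative - (2 * t) / \<tau>\<^sup>2) (at t)"
      by (rule DERIV_cong[OF DERIV_add[OF DERIV_const DERIV_cdivide[OF DERIV_diff[OF DERIV_const DERIV_power[OF DERIV_ident]]]]]) simp
    from DERIV_chain2[OF DERIV_real_sqrt[OF q] this] show ?thesis by (simp add: field_simps flip: R_def)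
  qed
  have d1: "((\<lambda>t. (t + sqrt (1 + (1 - t\<^sup>2) / \<tau>\<^sup>2)) / (1 + t)) has_real_derivative
      ((1 + - t / (\<tau>\<^sup>2 * R)) * (1 + t) - (t + R) * (0 + 1)) / ((1 + t) * (1 + t))) (at t)"
    using DERIV_divide[OF DERIV_add[OF DERIV_ident dR] DERIV_add[OF DERIV_const DERIV_ident], of 1] p by (simp flip: R_def)
  have "(log_root \<tau> has_real_derivative 1 / ((t + R) / (1 + t)) * (((1 + - t / (\<tau>\<^sup>2 * R)) * (1 + t) - (t + R) * (0 + 1)) / ((1 + t) * (1 + t)))) (at t)"
    unfolding log_root_def[abs_def] using DERIV_chain2[OF DERIV_ln_divide d1] p by (simp flip: R_def)
  moreover have "1 / ((t + R) / (1 + t)) * (((1 + - t / (\<tau>\<^sup>2 * R)) * (1 + t) - (t + R) * (0 + 1)) / ((1 + t) * (1 + t)))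
      = - ((1 - 1 / R) / (1 - t\<^sup>2))"
  proof -
    have "1 / ((t + R) / (1 + t)) * (((1 + - t / (\<tau>\<^sup>2 * R)) * (1 + t) - (t + R) * (0 + 1)) / ((1 + t) * (1 + t)))
       = ((\<tau>\<^sup>2 * R - t) * (1 + t) - (t + R) * (\<tau>\<^sup>2 * R)) / (\<tau>\<^sup>2 * R * (t + R) * (1 + t))"
      using p R1 tau by (simp add: divide_simps)
    moreover have "((\<tau>\<^sup>2 * R - t) * (1 + t) - (t + R) * (\<tau>\<^sup>2 * R)) * (1 - t) = - (R - 1) * (\<tau>\<^sup>2 * (t + R))"
    proof -
      have e: "\<tau>\<^sup>2 * R\<^sup>2 = \<tau>\<^sup>2 + 1 - t\<^sup>2" unfolding R2 using tau by (simp add: field_simps)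
      have "((\<tau>\<^sup>2 * R - t) * (1 + t) - (t + R) * (\<tau>\<^sup>2 * R)) * (1 - t) + (R - 1) * (\<tau>\<^sup>2 * (t + R))
         = t * (\<tau>\<^sup>2 * R\<^sup>2 - (\<tau>\<^sup>2 + 1 - t\<^sup>2))"
        by (simp add: power2_eq_square algebra_simps)
      then show ?thesis unfolding e mult_minus_left eq_neg_iff_add_eq_0 by simp
    qed
    moreover have "X / (T * R * (t + R) * (1 + t)) = - ((1 - 1 / R) / ((1 - t) * (1 + t)))"
      if "X * (1 - t) = - (R - 1) * (T * (t + R))" "T \<noteq> 0" for X T
    proof -
      have "X = - (R - 1) * (T * (t + R)) / (1 - t)" using that p by (simp add: field_simps)
      then show ?thesis using that(2) p R1 by (simp add: divide_simps)
    qed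
    moreover have "(1 - t) * (1 + t) = 1 - t\<^sup>2" by (simp add: power2_eq_square algebra_simps)
    moreover have "\<tau>\<^sup>2 \<noteq> 0" using tau by simp
    ultimately show ?thesis by (simp only:)
  qed
  ultimately show ?thesis unfolding R_def by (simp only:)
qed

text \<open>Integrating \<open>kern_deriv\<close> against the profile is integrating
  \<open>kern\<close> against the density of parts, by parts: the boundary terms vanish since
  \<open>kern \<tau> 0 = 0\<close> and \<open>profile t 1 = 0\<close>. The value follows by
  differentiating under the integral in \<open>t\<close> and comparing at
  \<open>t = 0\<close>.\<close>

lemma kern_deriv_profile_integral:
  assumes tau: "\<tau> > 0" and t: "\<bar>t\<bar> < 1"
  shows "((\<lambda>x. kern_deriv \<tau> x * profile t x) has_integral log_root \<tau> t) {0..1}"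
proof -
  define U where "U = {-1<..<1::real}"
  define \<Psi> where "\<Psi> = (\<lambda>t. integral {0..1} (\<lambda>x. kern_deriv \<tau> x * profile t x))"
  have int: "(\<lambda>x. kern_deriv \<tau> x * profile u x) integrable_on {0..1}" if "u \<in> U" for u
    using that by (intro integrable_continuous_real continuous_intros continuous_kern_deriv tau continuous_profile_space) (auto simp: U_def)
  have D\<Psi>: "(\<Psi> has_real_derivative - ((1 - 1 / sqrt (1 + (1 - u\<^sup>2) / \<tau>\<^sup>2)) / (1 - u\<^sup>2))) (at u)" if u: "u \<in> U" for u
  proof -
    have "((\<lambda>t. integral (cbox 0 1) (\<lambda>x. kern_deriv \<tau> x * profile t x)) has_field_derivative integral (cbox 0 1) (\<lambda>x. kern_deriv \<tau> x * (- profile_rate u x))) (at u within U)"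
    proof (rule leibniz_rule_field_derivative)
      fix v x :: real assume "v \<in> U" "x \<in> cbox 0 1"
      then show "((\<lambda>v. kern_deriv \<tau> x * profile v x) has_field_derivative kern_deriv \<tau> x * (- profile_rate v x)) (at v within U)"
        by (intro DERIV_cmult has_field_derivative_at_within[OF DERIV_profile_param_all]) (auto simp: U_def)
    next
      have "\<bar>v\<bar> < 1" if "v \<in> U" for v using that by (auto simp: U_def)
      then have "1 - v\<^sup>2 \<noteq> 0" if "v \<in> U" for v using that sq_less_1[of v] by fastforce
      then show "continuous_on (U \<times> cbox 0 1) (\<lambda>(v, x). kern_deriv \<tau> x * (- profile_rate v x))"
        unfolding case_prod_unfold profile_rate_def
        by (intro continuous_intros continuous_on_compose2[OF continuous_kern_deriv[OF tau, of UNIV]]) auto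
    qed (use int u in \<open>auto simp: U_def\<close>)
    moreover have "integral (cbox 0 1) (\<lambda>x. kern_deriv \<tau> x * (- profile_rate u x)) = - ((1 - 1 / sqrt (1 + (1 - u\<^sup>2) / \<tau>\<^sup>2)) / (1 - u\<^sup>2))"
      using integral_unique[OF has_integral_neg[OF kern_deriv_profile_rate_integral[OF tau, of u]]] u by (simp add: U_def abs_less_iff)
    moreover have "at u within U = at u" using u by (intro at_within_open) (auto simp: U_def)
    ultimately show ?thesis unfolding \<Psi>_def by simp
  qed
  have "((\<lambda>u. \<Psi> u - log_root \<tau> u) has_real_derivative 0) (at u within U)" if u: "u \<in> U" for u
  proof (rule has_field_derivative_at_within)
    have "\<bar>u\<bar> < 1" using u by (auto simp: U_def)
    then show "((\<lambda>u. \<Psi> u - log_root \<tau> u) has_real_derivative 0) (at u)"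
      by (rule DERIV_cong[OF DERIV_diff[OF D\<Psi>[OF u] DERIV_log_root[OF tau]]]) simp
  qed
  moreover have "convex U" by (simp add: U_def)
  ultimately obtain c where c: "\<And>u. u \<in> U \<Longrightarrow> \<Psi> u - log_root \<tau> u = c"
    using has_field_derivative_zero_constant[of U "\<lambda>u. \<Psi> u - log_root \<tau> u"] by blast
  \<comment> \<open>At \<open>t = 0\<close> the profile is \<open>(1 - x) / 2\<close>, and the
    integral is elementary; this fixes the constant.\<close>
  have "\<Psi> 0 = log_root \<tau> 0"
  proof -
    have tp: "\<tau>\<^sup>2 + x\<^sup>2 > 0" for x using tau by (simp add: add_pos_nonneg)
    define A where "A = (\<lambda>x. kern \<tau> x * ((1 - x) / 2) + ln (\<tau>\<^sup>2 + x\<^sup>2) / 2)"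
    have "((\<lambda>x. kern_deriv \<tau> x * ((1 - x) / 2)) has_integral A 1 - A 0) {0..1}"
    proof (rule fundamental_theorem_of_calculus)
      fix x :: real
      have "(A has_real_derivative kern_deriv \<tau> x * ((1 - x) / 2) + (0 - 1) / 2 * kern \<tau> x + (1 / (\<tau>\<^sup>2 + x\<^sup>2) * (2 * x)) / 2) (at x)"
        unfolding A_def using tp[of x]
        by (intro DERIV_add DERIV_mult DERIV_kern tau DERIV_cdivide DERIV_diff DERIV_const DERIV_ident DERIV_chain2[OF DERIV_ln_divide])
           (auto intro!: derivative_eq_intros)
      moreover have "(0 - 1) / 2 * kern \<tau> x + (1 / (\<tau>\<^sup>2 + x\<^sup>2) * (2 * x)) / 2 = 0"
      proof -
        have "(0 - 1) / 2 * (2 * x / W) + (1 / W * (2 * x)) / 2 = 0" for W :: real by simp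
        then show ?thesis unfolding kern_def .
      qed
      ultimately have "(A has_real_derivative kern_deriv \<tau> x * ((1 - x) / 2)) (at x)"
        by (simp only: add.assoc add_0_right)
      then show "(A has_vector_derivative kern_deriv \<tau> x * ((1 - x) / 2)) (at x within {0..1})"
        unfolding has_real_derivative_iff_has_vector_derivative by (rule has_vector_derivative_at_within)
    qed simp
    then have "((\<lambda>x. kern_deriv \<tau> x * profile 0 x) has_integral A 1 - A 0) {0..1}"
      by (rule has_integral_eq[rotated]) (simp add: profile_0)
    then have "\<Psi> 0 = A 1 - A 0" unfolding \<Psi>_def by (rule integral_unique)
    also have "\<dots> = ln (\<tau>\<^sup>2 + 1) / 2 - ln (\<tau>\<^sup>2) / 2" by (simp add: A_def kern_def)
    also have "\<dots> = ln (sqrt ((\<tau>\<^sup>2 + 1) / \<tau>\<^sup>2))"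
      using tau tp[of 1] by (simp add: ln_sqrt ln_div diff_divide_distrib)
    also have "(\<tau>\<^sup>2 + 1) / \<tau>\<^sup>2 = 1 + 1 / \<tau>\<^sup>2" using tau by (simp add: field_simps)
    finally show ?thesis by (simp add: log_root_def)
  qed
  then have "c = 0" using c[of 0] by (simp add: U_def)
  then have "\<Psi> t = log_root \<tau> t" using c[of t] t by (auto simp: U_def abs_less_iff)
  then show ?thesis using int[of t] t unfolding \<Psi>_def by (simp add: U_def has_integral_integral abs_less_iff) 
qed

section \<open>Convergence of the mean profile\<close>

lemma sum_telescope_real:
  fixes f :: "real \<Rightarrow> real"
  shows "(\<Sum>y=1..n. f (real y - 1) - f (real y)) = f 0 - f (real n)"
  by (induction n) simp_all

text \<open>The candidate density at \<open>y / n\<close> is \<open>n\<close> times the drop of the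
  profile over one cell. Summation by parts moves the difference onto \<open>kern\<close>, and the
  result is compared cell by cell with the integral of \<open>kern_deriv\<close> times the
  profile.\<close>

lemma riemann_profile:
  assumes tau: "\<tau> > 0" and t: "\<bar>t\<bar> < 1"
  shows "(\<lambda>n. (\<Sum>y=1..n. real n * (profile t ((real y - 1) / real n) - profile t (real y / real n)) * kern \<tau> (real y / real n)) / real n) \<longlonglongrightarrow> log_root \<tau> t"
proof -
  define B where "B = 2 / \<tau>\<^sup>2"
  define G where "G = (\<lambda>x. integral {0..x} (\<lambda>x. kern_deriv \<tau> x * profile t x))"
  have G0: "G 0 = 0" by (simp add: G_def)
  have G1: "G 1 = log_root \<tau> t" unfolding G_def using kern_deriv_profile_integral[OF tau t] by (rule integral_unique)
  have cont: "continuous_on {0..1} (\<lambda>x. kern_deriv \<tau> x * profile t x)"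
    using tau t by (intro continuous_intros continuous_kern_deriv continuous_profile_space)
  have DG: "(G has_real_derivative kern_deriv \<tau> x * profile t x) (at x within {0..1})" if "x \<in> {0..1}" for x
    unfolding G_def using cont that by (rule integral_has_real_derivative)
  \<comment> \<open>Freezing the profile at the left end of a cell costs at most the cell length, by
    the Lipschitz bound; \<open>B\<close> bounds \<open>kern_deriv\<close>. Summed over
    \<open>n\<close> cells the error is \<open>B / n\<close>.\<close>
  have local: "\<bar>(G b - G a) - profile t a * (kern \<tau> b - kern \<tau> a)\<bar> \<le> B * (b - a) * (b - a)" if ab: "0 \<le> a" "a \<le> b" "b \<le> 1" for a b
  proof -
    have "norm ((G b - profile t a * kern \<tau> b) - (G a - profile t a * kern \<tau> a)) \<le> (B * (b - a)) * norm (b - a)"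
    proof (rule field_differentiable_bound[where S = "{a..b}"])
      fix z assume z: "z \<in> {a..b}"
      show "((\<lambda>x. G x - profile t a * kern \<tau> x) has_field_derivative kern_deriv \<tau> z * profile t z - profile t a * kern_deriv \<tau> z) (at z within {a..b})"
        using z ab tau by (intro DERIV_diff DERIV_cmult has_field_derivative_subset[OF DG] has_field_derivative_at_within[OF DERIV_kern]) auto
      have "norm (kern_deriv \<tau> z * profile t z - profile t a * kern_deriv \<tau> z) = \<bar>kern_deriv \<tau> z\<bar> * \<bar>profile t a - profile t z\<bar>"
        by (simp add: abs_mult[symmetric] abs_minus_commute algebra_simps)
      also have "\<dots> \<le> B * (z - a)"
        using kern_deriv_bound[OF tau, of z] profile_lipschitz[OF t, of a z] z ab unfolding B_def by (intro mult_mono) auto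
      also have "\<dots> \<le> B * (b - a)" using z unfolding B_def by (intro mult_left_mono) auto
      finally show "norm (kern_deriv \<tau> z * profile t z - profile t a * kern_deriv \<tau> z) \<le> B * (b - a)" .
    qed (use ab in auto)
    then show ?thesis using ab by (simp add: algebra_simps)
  qed
  let ?S = "\<lambda>n. (\<Sum>y=1..n. real n * (profile t ((real y - 1) / real n) - profile t (real y / real n)) * kern \<tau> (real y / real n)) / real n"
  have est: "\<bar>?S n - log_root \<tau> t\<bar> \<le> B * (1 / real n)" if n: "n \<ge> 1" for n
  proof -
    define h where "h = (\<lambda>v. profile t (v / real n))"
    define k where "k = (\<lambda>v. kern \<tau> (v / real n))"
    have "?S n = (\<Sum>y=1..n. (h (real y - 1) - h (real y)) * k (real y))"
      using n by (simp add: h_def k_def sum_distrib_left sum_divide_distrib mult_ac)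
    also have "\<dots> = (\<Sum>y=1..n. h (real y - 1) * (k (real y) - k (real y - 1))) + (\<Sum>y=1..n. h (real y - 1) * k (real y - 1) - h (real y) * k (real y))"
      unfolding sum.distrib[symmetric] by (intro sum.cong refl) (simp add: algebra_simps)
    also have "(\<Sum>y=1..n. h (real y - 1) * k (real y - 1) - h (real y) * k (real y)) = h 0 * k 0 - h (real n) * k (real n)"
      by (rule sum_telescope_real[of "\<lambda>v. h v * k v"])
    also have "\<dots> = 0" using n by (simp add: h_def k_def kern_def profile_at_1)
    finally have S: "?S n = (\<Sum>y=1..n. h (real y - 1) * (k (real y) - k (real y - 1)))" by simp
    have "(\<Sum>y=1..n. - G ((real y - 1) / real n) - - G (real y / real n)) = - G (0 / real n) - - G (real n / real n)"
      by (rule sum_telescope_real[of "\<lambda>v. - G (v / real n)"])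
    then have L: "log_root \<tau> t = (\<Sum>y=1..n. G (real y / real n) - G ((real y - 1) / real n))"
      using n G0 G1 by simp
    have "\<bar>log_root \<tau> t - ?S n\<bar> \<le> (\<Sum>y=1..n. B * (1 / real n) * (1 / real n))"
      unfolding S L sum_subtractf[symmetric]
    proof (rule order_trans[OF sum_abs], rule sum_mono)
      fix y assume y: "y \<in> {1..n}"
      have "real y / real n - (real y - 1) / real n = 1 / real n" by (simp add: diff_divide_distrib)
      then show "\<bar>G (real y / real n) - G ((real y - 1) / real n) - h (real y - 1) * (k (real y) - k (real y - 1))\<bar> \<le> B * (1 / real n) * (1 / real n)"
        using local[of "(real y - 1) / real n" "real y / real n"] y unfolding h_def k_def by (auto simp: divide_right_mono)
    qed
    also have "\<dots> = B * (1 / real n)" using n by simp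
    finally show ?thesis by (simp only: abs_minus_commute)
  qed
  have "(\<lambda>n. B * (1 / real n)) \<longlonglongrightarrow> 0" by (intro tendsto_mult_right_zero lim_1_over_n)
  then have "(\<lambda>n. ?S n - log_root \<tau> t) \<longlonglongrightarrow> 0"
    by (rule Lim_null_comparison[rotated]) (use est in \<open>auto simp: eventually_sequentially intro!: exI[of _ 1]\<close>)
  then show ?thesis by (simp only: LIM_zero_iff)
qed

section \<open>From the loop equation to the mean of the logarithm of F\<close>

lemma EE_abs_le:
  assumes "0 \<le> p" "p \<le> 1"
  shows "\<bar>EE M p f\<bar> \<le> EE M p (\<lambda>L. \<bar>f L\<bar>)"
proof -
  have "EE M p f \<le> EE M p (\<lambda>L. \<bar>f L\<bar>)" using assms by (intro EE_mono) auto
  moreover have "EE M p (\<lambda>L. - 1 * f L) \<le> EE M p (\<lambda>L. \<bar>f L\<bar>)" using assms by (intro EE_mono) auto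
  ultimately show ?thesis unfolding EE_cmult by simp
qed

definition phi :: "real \<Rightarrow> nat \<Rightarrow> real" where
  "phi T y = ln ((T + hi y) / (T + lo y))"

lemma Fratio_exp:
  assumes "T > 0"
  shows "Fratio T L = exp (\<Sum>y\<in>L. phi T y)"
proof (cases "finite L")
  case True
  have "exp (phi T y) = (T + hi y) / (T + lo y)" for y
    unfolding phi_def using assms lo_nonneg[of y] hi_nonneg[of y] by (intro exp_ln divide_pos_pos) auto
  then show ?thesis using True by (simp add: Fratio_def exp_sum)
qed (simp add: Fratio_def)

text \<open>With \<open>z = 2 * y / (T + lo y)\<close>, \<open>phi T y = ln (1 + z)\<close> lies
  between \<open>z - z^2\<close> and \<open>z\<close>. Replacing \<open>lo y\<close> by
  \<open>y^2\<close> turns \<open>z\<close> into the kernel value, also at most \<open>z\<close> and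
  close to it. Both deviations are downward from \<open>z\<close>, so one bound covers their
  difference.\<close>

lemma phi_estimate:
  assumes tau: "\<tau> > 0" and n: "n \<ge> 1" "2 / (\<tau>\<^sup>2 * real n) \<le> 1" and y: "y \<le> n"
  defines "T \<equiv> \<tau>\<^sup>2 * (real n)\<^sup>2"
  shows "0 \<le> phi T y" "phi T y \<le> 2 / (\<tau>\<^sup>2 * real n)"
    "\<bar>phi T y - kern \<tau> (real y / real n) / real n\<bar> \<le> 4 / (\<tau> ^ 4 * (real n)\<^sup>2)"
proof -
  have T: "T > 0" using tau n by (simp add: T_def)
  define z where "z = 2 * real y / (T + lo y)"
  have pl: "T + lo y > 0" using T lo_nonneg[of y] by simp
  have e: "(T + hi y) / (T + lo y) = 1 + z"
    using pl hi_minus_lo[of y] unfolding z_def by (simp add: field_simps)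
  have z0: "z \<ge> 0" using pl by (simp add: z_def)
  have yn: "real y \<le> real n" using y by simp
  have "z \<le> 2 * real n / T" unfolding z_def using yn T lo_nonneg[of y] by (intro frac_le) auto
  also have "\<dots> = 2 / (\<tau>\<^sup>2 * real n)" using n by (simp add: T_def power2_eq_square)
  finally have zu: "z \<le> 2 / (\<tau>\<^sup>2 * real n)" .
  have z1: "z \<le> 1" using zu n by linarith
  show "0 \<le> phi T y" unfolding phi_def e using z0 by simp
  have ub: "phi T y \<le> z" unfolding phi_def e using z0 by (rule ln_add_one_self_le_self)
  then show "phi T y \<le> 2 / (\<tau>\<^sup>2 * real n)" using zu by linarith
  have lb: "phi T y \<ge> z - z\<^sup>2" unfolding phi_def e using z0 z1 by (rule ln_one_plus_pos_lower_bound)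
  have "z\<^sup>2 \<le> (2 / (\<tau>\<^sup>2 * real n))\<^sup>2" using zu z0 by (rule power_mono)
  also have "\<dots> = 4 / (\<tau> ^ 4 * (real n)\<^sup>2)" by (simp add: power_divide power_mult_distrib flip: power_mult)
  finally have z2: "z\<^sup>2 \<le> 4 / (\<tau> ^ 4 * (real n)\<^sup>2)" .
  define k where "k = 2 * real y / (T + (real y)\<^sup>2)"
  have k: "kern \<tau> (real y / real n) / real n = k"
  proof -
    have "\<tau>\<^sup>2 + (real y / real n)\<^sup>2 = (T + (real y)\<^sup>2) / (real n)\<^sup>2" using n by (simp add: T_def power_divide field_simps)
    then show ?thesis using n unfolding kern_def k_def by (simp add: power2_eq_square)
  qed
  have py: "T + (real y)\<^sup>2 > 0" using T by (simp add: add_pos_nonneg)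
  have loy: "lo y = (real y)\<^sup>2 - real y" by (simp add: lo_def power2_eq_square algebra_simps)
  have zk: "z - k = 2 * (real y)\<^sup>2 / ((T + lo y) * (T + (real y)\<^sup>2))"
    using pl py unfolding z_def k_def by (simp add: divide_simps) (simp add: loy power2_eq_square algebra_simps)
  have zk0: "z - k \<ge> 0" unfolding zk using pl py by simp
  have "z - k \<le> 2 * (real n)\<^sup>2 / (T * T)" unfolding zk
    using T lo_nonneg[of y] yn by (intro frac_le mult_mono power_mono) auto
  also have "\<dots> = 2 / (\<tau> ^ 4 * (real n)\<^sup>2)" using n tau by (simp add: T_def power2_eq_square power4_eq_xxxx)
  also have "\<dots> \<le> 4 / (\<tau> ^ 4 * (real n)\<^sup>2)" by (intro divide_right_mono) auto
  finally have zk1: "z - k \<le> 4 / (\<tau> ^ 4 * (real n)\<^sup>2)" .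
  show "\<bar>phi T y - kern \<tau> (real y / real n) / real n\<bar> \<le> 4 / (\<tau> ^ 4 * (real n)\<^sup>2)"
    unfolding k using ub lb z2 zk0 zk1 by (simp add: abs_le_iff)
qed

lemma exp_lipschitz:
  fixes x y B :: real
  assumes "x \<le> B" "y \<le> B"
  shows "\<bar>exp x - exp y\<bar> \<le> exp B * \<bar>x - y\<bar>"
proof -
  have "norm (exp x - exp y) \<le> exp B * norm (x - y)"
    by (rule field_differentiable_bound[where S = "{..B}" and f' = exp]) (auto intro!: derivative_eq_intros assms)
  then show ?thesis by simp
qed

text \<open>The defect of \<open>v\<close> in the equation for \<open>f\<close> is
  \<open>v - f\<close> times \<open>(1 - p) * \<tau>^2 + p * (1 + \<tau>^2) / (v * f)\<close>. The
  second summand is nonnegative, so an approximate positive solution is close to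
  \<open>f\<close>.\<close>

lemma quadratic_root_unique:
  assumes p: "0 < p" "p < 1" and tau: "\<tau> > (0::real)" and v: "v > 0"
  defines "f \<equiv> (1 - 2 * p + sqrt (1 + (1 - (1 - 2 * p)\<^sup>2) / \<tau>\<^sup>2)) / (1 + (1 - 2 * p))"
  shows "f > 0" "\<bar>v - f\<bar> \<le> \<bar>(1 - p) * \<tau>\<^sup>2 * v - p * (1 + \<tau>\<^sup>2) / v - (1 - 2 * p) * \<tau>\<^sup>2\<bar> / ((1 - p) * \<tau>\<^sup>2)"
proof -
  define R where "R = sqrt (1 + (1 - (1 - 2 * p)\<^sup>2) / \<tau>\<^sup>2)"
  have q: "1 - (1 - 2 * p)\<^sup>2 = 4 * p * (1 - p)" by (simp add: power2_eq_square algebra_simps)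
  have q0: "4 * p * (1 - p) / \<tau>\<^sup>2 > 0" using p tau by simp
  have R2: "R\<^sup>2 = 1 + 4 * p * (1 - p) / \<tau>\<^sup>2" using q0 unfolding R_def q by simp
  have R1: "R > 1" unfolding R_def q using q0 by simp
  have f: "f = (1 - 2 * p + R) / (2 * (1 - p))" unfolding f_def R_def by simp
  have "1 - 2 * p + R > 0" using R1 p by linarith
  then show f0: "f > 0" unfolding f using p by simp
  have fe: "(1 - p) * \<tau>\<^sup>2 * f\<^sup>2 - p * (1 + \<tau>\<^sup>2) - (1 - 2 * p) * \<tau>\<^sup>2 * f = 0"
  proof -
    have t: "\<tau>\<^sup>2 * R\<^sup>2 = \<tau>\<^sup>2 + 4 * p * (1 - p)" unfolding R2 using tau by (simp add: field_simps)
    have "2 * (1 - p) * f = 1 - 2 * p + R" unfolding f using p by simp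
    then have Rf: "R = 2 * (1 - p) * f - (1 - 2 * p)" by simp
    have "4 * (1 - p) * ((1 - p) * \<tau>\<^sup>2 * f\<^sup>2 - p * (1 + \<tau>\<^sup>2) - (1 - 2 * p) * \<tau>\<^sup>2 * f)
       = \<tau>\<^sup>2 * R\<^sup>2 - (\<tau>\<^sup>2 + 4 * p * (1 - p))"
      unfolding Rf by (simp add: power2_eq_square algebra_simps)
    then show ?thesis unfolding t using p by simp
  qed
  define Q where "Q = (1 - p) * \<tau>\<^sup>2 * v - p * (1 + \<tau>\<^sup>2) / v - (1 - 2 * p) * \<tau>\<^sup>2"
  have "Q = (v - f) * ((1 - p) * \<tau>\<^sup>2 + p * (1 + \<tau>\<^sup>2) / (v * f))"
  proof -
    have "0 = (1 - p) * \<tau>\<^sup>2 * f - p * (1 + \<tau>\<^sup>2) / f - (1 - 2 * p) * \<tau>\<^sup>2"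
      using fe f0 by (simp add: field_simps power2_eq_square)
    then have "Q = Q - ((1 - p) * \<tau>\<^sup>2 * f - p * (1 + \<tau>\<^sup>2) / f - (1 - 2 * p) * \<tau>\<^sup>2)" by simp
    also have "\<dots> = (v - f) * ((1 - p) * \<tau>\<^sup>2 + p * (1 + \<tau>\<^sup>2) / (v * f))"
      unfolding Q_def using f0 v by (simp add: divide_simps) (simp add: algebra_simps)
    finally show ?thesis .
  qed
  then have "\<bar>Q\<bar> = \<bar>v - f\<bar> * \<bar>(1 - p) * \<tau>\<^sup>2 + p * (1 + \<tau>\<^sup>2) / (v * f)\<bar>" by (simp only: abs_mult)
  moreover have "(1 - p) * \<tau>\<^sup>2 \<le> \<bar>(1 - p) * \<tau>\<^sup>2 + p * (1 + \<tau>\<^sup>2) / (v * f)\<bar>"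
  proof -
    have "p * (1 + \<tau>\<^sup>2) / (v * f) \<ge> 0" using p v f0 by simp
    then have "(1 - p) * \<tau>\<^sup>2 \<le> (1 - p) * \<tau>\<^sup>2 + p * (1 + \<tau>\<^sup>2) / (v * f)" by simp
    also have "\<dots> \<le> \<bar>(1 - p) * \<tau>\<^sup>2 + p * (1 + \<tau>\<^sup>2) / (v * f)\<bar>" by (rule abs_ge_self)
    finally show ?thesis .
  qed
  ultimately have "\<bar>v - f\<bar> * ((1 - p) * \<tau>\<^sup>2) \<le> \<bar>Q\<bar>" by (simp add: mult_left_mono)
  then show "\<bar>v - f\<bar> \<le> \<bar>(1 - p) * \<tau>\<^sup>2 * v - p * (1 + \<tau>\<^sup>2) / v - (1 - 2 * p) * \<tau>\<^sup>2\<bar> / ((1 - p) * \<tau>\<^sup>2)"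
    unfolding Q_def using p tau by (simp add: pos_le_divide_eq)
qed

text \<open>The logarithm \<open>X\<close> of \<open>F\<close> is within \<open>D n\<close> of its
  mean \<open>\<mu>\<close> on average, so the means of \<open>F\<close> and \<open>1 / F\<close>
  are close to \<open>exp \<mu>\<close> and \<open>exp (- \<mu>)\<close>. The loop equation, linear
  in these two means, then becomes an approximate quadratic equation for
  \<open>exp \<mu>\<close>.\<close>

lemma mean_log_tendsto:
  assumes p: "0 < p" "p < 1" and tau: "\<tau> > 0"
  shows "(\<lambda>n. EE (n - 1) p (\<lambda>L. \<Sum>y\<in>L. phi (\<tau>\<^sup>2 * (real n)\<^sup>2) y)) \<longlonglongrightarrow> log_root \<tau> (1 - 2 * p)"
proof -
  define B where "B = 2 / \<tau>\<^sup>2"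
  have B: "B > 0" using tau by (simp add: B_def)
  define X where "X = (\<lambda>n L. \<Sum>y\<in>L. phi (\<tau>\<^sup>2 * (real n)\<^sup>2) y)"
  define \<mu> where "\<mu> = (\<lambda>n. EE (n - 1) p (X n))"
  define f where "f = (1 - 2 * p + sqrt (1 + (1 - (1 - 2 * p)\<^sup>2) / \<tau>\<^sup>2)) / (1 + (1 - 2 * p))"
  define D where "D = (\<lambda>n. (1 + B\<^sup>2) / sqrt (real n))"
  define E where "E = (\<lambda>n. ((1 - p) * \<tau>\<^sup>2 * (exp B * D n) + p * (1 + \<tau>\<^sup>2) * D n + p * (1 / real n)) / ((1 - p) * \<tau>\<^sup>2))"
  have p': "0 \<le> p" "p \<le> 1" using p by auto
  have main: "norm (exp (\<mu> n) - f) \<le> E n" if n: "n \<ge> 1" "2 / (\<tau>\<^sup>2 * real n) \<le> 1" for n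
  proof -
    define T where "T = \<tau>\<^sup>2 * (real n)\<^sup>2"
    have T: "T > 0" using tau n by (simp add: T_def)
    let ?M = "n - 1"
    let ?E = "EE ?M p"
    have b: "B / real n = 2 / (\<tau>\<^sup>2 * real n)" by (simp add: B_def)
    have ph: "0 \<le> phi T y" "phi T y \<le> B / real n" if "y \<in> {1..?M}" for y
      using phi_estimate(1,2)[OF tau n, of y] that unfolding T_def b by auto
    \<comment> \<open>There are fewer than \<open>n\<close> summands, each at most
      \<open>B / n\<close>: so \<open>X\<close> stays in \<open>[0, B]\<close> for every
      \<open>n\<close>, and exponentials are Lipschitz there with constants independent of
      \<open>n\<close>.\<close>
    have X0: "0 \<le> X n L" "X n L \<le> B" if L: "L \<subseteq> {1..?M}" for L
    proof -
      show "0 \<le> X n L" unfolding X_def T_def[symmetric] using L ph by (intro sum_nonneg) auto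
      have fin: "finite L" using L finite_subset by blast
      have "X n L \<le> (\<Sum>y\<in>L. B / real n)" unfolding X_def T_def[symmetric] using L ph by (intro sum_mono) auto
      also have "\<dots> = real (card L) * (B / real n)" by simp
      also have "\<dots> \<le> real n * (B / real n)"
        using card_mono[OF _ L] n B by (intro mult_right_mono) auto
      also have "\<dots> = B" using n by simp
      finally show "X n L \<le> B" .
    qed
    have mu: "0 \<le> \<mu> n" "\<mu> n \<le> B"
      using EE_mono[OF p', of ?M "\<lambda>_. 0" "X n"] EE_mono[OF p', of ?M "X n" "\<lambda>_. B"] X0 p'
      by (auto simp: \<mu>_def EE_const)
    have V: "?E (\<lambda>L. (X n L - \<mu> n)\<^sup>2) \<le> B\<^sup>2 / real n"
    proof -
      have "?E (\<lambda>L. (X n L - \<mu> n)\<^sup>2) \<le> (\<Sum>y\<in>{1..?M}. (phi T y)\<^sup>2)"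
        unfolding \<mu>_def X_def T_def[symmetric] using p ph by (intro variance_bound) auto
      also have "\<dots> \<le> (\<Sum>y\<in>{1..?M}. (B / real n)\<^sup>2)" using ph by (intro sum_mono power_mono) auto
      also have "\<dots> = real ?M * (B / real n)\<^sup>2" by simp
      also have "\<dots> \<le> real n * (B / real n)\<^sup>2" by (intro mult_right_mono) auto
      also have "\<dots> = B\<^sup>2 / real n" using n by (simp add: power_divide power2_eq_square)
      finally show ?thesis .
    qed
    define s where "s = sqrt (real n)"
    have s: "s > 0" "s * s = real n" using n by (auto simp: s_def)
    have A: "?E (\<lambda>L. \<bar>X n L - \<mu> n\<bar>) \<le> D n"
    proof -
      \<comment> \<open>A pointwise substitute for the Cauchy-Schwarz inequality; with variance at
        most \<open>B^2 / n\<close> and \<open>s = sqrt n\<close> both terms have order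
        \<open>1 / sqrt n\<close>, which gives \<open>D\<close>.\<close>
      have "\<bar>u\<bar> \<le> 1 / s + s * u\<^sup>2" for u :: real
      proof -
        have "0 \<le> (s * \<bar>u\<bar> - 1)\<^sup>2" by simp
        then have "2 * (s * \<bar>u\<bar>) \<le> s\<^sup>2 * u\<^sup>2 + 1" by (simp add: power2_diff power_mult_distrib)
        then have "s * \<bar>u\<bar> \<le> 1 + s\<^sup>2 * u\<^sup>2" using s by (smt (verit) mult_nonneg_nonneg abs_ge_zero)
        then have "\<bar>u\<bar> \<le> (1 + s\<^sup>2 * u\<^sup>2) / s" using s(1) by (simp add: pos_le_divide_eq mult.commute)
        also have "\<dots> = 1 / s + s * u\<^sup>2" using s(1) by (simp add: add_divide_distrib power2_eq_square)
        finally show ?thesis .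
      qed
      then have "?E (\<lambda>L. \<bar>X n L - \<mu> n\<bar>) \<le> ?E (\<lambda>L. 1 / s + s * (X n L - \<mu> n)\<^sup>2)" using p' by (intro EE_mono)
      also have "\<dots> = 1 / s + s * ?E (\<lambda>L. (X n L - \<mu> n)\<^sup>2)" using p' by (simp add: EE_add EE_cmult EE_const)
      also have "\<dots> \<le> 1 / s + s * (B\<^sup>2 / real n)" using mult_left_mono[OF V, of s] s(1) by simp
      also have "s * (B\<^sup>2 / real n) = B\<^sup>2 / s" using s by (simp add: field_simps flip: s(2))
      finally show ?thesis unfolding D_def s_def[symmetric] by (simp add: add_divide_distrib)
    qed
    have a: "\<bar>?E (Fratio T) - exp (\<mu> n)\<bar> \<le> exp B * D n"
    proof -
      have "?E (Fratio T) - exp (\<mu> n) = ?E (\<lambda>L. Fratio T L - exp (\<mu> n))" using p' by (simp add: EE_diff EE_const)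
      also have "\<bar>\<dots>\<bar> \<le> ?E (\<lambda>L. \<bar>Fratio T L - exp (\<mu> n)\<bar>)" using p' by (rule EE_abs_le)
      also have "\<dots> \<le> ?E (\<lambda>L. exp B * \<bar>X n L - \<mu> n\<bar>)"
      proof (rule EE_mono[OF p'])
        fix L assume "L \<subseteq> {1..?M}"
        then show "\<bar>Fratio T L - exp (\<mu> n)\<bar> \<le> exp B * \<bar>X n L - \<mu> n\<bar>"
          unfolding Fratio_exp[OF T] using X0[of L] mu unfolding X_def T_def by (intro exp_lipschitz) auto
      qed
      also have "\<dots> \<le> exp B * D n" unfolding EE_cmult using A by simp
      finally show ?thesis .
    qed
    have bb: "\<bar>?E (\<lambda>L. 1 / Fratio T L) - exp (- \<mu> n)\<bar> \<le> D n"
    proof -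
      have "?E (\<lambda>L. 1 / Fratio T L) - exp (- \<mu> n) = ?E (\<lambda>L. 1 / Fratio T L - exp (- \<mu> n))" using p' by (simp add: EE_diff EE_const)
      also have "\<bar>\<dots>\<bar> \<le> ?E (\<lambda>L. \<bar>1 / Fratio T L - exp (- \<mu> n)\<bar>)" using p' by (rule EE_abs_le)
      also have "\<dots> \<le> ?E (\<lambda>L. \<bar>X n L - \<mu> n\<bar>)"
      proof (rule EE_mono[OF p'])
        fix L assume L: "L \<subseteq> {1..?M}"
        have "1 / Fratio T L = exp (- X n L)" unfolding X_def T_def[symmetric] Fratio_exp[OF T] by (simp only: exp_minus inverse_eq_divide)
        moreover have "\<bar>exp (- X n L) - exp (- \<mu> n)\<bar> \<le> exp 0 * \<bar>- X n L - - \<mu> n\<bar>"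
          using X0[OF L] mu by (intro exp_lipschitz) auto
        ultimately show "\<bar>1 / Fratio T L - exp (- \<mu> n)\<bar> \<le> \<bar>X n L - \<mu> n\<bar>" by (simp add: abs_minus_commute)
      qed
      also have "\<dots> \<le> D n" by (rule A)
      finally show ?thesis .
    qed
    have b1: "?E (\<lambda>L. 1 / Fratio T L) \<le> 1" "0 \<le> ?E (\<lambda>L. 1 / Fratio T L)"
    proof -
      have "1 / Fratio T L \<le> 1 \<and> 0 \<le> 1 / Fratio T L" if "L \<subseteq> {1..?M}" for L
        using X0(1)[OF that] unfolding X_def T_def[symmetric] Fratio_exp[OF T] by simp
      then show "?E (\<lambda>L. 1 / Fratio T L) \<le> 1" "0 \<le> ?E (\<lambda>L. 1 / Fratio T L)"
        using EE_mono[OF p', of ?M "\<lambda>_. 0" "\<lambda>L. 1 / Fratio T L"] EE_mono[OF p', of ?M "\<lambda>L. 1 / Fratio T L" "\<lambda>_. 1"] p'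
        by (auto simp: EE_const)
    qed
    define a' where "a' = ?E (Fratio T)"
    define b' where "b' = ?E (\<lambda>L. 1 / Fratio T L)"
    \<comment> \<open>Since the largest part is \<open>n - 1\<close>, the loop equation carries
      \<open>(n - 1) * n = (1 - c) * n^2\<close>, and \<open>c\<close> only adds an error of order
      \<open>1 / n\<close>.\<close>
    define c where "c = 1 / real n"
    have n2: "(real n)\<^sup>2 \<noteq> 0" using n by simp
    have "(1 - p) * T * a' - p * (real ?M * (real ?M + 1) + T) * b' = (1 - 2 * p) * T"
      unfolding a'_def b'_def by (rule EE_loop[OF p T])
    moreover have "real ?M * (real ?M + 1) = (1 - c) * (real n)\<^sup>2" using n by (simp add: c_def of_nat_diff power2_eq_square algebra_simps)
    ultimately have "(1 - p) * T * a' - p * ((1 - c) * (real n)\<^sup>2 + T) * b' = (1 - 2 * p) * T" by (simp only:)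
    then have "(real n)\<^sup>2 * ((1 - p) * \<tau>\<^sup>2 * a' - p * (1 - c + \<tau>\<^sup>2) * b') = (real n)\<^sup>2 * ((1 - 2 * p) * \<tau>\<^sup>2)"
      unfolding T_def by (simp add: algebra_simps)
    then have loop: "(1 - p) * \<tau>\<^sup>2 * a' - p * (1 - c + \<tau>\<^sup>2) * b' = (1 - 2 * p) * \<tau>\<^sup>2" using n2 by simp
    let ?v = "exp (\<mu> n)"
    have "(1 - p) * \<tau>\<^sup>2 * ?v - p * (1 + \<tau>\<^sup>2) / ?v - (1 - 2 * p) * \<tau>\<^sup>2
       = (1 - p) * \<tau>\<^sup>2 * (?v - a') + p * (1 + \<tau>\<^sup>2) * (b' - exp (- \<mu> n)) - p * (c * b')"
      unfolding loop[symmetric] by (simp add: exp_minus divide_inverse algebra_simps)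
    also have "\<bar>\<dots>\<bar> \<le> \<bar>(1 - p) * \<tau>\<^sup>2 * (?v - a')\<bar> + \<bar>p * (1 + \<tau>\<^sup>2) * (b' - exp (- \<mu> n))\<bar> + \<bar>p * (c * b')\<bar>" by linarith
    also have "\<dots> \<le> (1 - p) * \<tau>\<^sup>2 * (exp B * D n) + p * (1 + \<tau>\<^sup>2) * D n + p * (1 / real n)"
    proof (intro add_mono)
      show "\<bar>(1 - p) * \<tau>\<^sup>2 * (?v - a')\<bar> \<le> (1 - p) * \<tau>\<^sup>2 * (exp B * D n)"
        unfolding abs_mult[of _ "?v - a'"] using a p unfolding a'_def by (intro mult_mono) (auto simp: abs_minus_commute)
      show "\<bar>p * (1 + \<tau>\<^sup>2) * (b' - exp (- \<mu> n))\<bar> \<le> p * (1 + \<tau>\<^sup>2) * D n"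
        unfolding abs_mult[of _ "b' - exp (- \<mu> n)"] using bb p unfolding b'_def by (intro mult_mono) auto
      have "c * b' \<le> c * 1" using b1 unfolding b'_def c_def by (intro mult_left_mono) auto
      then have "c * b' \<le> 1 / real n" by (simp add: c_def)
      moreover have "0 \<le> c * b'" using b1 by (simp add: b'_def c_def)
      ultimately have "p * (c * b') \<le> p * (1 / real n)" "0 \<le> p * (c * b')"
        using p by (auto intro: mult_left_mono mult_nonneg_nonneg simp del: times_divide_eq_right)
      then show "\<bar>p * (c * b')\<bar> \<le> p * (1 / real n)" by linarith
    qed
    finally have Q: "\<bar>(1 - p) * \<tau>\<^sup>2 * ?v - p * (1 + \<tau>\<^sup>2) / ?v - (1 - 2 * p) * \<tau>\<^sup>2\<bar> \<le> (1 - p) * \<tau>\<^sup>2 * (exp B * D n) + p * (1 + \<tau>\<^sup>2) * D n + p * (1 / real n)" .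
    have "\<bar>?v - f\<bar> \<le> \<bar>(1 - p) * \<tau>\<^sup>2 * ?v - p * (1 + \<tau>\<^sup>2) / ?v - (1 - 2 * p) * \<tau>\<^sup>2\<bar> / ((1 - p) * \<tau>\<^sup>2)"
      unfolding f_def by (rule quadratic_root_unique[OF p tau]) simp
    also have "\<dots> \<le> E n" unfolding E_def using Q p by (intro divide_right_mono) auto
    finally show ?thesis by simp
  qed
  have f0: "f > 0" unfolding f_def by (rule quadratic_root_unique(1)[OF p tau, of 1]) simp
  have D0: "D \<longlonglongrightarrow> 0" 
  proof -
    have "D = (\<lambda>n. (1 + B\<^sup>2) * sqrt (1 / real n))" by (simp add: D_def real_sqrt_divide)
    moreover have "(\<lambda>n. (1 + B\<^sup>2) * sqrt (1 / real n)) \<longlonglongrightarrow> (1 + B\<^sup>2) * sqrt 0"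
      by (intro tendsto_intros lim_1_over_n)
    ultimately show ?thesis by simp
  qed
  have "E \<longlonglongrightarrow> ((1 - p) * \<tau>\<^sup>2 * (exp B * 0) + p * (1 + \<tau>\<^sup>2) * 0 + p * 0) / ((1 - p) * \<tau>\<^sup>2)"
    unfolding E_def using p tau by (intro tendsto_intros D0 lim_1_over_n) auto
  then have E0: "E \<longlonglongrightarrow> 0" by simp
  have "\<forall>\<^sub>F n in sequentially. 2 / (\<tau>\<^sup>2 * real n) \<le> 1"
  proof -
    have "(\<lambda>n. B * (1 / real n)) \<longlonglongrightarrow> 0" by (intro tendsto_mult_right_zero lim_1_over_n)
    then have "\<forall>\<^sub>F n in sequentially. B * (1 / real n) < 1" by (rule order_tendstoD) simp
    then show ?thesis by eventually_elim (simp add: B_def)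
  qed
  then have "\<forall>\<^sub>F n in sequentially. norm (exp (\<mu> n) - f) \<le> E n"
    using eventually_ge_at_top[of 1] by eventually_elim (rule main)
  then have "(\<lambda>n. exp (\<mu> n) - f) \<longlonglongrightarrow> 0" using E0 by (rule Lim_null_comparison)
  then have "(\<lambda>n. exp (\<mu> n)) \<longlonglongrightarrow> f" by (simp only: LIM_zero_iff)
  then have "(\<lambda>n. ln (exp (\<mu> n))) \<longlonglongrightarrow> ln f" using f0 by (intro tendsto_ln) auto
  then show ?thesis unfolding \<mu>_def X_def f_def log_root_def by simp
qed

text \<open>Parts reach only \<open>n - 1\<close>, while the grid of the test functions runs up to
  \<open>n\<close>; the last term is 0.\<close>

lemma marginal_outside: "n \<ge> 1 \<Longrightarrow> marginal (n - 1) p n = 0"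
proof -
  assume n: "n \<ge> 1"
  have "EE (n - 1) p (\<lambda>L. if n \<in> L then 1 else 0) = EE (n - 1) p (\<lambda>_. 0)"
    using n by (intro EE_cong) auto
  then show ?thesis by (simp add: marginal_def EE_def)
qed

lemma sum_marginal_split:
  assumes "n \<ge> 1"
  shows "(\<Sum>y=1..n. marginal (n - 1) p y * F y) = (\<Sum>y=1..n-1. marginal (n - 1) p y * F y)"
proof -
  obtain k where "n = Suc k" using assms by (cases n) auto
  then show ?thesis using marginal_outside[OF assms, of p] by simp
qed

lemma mean_kernel_tendsto:
  assumes p: "0 < p" "p < 1" and tau: "\<tau> > 0"
  shows "(\<lambda>n. (\<Sum>y=1..n. marginal (n - 1) p y * kern \<tau> (real y / real n)) / real n) \<longlonglongrightarrow> log_root \<tau> (1 - 2 * p)"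
proof -
  let ?X = "\<lambda>n. EE (n - 1) p (\<lambda>L. \<Sum>y\<in>L. phi (\<tau>\<^sup>2 * (real n)\<^sup>2) y)"
  let ?S = "\<lambda>n. (\<Sum>y=1..n. marginal (n - 1) p y * kern \<tau> (real y / real n)) / real n"
  have main: "norm (?S n - ?X n) \<le> 4 / \<tau> ^ 4 * (1 / real n)" if n: "n \<ge> 1" "2 / (\<tau>\<^sup>2 * real n) \<le> 1" for n
  proof -
    have "?S n - ?X n = (\<Sum>y=1..n-1. marginal (n - 1) p y * (kern \<tau> (real y / real n) / real n - phi (\<tau>\<^sup>2 * (real n)\<^sup>2) y))"
      unfolding sum_marginal_split[OF n(1)] EE_linear_stat sum_divide_distrib sum_subtractf[symmetric]
      by (intro sum.cong refl) (simp add: algebra_simps)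
    also have "norm \<dots> \<le> (\<Sum>y=1..n-1. 1 * (4 / (\<tau> ^ 4 * (real n)\<^sup>2)))"
    proof (rule order_trans[OF norm_sum], rule sum_mono)
      fix y assume "y \<in> {1..n-1}"
      then have "\<bar>phi (\<tau>\<^sup>2 * (real n)\<^sup>2) y - kern \<tau> (real y / real n) / real n\<bar> \<le> 4 / (\<tau> ^ 4 * (real n)\<^sup>2)"
        by (intro phi_estimate tau n) auto
      then show "norm (marginal (n - 1) p y * (kern \<tau> (real y / real n) / real n - phi (\<tau>\<^sup>2 * (real n)\<^sup>2) y)) \<le> 1 * (4 / (\<tau> ^ 4 * (real n)\<^sup>2))"
        unfolding norm_mult using marginal_bounds[of p "n-1" y] p by (intro mult_mono) (auto simp: abs_minus_commute)
    qed
    also have "\<dots> = real (n - 1) * (4 / (\<tau> ^ 4 * (real n)\<^sup>2))" by simp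
    also have "\<dots> \<le> real n * (4 / (\<tau> ^ 4 * (real n)\<^sup>2))" by (intro mult_right_mono) auto
    also have "\<dots> = 4 / \<tau> ^ 4 * (1 / real n)" using n by (simp add: power2_eq_square)
    finally show ?thesis .
  qed
  have c0: "(\<lambda>n. c * (1 / real n)) \<longlonglongrightarrow> 0" for c :: real by (intro tendsto_mult_right_zero lim_1_over_n)
  have "\<forall>\<^sub>F n in sequentially. 2 / \<tau>\<^sup>2 * (1 / real n) < 1" by (rule order_tendstoD(2)[OF c0]) simp
  then have "\<forall>\<^sub>F n in sequentially. norm (?S n - ?X n) \<le> 4 / \<tau> ^ 4 * (1 / real n)"
    using eventually_ge_at_top[of 1] by eventually_elim (rule main, auto)
  then have "(\<lambda>n. ?S n - ?X n) \<longlonglongrightarrow> 0" using c0 by (rule Lim_null_comparison)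
  from tendsto_add[OF this mean_log_tendsto[OF p tau]] show ?thesis by simp
qed

section \<open>Convergence of the number of large parts\<close>

definition parts_beyond :: "nat \<Rightarrow> real \<Rightarrow> nat set \<Rightarrow> real" where
  "parts_beyond n x L = (\<Sum>y\<in>L. if x < real y / real n then 1 else 0)"

lemma EE_parts_beyond:
  assumes "n \<ge> 1"
  shows "EE (n - 1) p (parts_beyond n x) = (\<Sum>y=1..n. if x < real y / real n then marginal (n - 1) p y else 0)"
proof -
  have "EE (n - 1) p (parts_beyond n x) = (\<Sum>y=1..n-1. marginal (n - 1) p y * (if x < real y / real n then 1 else 0))"
    unfolding parts_beyond_def[abs_def] EE_linear_stat by (intro sum.cong refl) simp
  also have "\<dots> = (\<Sum>y=1..n. marginal (n - 1) p y * (if x < real y / real n then 1 else 0))"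
    by (rule sum_marginal_split[OF assms, symmetric])
  also have "\<dots> = (\<Sum>y=1..n. if x < real y / real n then marginal (n - 1) p y else 0)"
    by (intro sum.cong refl) simp
  finally show ?thesis .
qed

lemma tail_profile_tendsto:
  assumes t: "\<bar>t\<bar> < 1" and x: "0 < x" "x \<le> 1"
  shows "(\<lambda>n. (\<Sum>y=1..n. if x < real y / real n then real n * (profile t ((real y - 1) / real n) - profile t (real y / real n)) else 0) / real n) \<longlonglongrightarrow> profile t x"
    (is "?S \<longlonglongrightarrow> _")
proof -
  have main: "norm (?S n - profile t x) \<le> 1 / real n" if n: "n \<ge> 1" for n
  proof -
    define j where "j = nat \<lfloor>x * real n\<rfloor>"
    have xn: "0 \<le> x * real n" using x by simp
    have j: "real j \<le> x * real n" "x * real n < real j + 1" using xn unfolding j_def by linarith+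
    have jn: "j \<le> n"
    proof -
      have "x * real n \<le> 1 * real n" using x by (intro mult_right_mono) auto
      then show ?thesis using j by simp
    qed
    define h where "h = (\<lambda>v. profile t (v / real n))"
    have iff: "x < real y / real n \<longleftrightarrow> j < y" for y
    proof -
      have "x < real y / real n \<longleftrightarrow> x * real n < real y" using n by (simp add: pos_less_divide_eq)
      also have "\<dots> \<longleftrightarrow> j < y"
      proof
        assume "x * real n < real y" then show "j < y" using j(1) by simp
      next
        assume "j < y" then have "real j + 1 \<le> real y" by simp
        then show "x * real n < real y" using j(2) by linarith
      qed
      finally show ?thesis .
    qed
    have "?S n = (\<Sum>y=1..n. if j < y then h (real y - 1) - h (real y) else 0)"
      unfolding iff h_def sum_divide_distrib using n by (intro sum.cong refl) simp
    \<comment> \<open>Cutting the argument off at \<open>j\<close> makes the terms with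
      \<open>y \<le> j\<close> vanish, so that the truncated sum telescopes over the whole
      range.\<close>
    also have "\<dots> = (\<Sum>y=1..n. h (max (real j) (real y - 1)) - h (max (real j) (real y)))"
      by (intro sum.cong refl) (auto simp: max_def)
    also have "\<dots> = h (max (real j) 0) - h (max (real j) (real n))"
      by (rule sum_telescope_real[of "\<lambda>v. h (max (real j) v)"])
    also have "\<dots> = profile t (real j / real n)" using jn n by (simp add: h_def profile_at_1 max_def)
    finally have S: "?S n = profile t (real j / real n)" .
    have "real j / real n \<le> x" using j n by (simp add: divide_le_eq)
    then have "\<bar>profile t (real j / real n) - profile t x\<bar> \<le> x - real j / real n" using x by (intro profile_lipschitz t) auto
    also have "\<dots> \<le> 1 / real n"
    proof -
      have "x \<le> (real j + 1) / real n" using j n by (simp add: pos_le_divide_eq)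
      then show ?thesis by (simp add: add_divide_distrib)
    qed
    finally show ?thesis unfolding S by simp
  qed
  have "(\<lambda>n. ?S n - profile t x) \<longlonglongrightarrow> 0"
    by (rule Lim_null_comparison[OF _ lim_1_over_n]) (use main in \<open>auto simp: eventually_sequentially intro!: exI[of _ 1]\<close>)
  then show ?thesis by (simp only: LIM_zero_iff)
qed

text \<open>The probabilities of parts and the candidate density have the same limits against every
  \<open>kern \<tau>\<close>, namely \<open>log_root\<close>; their difference is bounded, so
  \<open>tail_sum_tendsto\<close> applies to it.\<close>

lemma mean_tail_tendsto:
  assumes p: "0 < p" "p < 1" and x: "0 < x" "x \<le> 1"
  shows "(\<lambda>n. EE (n - 1) p (parts_beyond n x) / real n) \<longlonglongrightarrow> profile (1 - 2 * p) x"
proof -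
  define t where "t = 1 - 2 * p"
  have t: "\<bar>t\<bar> < 1" using p by (auto simp: t_def abs_less_iff)
  define c where "c = (\<lambda>n y. real n * (profile t ((real y - 1) / real n) - profile t (real y / real n)))"
  \<comment> \<open>The value 0 outside the grid makes the bound hold for all indices, as the lemma
    on test functions demands.\<close>
  define d where "d = (\<lambda>n y. if y \<in> {1..n} then marginal (n - 1) p y - c n y else 0)"
  have db: "\<bar>d n y\<bar> \<le> 2" for n y
  proof (cases "y \<in> {1..n}")
    case True
    then have n: "real n > 0" "1 \<le> y" "y \<le> n" by auto
    have "\<bar>profile t ((real y - 1) / real n) - profile t (real y / real n)\<bar> \<le> real y / real n - (real y - 1) / real n"
      using n by (intro profile_lipschitz t) (auto simp: divide_right_mono)
    also have "\<dots> = 1 / real n" by (simp add: diff_divide_distrib)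
    finally have "real n * \<bar>profile t ((real y - 1) / real n) - profile t (real y / real n)\<bar> \<le> real n * (1 / real n)"
      using n by (intro mult_left_mono) auto
    then have "\<bar>c n y\<bar> \<le> 1" using n unfolding c_def abs_mult by simp
    moreover have "0 \<le> marginal (n-1) p y" "marginal (n-1) p y \<le> 1" using marginal_bounds[of p "n-1" y] p by auto
    ultimately show ?thesis using True unfolding d_def by (simp add: abs_le_iff)
  next
    case False
    then have "d n y = 0" unfolding d_def by (simp only: if_False)
    then show ?thesis by simp
  qed
  have "(\<lambda>n. (\<Sum>y=1..n. if x < real y / real n then d n y else 0) / real n) \<longlonglongrightarrow> 0"
  proof (rule tail_sum_tendsto[OF db _ x(1)])
    fix \<tau> :: real assume tau: "\<tau> > 0"
    have "(\<lambda>n. (\<Sum>y=1..n. marginal (n - 1) p y * kern \<tau> (real y / real n)) / real n - (\<Sum>y=1..n. c n y * kern \<tau> (real y / real n)) / real n) \<longlonglongrightarrow> log_root \<tau> t - log_root \<tau> t"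
      unfolding c_def using mean_kernel_tendsto[OF p tau] riemann_profile[OF tau t] unfolding t_def by (intro tendsto_diff)
    moreover have "(\<Sum>y=1..n. marginal (n - 1) p y * kern \<tau> (real y / real n)) / real n - (\<Sum>y=1..n. c n y * kern \<tau> (real y / real n)) / real n
       = (\<Sum>y=1..n. d n y * kern \<tau> (real y / real n)) / real n" for n
      unfolding diff_divide_distrib[symmetric] sum_subtractf[symmetric] d_def
      by (intro arg_cong2[where f = "(/)"] sum.cong refl) (simp add: algebra_simps)
    ultimately show "(\<lambda>n. (\<Sum>y=1..n. d n y * kern \<tau> (real y / real n)) / real n) \<longlonglongrightarrow> 0" by simp
  qed
  from tendsto_add[OF this tail_profile_tendsto[OF t x]]
  have L: "(\<lambda>n. (\<Sum>y=1..n. if x < real y / real n then d n y else 0) / real n + (\<Sum>y=1..n. if x < real y / real n then c n y else 0) / real n) \<longlonglongrightarrow> profile t x"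
    unfolding c_def by simp
  have "\<forall>\<^sub>F n in sequentially. (\<Sum>y=1..n. if x < real y / real n then d n y else 0) / real n + (\<Sum>y=1..n. if x < real y / real n then c n y else 0) / real n
      = EE (n - 1) p (parts_beyond n x) / real n"
    using eventually_ge_at_top[of 1]
  proof eventually_elim
    case (elim n)
    show ?case unfolding EE_parts_beyond[OF elim] add_divide_distrib[symmetric] sum.distrib[symmetric]
      by (intro arg_cong2[where f = "(/)"] sum.cong refl) (simp add: d_def)
  qed
  from Lim_transform_eventually[OF L this] show ?thesis by (simp only: t_def)
qed

text \<open>Chebyshev's inequality: half of \<open>\<epsilon>\<close> absorbs the deviation of the
  mean, and the variance of the count is at most \<open>n\<close> against a threshold of order
  \<open>n^2\<close>.\<close>

lemma poisson_prob_tendsto: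
  assumes p: "0 < p" "p < 1" and x: "0 < x" "x \<le> 1" and e: "\<epsilon> > 0"
  shows "(\<lambda>n. EE (n - 1) p (\<lambda>L. if \<bar>parts_beyond n x L / real n - profile (1 - 2 * p) x\<bar> > \<epsilon> then 1 else 0)) \<longlonglongrightarrow> 0"
proof -
  let ?m = "\<lambda>n. EE (n - 1) p (parts_beyond n x)"
  let ?I = "\<lambda>n. EE (n - 1) p (\<lambda>L. if \<bar>parts_beyond n x L / real n - profile (1 - 2 * p) x\<bar> > \<epsilon> then 1 else 0)"
  have p': "0 \<le> p" "p \<le> 1" using p by auto
  have main: "norm (?I n) \<le> 4 / \<epsilon>\<^sup>2 * (1 / real n)" if n: "n \<ge> 1" "\<bar>?m n / real n - profile (1 - 2 * p) x\<bar> < \<epsilon> / 2" for n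
  proof -
    have "?I n \<le> EE (n - 1) p (\<lambda>L. (4 / (\<epsilon>\<^sup>2 * (real n)\<^sup>2)) * (parts_beyond n x L - ?m n)\<^sup>2)"
    proof (rule EE_mono[OF p'])
      fix L
      show "(if \<bar>parts_beyond n x L / real n - profile (1 - 2 * p) x\<bar> > \<epsilon> then 1 else 0) \<le> (4 / (\<epsilon>\<^sup>2 * (real n)\<^sup>2)) * (parts_beyond n x L - ?m n)\<^sup>2"
      proof (cases "\<bar>parts_beyond n x L / real n - profile (1 - 2 * p) x\<bar> > \<epsilon>")
        case True
        then have "\<bar>parts_beyond n x L / real n - ?m n / real n\<bar> > \<epsilon> / 2" using n(2) by linarith
        then have "\<bar>parts_beyond n x L - ?m n\<bar> / real n > \<epsilon> / 2" using n(1) by (simp add: diff_divide_distrib[symmetric] abs_divide)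
        then have "\<epsilon> * real n / 2 \<le> \<bar>parts_beyond n x L - ?m n\<bar>" using n(1) by (simp add: field_simps)
        then have "(\<epsilon> * real n / 2)\<^sup>2 \<le> (parts_beyond n x L - ?m n)\<^sup>2" using e by (metis power_mono power2_abs less_imp_le mult_nonneg_nonneg of_nat_0_le_iff zero_le_divide_iff zero_le_numeral)
        then have "(4 / (\<epsilon>\<^sup>2 * (real n)\<^sup>2)) * (\<epsilon> * real n / 2)\<^sup>2 \<le> (4 / (\<epsilon>\<^sup>2 * (real n)\<^sup>2)) * (parts_beyond n x L - ?m n)\<^sup>2"
          by (intro mult_left_mono) auto
        moreover have "(4 / (\<epsilon>\<^sup>2 * (real n)\<^sup>2)) * (\<epsilon> * real n / 2)\<^sup>2 = 1" using e n by (simp add: power_mult_distrib power_divide)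
        ultimately show ?thesis using True by simp
      qed simp
    qed
    also have "\<dots> = (4 / (\<epsilon>\<^sup>2 * (real n)\<^sup>2)) * EE (n - 1) p (\<lambda>L. (parts_beyond n x L - ?m n)\<^sup>2)" by (rule EE_cmult)
    also have "\<dots> \<le> (4 / (\<epsilon>\<^sup>2 * (real n)\<^sup>2)) * real n"
    proof (rule mult_left_mono)
      have "EE (n - 1) p (\<lambda>L. (parts_beyond n x L - ?m n)\<^sup>2) \<le> (\<Sum>y\<in>{1..n-1}. (if x < real y / real n then 1 else 0 :: real)\<^sup>2)"
        unfolding parts_beyond_def[abs_def] using p by (intro variance_bound) auto
      also have "\<dots> \<le> (\<Sum>y\<in>{1..n-1}. 1)" by (intro sum_mono) auto
      also have "\<dots> \<le> real n" by simp
      finally show "EE (n - 1) p (\<lambda>L. (parts_beyond n x L - ?m n)\<^sup>2) \<le> real n" .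
    qed simp
    also have "\<dots> = 4 / \<epsilon>\<^sup>2 * (1 / real n)" using n by (simp add: power2_eq_square)
    finally have "?I n \<le> 4 / \<epsilon>\<^sup>2 * (1 / real n)" .
    moreover have "0 \<le> ?I n" using EE_mono[OF p', of "n-1" "\<lambda>_. 0"] p' by (simp add: EE_const)
    ultimately show ?thesis by simp
  qed
  have "\<forall>\<^sub>F n in sequentially. dist (?m n / real n) (profile (1 - 2 * p) x) < \<epsilon> / 2"
    using mean_tail_tendsto[OF p x] e by (intro tendstoD) auto
  then have "\<forall>\<^sub>F n in sequentially. norm (?I n) \<le> 4 / \<epsilon>\<^sup>2 * (1 / real n)"
    using eventually_ge_at_top[of 1] by eventually_elim (rule main, auto simp: dist_real_def)
  moreover have "(\<lambda>n. 4 / \<epsilon>\<^sup>2 * (1 / real n)) \<longlonglongrightarrow> 0" by (intro tendsto_mult_right_zero lim_1_over_n)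
  ultimately show ?thesis by (rule Lim_null_comparison)
qed

section \<open>132-avoiding networks as growth words\<close>

text \<open>A part \<open>j - 1\<close> at position \<open>j\<close> has its rank, counted from the
  largest part, as value. Any other position has value \<open>card L\<close> plus the number of such
  positions up to \<open>j\<close>, which is \<open>j + card {y\<in>L. j \<le> y}\<close>. Position
  1 belongs to the absent part 0 and has value \<open>card L + 1\<close>.\<close>

definition one_line :: "nat set \<Rightarrow> nat \<Rightarrow> nat" where
  "one_line L j = (if j - 1 \<in> L then card {y\<in>L. j - 1 \<le> y} else j + card {y\<in>L. j \<le> y})"

lemma card_add_part:
  assumes "finite L" "0 \<notin> L" "addable i L" "a \<ge> 1"
  shows "card {y \<in> add_part i L. a \<le> y} = card {y\<in>L. a \<le> y} + (if a = i then 1 else 0)"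
proof -
  have i: "i \<ge> 1" "i \<notin> L" "i = 1 \<or> i - 1 \<in> L" using assms by (auto simp: addable_def)
  consider "a > i" | "a = i" | "a < i" by linarith
  then show ?thesis
  proof cases
    case 1
    then have "{y \<in> add_part i L. a \<le> y} = {y\<in>L. a \<le> y}" by (auto simp: add_part_def)
    then show ?thesis using 1 by simp
  next
    case 2
    then have "{y \<in> add_part i L. a \<le> y} = insert i {y\<in>L. a \<le> y}" using i by (auto simp: add_part_def)
    then show ?thesis using 2 i assms by simp
  next
    case 3
    then have m: "i - 1 \<in> L" "a \<le> i - 1" using i assms by auto
    have "{y \<in> add_part i L. a \<le> y} = insert i ({y\<in>L. a \<le> y} - {i - 1})" using 3 i by (auto simp: add_part_def)
    moreover have "card ({y\<in>L. a \<le> y} - {i - 1}) = card {y\<in>L. a \<le> y} - 1" using m by (simp add: card_Diff_singleton)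
    moreover have "card {y\<in>L. a \<le> y} > 0" using m assms by (auto simp: card_gt_0_iff)
    ultimately show ?thesis using 3 i assms by simp
  qed
qed

lemma card_split_at:
  fixes L :: "nat set"
  assumes "finite L"
  shows "card {y\<in>L. a \<le> y} = card {y\<in>L. Suc a \<le> y} + (if a \<in> L then 1 else 0)"
proof -
  have "{y\<in>L. a \<le> y} = (if a \<in> L then insert a {y\<in>L. Suc a \<le> y} else {y\<in>L. Suc a \<le> y})"
    by (auto simp: not_less_eq_eq[symmetric] intro: le_antisym)
  then show ?thesis using assms by simp
qed

text \<open>Swapping positions \<open>i\<close> and \<open>i + 1\<close> moves the part at position
  \<open>i\<close> one place to the right. Since \<open>card_add_part\<close> changes the count at
  the single threshold \<open>i\<close>, all other entries stay. For \<open>i = 1\<close> the entry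
  \<open>card L + 1\<close> of position 1 becomes the rank of a new smallest part.\<close>

lemma one_line_step:
  assumes L: "finite L" "0 \<notin> L" and c: "addable i L" and j: "j \<ge> 1"
  shows "one_line L (swp i (Suc i) j) = one_line (add_part i L) j"
proof -
  have i: "i \<ge> 1" "i \<notin> L" "i = 1 \<or> i - 1 \<in> L" using c by (auto simp: addable_def)
  note cs = card_add_part[OF L c]
  consider "j = i" | "j = Suc i" | "j \<noteq> i" "j \<noteq> Suc i" by blast
  then show ?thesis
  proof cases
    case 1
    have "i - 1 \<notin> add_part i L" using i by (auto simp: add_part_def)
    then show ?thesis using 1 i cs[of i] card_split_at[OF L(1), of i] by (simp add: swp_def one_line_def)
  next
    case 2
    have m: "i \<in> add_part i L" by (simp add: add_part_def)
    show ?thesis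
    proof (cases "i - 1 \<in> L")
      case True
      then have "i - 1 \<ge> 1" using L by (cases "i - 1") auto
      have "card {y\<in>L. i - 1 \<le> y} = card {y\<in>L. i \<le> y} + 1"
        using card_split_at[OF L(1), of "i - 1"] True i by simp
      then show ?thesis using 2 True m i cs[of i] by (simp add: swp_def one_line_def)
    next
      case False
      then have "i = 1" using i by simp
      then show ?thesis using 2 False m cs[of 1] by (simp add: swp_def one_line_def)
    qed
  next
    case 3
    have s: "swp i (Suc i) j = j" using 3 by (simp add: swp_def)
    have m: "j - 1 \<in> add_part i L \<longleftrightarrow> j - 1 \<in> L" using 3 j i by (auto simp: add_part_def)
    show ?thesis
    proof (cases "j - 1 \<in> L")
      case True
      then have "j - 1 \<ge> 1" using L by (cases "j - 1") auto
      then show ?thesis using 3 True m s cs[of "j - 1"] by (auto simp: one_line_def)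
    next
      case False
      then show ?thesis using 3 False m s cs[of j] j by (simp add: one_line_def)
    qed
  qed
qed

lemma one_line_part_le: "finite L \<Longrightarrow> j - 1 \<in> L \<Longrightarrow> one_line L j \<le> card L"
  by (auto simp: one_line_def intro: card_mono)

lemma one_line_other_ge:
  assumes "finite L" "0 \<notin> L" "j - 1 \<notin> L" "j \<ge> 1"
  shows "one_line L j > card L"
proof -
  have "L = {y\<in>L. y < j} \<union> {y\<in>L. j \<le> y}" by auto
  then have "card L \<le> card {y\<in>L. y < j} + card {y\<in>L. j \<le> y}" by (metis card_Un_le)
  moreover have "card {y\<in>L. y < j} \<le> card {1..<j}"
    using assms(2) by (intro card_mono) (auto simp: Suc_le_eq intro!: Nat.gr0I)
  ultimately show ?thesis using assms by (simp add: one_line_def)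
qed

lemma one_line_part_anti:
  assumes "finite L" "i - 1 \<in> L" "k - 1 \<in> L" "i < k" "i \<ge> 1"
  shows "one_line L k < one_line L i"
proof -
  have "{y\<in>L. k - 1 \<le> y} \<subset> {y\<in>L. i - 1 \<le> y}"
  proof
    show "{y\<in>L. k - 1 \<le> y} \<subseteq> {y\<in>L. i - 1 \<le> y}" using assms by auto
    have "i - 1 \<notin> {y\<in>L. k - 1 \<le> y}" "i - 1 \<in> {y\<in>L. i - 1 \<le> y}" using assms by auto
    then show "{y\<in>L. k - 1 \<le> y} \<noteq> {y\<in>L. i - 1 \<le> y}" by blast
  qed
  then show ?thesis using assms by (simp add: one_line_def psubset_card_mono)
qed

lemma one_line_other_mono:
  assumes "finite L" "j - 1 \<notin> L" "k - 1 \<notin> L" "j < k"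
  shows "one_line L j < one_line L k"
proof -
  have "{y\<in>L. j \<le> y} \<subseteq> {j..<k - 1} \<union> {y\<in>L. k \<le> y}"
  proof
    fix y assume y: "y \<in> {y\<in>L. j \<le> y}"
    then have "y \<noteq> k - 1" using assms by auto
    then show "y \<in> {j..<k - 1} \<union> {y\<in>L. k \<le> y}" using y by auto
  qed
  then have "card {y\<in>L. j \<le> y} \<le> card ({j..<k - 1} \<union> {y\<in>L. k \<le> y})" using assms by (intro card_mono) auto
  also have "\<dots> \<le> (k - 1 - j) + card {y\<in>L. k \<le> y}" using card_Un_le[of "{j..<k - 1}"] by simp
  finally show ?thesis using assms by (simp add: one_line_def)
qed

text \<open>In a pattern 132 at \<open>i < j < k\<close>, if position \<open>k\<close> carried no
  part then the larger entry at \<open>j\<close> would carry none either, contradicting that such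
  entries increase. So \<open>k\<close> carries a part, hence so does the smaller entry at
  \<open>i\<close>; but ranks decrease from left to right.\<close>

lemma one_line_avoids132:
  assumes L: "finite L" "0 \<notin> L" and s: "\<And>j. j \<ge> 1 \<Longrightarrow> \<sigma> j = one_line L j"
  shows "avoids132 n \<sigma>"
  unfolding avoids132_def
proof
  assume "\<exists>i j k. 1 \<le> i \<and> i < j \<and> j < k \<and> k \<le> n \<and> \<sigma> i < \<sigma> k \<and> \<sigma> k < \<sigma> j"
  then obtain i j k where *: "1 \<le> i" "i < j" "j < k" "\<sigma> i < \<sigma> k" "\<sigma> k < \<sigma> j" by blast
  then have "\<sigma> i = one_line L i" "\<sigma> j = one_line L j" "\<sigma> k = one_line L k" by (intro s; simp)+
  with * have ijk: "1 \<le> i" "i < j" "j < k" "one_line L i < one_line L k" "one_line L k < one_line L j" by simp_all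
  have "k - 1 \<in> L"
  proof (rule ccontr)
    assume k: "k - 1 \<notin> L"
    then have "one_line L k > card L" using L ijk by (intro one_line_other_ge) auto
    then have "j - 1 \<notin> L" using one_line_part_le[OF L(1), of j] ijk by linarith
    then show False using one_line_other_mono[OF L(1) _ k] ijk by fastforce
  qed
  moreover from this have "i - 1 \<in> L"
    using one_line_part_le[OF L(1), of k] one_line_other_ge[OF L, of i] ijk by linarith
  ultimately show False using one_line_part_anti[OF L(1), of i k] ijk by linarith
qed

lemma inter_0: "inter w 0 = id"
  by (simp add: inter_def)

lemma inter_Suc: "k < length w \<Longrightarrow> inter w (Suc k) = inter w k \<circ> swp (w ! k) (Suc (w ! k))"
  by (simp add: inter_def take_Suc_conv_app_nth)

lemma shape_0: "shape w 0 = {}"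
  by (simp add: shape_def)

lemma shape_Suc: "k < length w \<Longrightarrow> shape w (Suc k) = add_part (w ! k) (shape w k)"
  by (simp add: shape_def take_Suc_conv_app_nth)

lemma ok_take_Suc: "k < length w \<Longrightarrow> ok M {} (take (Suc k) w) \<longleftrightarrow> ok M {} (take k w) \<and> w ! k \<le> M \<and> addable (w ! k) (shape w k)"
  by (simp add: take_Suc_conv_app_nth ok_append shape_def)

lemma inter_eq_one_line:
  assumes "ok M {} (take k w)" "k \<le> length w" "j \<ge> 1"
  shows "inter w k j = one_line (shape w k) j"
  using assms
proof (induction k arbitrary: j)
  case 0
  then show ?case by (simp add: inter_0 shape_0 one_line_def)
next
  case (Suc k)
  then have k: "k < length w" by simp
  have o: "ok M {} (take k w)" "addable (w ! k) (shape w k)" using Suc.prems k by (auto simp: ok_take_Suc)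
  have L: "shape w k \<subseteq> {1..M}" using run_subset[of "{}" M "take k w"] o by (simp add: shape_def)
  then have L': "finite (shape w k)" "0 \<notin> shape w k" by (auto intro: finite_subset)
  have "swp (w ! k) (Suc (w ! k)) j \<ge> 1" using Suc.prems o by (auto simp: swp_def addable_def)
  then have "inter w (Suc k) j = one_line (shape w k) (swp (w ! k) (Suc (w ! k)) j)"
    using Suc k o by (simp add: inter_Suc)
  also have "\<dots> = one_line (shape w (Suc k)) j" unfolding shape_Suc[OF k] using L' o Suc.prems by (intro one_line_step)
  finally show ?case .
qed

lemma NN_eq: "n \<ge> 1 \<Longrightarrow> NN n = \<Sum>{1..n-1}"
proof -
  have "Suc M choose 2 = \<Sum>{1..M}" for M by (induction M) (simp_all add: numeral_2_eq_2)
  then show "n \<ge> 1 \<Longrightarrow> NN n = \<Sum>{1..n-1}" unfolding NN_def by (metis Suc_diff_1 less_le_trans zero_less_one)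
qed

lemma full_set:
  fixes L :: "nat set"
  assumes "L \<subseteq> {1..M}" "\<Sum>L = \<Sum>{1..M}"
  shows "L = {1..M}"
proof -
  have "\<Sum>{1..M} = \<Sum>L + \<Sum>({1..M} - L)" using assms(1) by (simp add: sum.subset_diff)
  then have "\<Sum>({1..M} - L) = 0" using assms by simp
  then have "{1..M} - L = {}" by (subst (asm) sum_eq_0_set) auto
  then show ?thesis using assms by auto
qed

lemma networks_subset_R132:
  assumes n: "n \<ge> 1" and w: "w \<in> networks (n - 1)"
  shows "w \<in> R132 n"
proof -
  let ?M = "n - 1"
  have w': "length w = NN n" "ok ?M {} w" using w NN_eq[OF n] by (auto simp: networks_def)
  have o: "ok ?M {} (take k w)" for k using w' ok_take_drop[of ?M "{}" w k] by simp
  have L: "shape w k \<subseteq> {1..?M}" for k using shape_subset[OF w] .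
  have inter: "inter w k j = one_line (shape w k) j" if "k \<le> NN n" "j \<ge> 1" for k j
    using inter_eq_one_line[OF o] that w' by simp
  have full: "shape w (NN n) = {1..?M}"
    using sum_shape[OF w, of "NN n"] NN_eq[OF n] by (intro full_set L) simp
  have rev: "inter w (NN n) j = n + 1 - j" if j: "j \<in> {1..n}" for j
  proof -
    have "one_line {1..?M} j = n + 1 - j"
    proof (cases "j = 1")
      case True
      have e: "{y\<in>{1..?M}. 1 \<le> y} = {1..?M}" by auto
      show ?thesis unfolding True one_line_def e using n by simp
    next
      case False
      then have "{y\<in>{1..?M}. j - 1 \<le> y} = {j-1..?M}" using j by auto
      moreover have "j - 1 \<in> {1..?M}" using False j by auto
      ultimately show ?thesis using j by (simp add: one_line_def) 
    qed
    then show ?thesis using inter[of "NN n" j] j full by simp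
  qed
  have "sorting_network n w"
    unfolding sorting_network_def using w' rev ok_letters[OF w'(2)] by auto
  moreover have "avoids132 n (inter w k)" if "k \<le> NN n" for k
    using L[of k] inter[OF that] by (intro one_line_avoids132[of "shape w k"]) (auto intro: finite_subset)
  ultimately show ?thesis by (simp add: R132_def)
qed

text \<open>Inversions recorded by values rather than positions, so that an adjacent swap creates at
  most the one pair of swapped values and relabels nothing.\<close>

definition inv_values :: "nat \<Rightarrow> (nat \<Rightarrow> nat) \<Rightarrow> (nat \<times> nat) set" where
  "inv_values n \<sigma> = {(\<sigma> b, \<sigma> a) | a b. 1 \<le> a \<and> a < b \<and> b \<le> n \<and> \<sigma> b < \<sigma> a}"

lemma finite_inv_values: "finite (inv_values n \<sigma>)"
  by (rule finite_subset[of _ "(\<lambda>(a,b). (\<sigma> b, \<sigma> a)) ` ({1..n} \<times> {1..n})"]) (auto simp: inv_values_def)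

lemma inv_values_swp:
  assumes i: "1 \<le> i" "Suc i \<le> n"
  shows "inv_values n (\<sigma> \<circ> swp i (Suc i)) \<subseteq> (if \<sigma> i < \<sigma> (Suc i) then insert (\<sigma> i, \<sigma> (Suc i)) (inv_values n \<sigma>) else inv_values n \<sigma>)"
proof
  fix z assume "z \<in> inv_values n (\<sigma> \<circ> swp i (Suc i))"
  then obtain a b where z: "z = (\<sigma> (swp i (Suc i) b), \<sigma> (swp i (Suc i) a))" "1 \<le> a" "a < b" "b \<le> n"
     "\<sigma> (swp i (Suc i) b) < \<sigma> (swp i (Suc i) a)" by (auto simp: inv_values_def)
  show "z \<in> (if \<sigma> i < \<sigma> (Suc i) then insert (\<sigma> i, \<sigma> (Suc i)) (inv_values n \<sigma>) else inv_values n \<sigma>)"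
  proof (cases "a = i \<and> b = Suc i")
    case True
    then show ?thesis using z by (simp add: swp_def)
  next
    case False
    then have "1 \<le> swp i (Suc i) a" "swp i (Suc i) a < swp i (Suc i) b" "swp i (Suc i) b \<le> n"
      using z i by (auto simp: swp_def)
    then have "z \<in> inv_values n \<sigma>" using z unfolding inv_values_def by blast
    then show ?thesis by simp
  qed
qed

lemma card_inv_values_reverse:
  assumes n: "n \<ge> 1" and s: "\<And>j. j \<in> {1..n} \<Longrightarrow> \<sigma> j = n + 1 - j"
  shows "card (inv_values n \<sigma>) = NN n"
proof -
  define S where "S = (SIGMA b:{1..n}. {1..<b})"
  have "inv_values n \<sigma> = (\<lambda>(b,a). (n + 1 - b, n + 1 - a)) ` S"
  proof
    show "inv_values n \<sigma> \<subseteq> (\<lambda>(b,a). (n + 1 - b, n + 1 - a)) ` S"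
    proof
      fix z assume "z \<in> inv_values n \<sigma>"
      then obtain a b where z: "z = (\<sigma> b, \<sigma> a)" "1 \<le> a" "a < b" "b \<le> n" by (auto simp: inv_values_def)
      then have "z = (\<lambda>(b,a). (n + 1 - b, n + 1 - a)) (b,a)" "(b,a) \<in> S" using s[of a] s[of b] by (auto simp: S_def)
      then show "z \<in> (\<lambda>(b,a). (n + 1 - b, n + 1 - a)) ` S" by (rule image_eqI)
    qed
    show "(\<lambda>(b,a). (n + 1 - b, n + 1 - a)) ` S \<subseteq> inv_values n \<sigma>"
    proof
      fix z assume "z \<in> (\<lambda>(b,a). (n + 1 - b, n + 1 - a)) ` S"
      then obtain a b where z: "z = (n + 1 - b, n + 1 - a)" "1 \<le> a" "a < b" "b \<le> n" by (auto simp: S_def)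
      then have "\<sigma> a = n + 1 - a" "\<sigma> b = n + 1 - b" using s[of a] s[of b] by auto
      then show "z \<in> inv_values n \<sigma>" using z unfolding inv_values_def by (intro CollectI exI[of _ a] exI[of _ b]) auto
    qed
  qed
  moreover have "inj_on (\<lambda>(b,a). (n + 1 - b, n + 1 - a)) S"
    by (auto simp: inj_on_def S_def)
  ultimately have "card (inv_values n \<sigma>) = card S" by (simp add: card_image)
  also have "\<dots> = (\<Sum>b\<in>{1..n}. b - 1)" by (simp add: S_def)
  also have "\<dots> = (\<Sum>b\<in>{1..n-1}. b)"
  proof -
    obtain m where m: "n = Suc m" using n by (cases n) auto
    have "(\<Sum>b\<in>{1..Suc m}. b - 1) = (\<Sum>b\<in>{1..m}. b)" by (induction m) auto
    then show ?thesis by (simp add: m)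
  qed
  finally show ?thesis using NN_eq[OF n] by simp
qed

text \<open>The reverse permutation has \<open>NN n\<close> inversions, the number of letters, and
  each letter creates at most one; a swap at a non-ascent creates none, and the total could not be
  reached.\<close>

lemma network_ascents:
  assumes n: "n \<ge> 1" and w: "sorting_network n w" and k: "k < NN n"
  shows "inter w k (w ! k) < inter w k (Suc (w ! k))"
proof (rule ccontr)
  assume na: "\<not> ?thesis"
  have len: "length w = NN n" and lets: "\<And>m. m < NN n \<Longrightarrow> 1 \<le> w ! m \<and> Suc (w ! m) \<le> n"
  proof -
    show len: "length w = NN n" using w by (simp add: sorting_network_def)
    fix m assume "m < NN n"
    then have "1 \<le> w ! m \<and> w ! m \<le> n - 1" using w len by (simp add: sorting_network_def)
    then show "1 \<le> w ! m \<and> Suc (w ! m) \<le> n" using n by linarith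
  qed
  define v where "v = (\<lambda>m. card (inv_values n (inter w m)))"
  have step: "v (Suc m) \<le> Suc (v m)" if "m < NN n" for m
  proof -
    have "inv_values n (inter w (Suc m)) \<subseteq> insert (inter w m (w ! m), inter w m (Suc (w ! m))) (inv_values n (inter w m))"
      using inv_values_swp[of "w ! m" n "inter w m"] lets[OF that] that len by (auto simp: inter_Suc split: if_splits)
    then have "v (Suc m) \<le> card (insert (inter w m (w ! m), inter w m (Suc (w ! m))) (inv_values n (inter w m)))"
      unfolding v_def using finite_inv_values by (intro card_mono) auto
    also have "\<dots> \<le> Suc (v m)" unfolding v_def by (simp add: card_insert_if finite_inv_values)
    finally show ?thesis .
  qed
  have v0: "v 0 = 0" by (auto simp: v_def inter_0 inv_values_def card_eq_0_iff)
  have up: "m \<le> NN n \<Longrightarrow> v m \<le> m" for m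
  proof (induction m)
    case (Suc m)
    then show ?case using step[of m] by simp
  qed (simp add: v0)
  have down: "Suc k + d \<le> NN n \<Longrightarrow> v (Suc k + d) \<le> v (Suc k) + d" for d
  proof (induction d)
    case (Suc d)
    then show ?case using step[of "Suc k + d"] by simp
  qed simp
  have "v (Suc k) \<le> v k"
    unfolding v_def using inv_values_swp[of "w ! k" n "inter w k"] lets[OF k] na k len finite_inv_values
    by (intro card_mono) (auto simp: inter_Suc)
  then have "v (NN n) \<le> k + (NN n - Suc k)" using down[of "NN n - Suc k"] up[of k] k by simp
  moreover have "v (NN n) = NN n" unfolding v_def using w n by (intro card_inv_values_reverse) (auto simp: sorting_network_def)
  ultimately show False using k by simp
qed

text \<open>By induction the prefix is a growth word with known one-line form. The next letter must
  swap an ascent and must not create a pattern 132, which leaves exactly the addable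
  letters.\<close>

lemma R132_subset_networks:
  assumes n: "n \<ge> 1" and w: "w \<in> R132 n"
  shows "w \<in> networks (n - 1)"
proof -
  let ?M = "n - 1"
  have sn: "sorting_network n w" and av: "\<And>k. k \<le> NN n \<Longrightarrow> avoids132 n (inter w k)" using w by (auto simp: R132_def)
  have len: "length w = NN n" and lets: "\<And>m. m < NN n \<Longrightarrow> 1 \<le> w ! m \<and> w ! m \<le> ?M"
    using sn by (auto simp: sorting_network_def)
  have "k \<le> NN n \<Longrightarrow> ok ?M {} (take k w)" for k
  proof (induction k)
    case (Suc k)
    then have k: "k < NN n" and o: "ok ?M {} (take k w)" by auto
    define L where "L = shape w k"
    define i where "i = w ! k"
    have i: "1 \<le> i" "i \<le> ?M" using lets[OF k] by (auto simp: i_def)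
    have "L \<subseteq> {1..?M}" using run_subset[of "{}" ?M "take k w"] o by (simp add: L_def shape_def)
    then have L: "finite L" "0 \<notin> L" by (auto intro: finite_subset)
    have int: "inter w k j = one_line L j" if "j \<ge> 1" for j using inter_eq_one_line[OF o] k len that by (simp add: L_def)
    have asc: "one_line L i < one_line L (Suc i)" using network_ascents[OF n sn k] int i by (simp add: i_def)
    \<comment> \<open>If \<open>i\<close> were a part, position \<open>i + 1\<close> would hold a
      rank, so the ascent would force a rank at position \<open>i\<close> as well; but ranks
      decrease.\<close>
    have iL: "i \<notin> L"
    proof
      assume m: "i \<in> L"
      then have "one_line L (Suc i) \<le> card L" using L by (intro one_line_part_le) auto
      then have "i - 1 \<in> L" using asc one_line_other_ge[OF L, of i] i by fastforce
      then show False using one_line_part_anti[OF L(1), of i "Suc i"] m i asc by simp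
    qed
    have "i = 1 \<or> i - 1 \<in> L"
    proof (rule ccontr)
      \<comment> \<open>Otherwise positions \<open>1\<close>, \<open>i\<close> and
        \<open>i + 1\<close> carry no parts and increase, and the swap turns them into a pattern
        132.\<close>
      assume h: "\<not> (i = 1 \<or> i - 1 \<in> L)"
      then have "one_line L 1 < one_line L i" using i L by (intro one_line_other_mono) auto
      define \<tau> where "\<tau> = inter w (Suc k)"
      have \<tau>: "\<tau> j = inter w k (swp i (Suc i) j)" for j using k len by (simp add: \<tau>_def inter_Suc i_def)
      have t1: "\<tau> 1 = one_line L 1" using h i int by (auto simp: \<tau> swp_def)
      have t2: "\<tau> i = one_line L (Suc i)" using int by (simp add: \<tau> swp_def)
      have t3: "\<tau> (Suc i) = one_line L i" using int i by (simp add: \<tau> swp_def)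
      have "1 \<le> (1::nat) \<and> 1 < i \<and> i < Suc i \<and> Suc i \<le> n \<and> \<tau> 1 < \<tau> (Suc i) \<and> \<tau> (Suc i) < \<tau> i"
        using h i asc \<open>one_line L 1 < one_line L i\<close> unfolding t1 t2 t3 by auto
      then have "\<not> avoids132 n \<tau>" unfolding avoids132_def by blast
      then show False using av[of "Suc k"] k unfolding \<tau>_def by simp
    qed
    then have "addable i L" using i iL by (simp add: addable_def)
    then show ?case using k len o i by (simp add: ok_take_Suc i_def L_def)
  qed simp
  from this[of "NN n"] show ?thesis using len NN_eq[OF n] by (simp add: networks_def)
qed

lemma R132_eq: "n \<ge> 1 \<Longrightarrow> R132 n = networks (n - 1)"
  using networks_subset_R132 R132_subset_networks by blast

section \<open>Deterministic times\<close>

definition avg_at :: "nat \<Rightarrow> nat \<Rightarrow> (nat set \<Rightarrow> real) \<Rightarrow> real" where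
  "avg_at M m f = (\<Sum>w\<in>networks M. f (shape w m)) / card (networks M)"

lemma EE_avg_at: "EE M p f = (\<Sum>m\<le>\<Sum>{1..M}. Bernstein (\<Sum>{1..M}) m p * avg_at M m f)"
  by (simp add: EE_def avg_at_def)

lemma avg_at_mono2: "(\<And>w. w \<in> networks M \<Longrightarrow> f (shape w m) \<le> h (shape w k)) \<Longrightarrow> avg_at M m f \<le> avg_at M k h"
  unfolding avg_at_def by (intro divide_right_mono sum_mono) auto

lemma avg_at_nonneg: "(\<And>L. 0 \<le> f L) \<Longrightarrow> 0 \<le> avg_at M m f"
  unfolding avg_at_def by (intro divide_nonneg_nonneg sum_nonneg) auto

lemma avg_at_add: "avg_at M m (\<lambda>L. f L + h L) = avg_at M m f + avg_at M m h"
  unfolding avg_at_def by (simp add: sum.distrib add_divide_distrib)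

lemma avg_at_sum: "avg_at M m (\<lambda>L. \<Sum>i\<in>I. f i L) = (\<Sum>i\<in>I. avg_at M m (f i))"
  unfolding avg_at_def sum_divide_distrib[symmetric] by (subst sum.swap) simp

text \<open>Chebyshev's inequality for the binomial law, with the variance
  \<open>N * p * (1 - p)\<close> bounded by \<open>N\<close>.\<close>

lemma bernstein_tail:
  assumes N: "N \<ge> 1" and p: "0 \<le> p" "p \<le> 1" and d: "\<delta> > 0"
  shows "(\<Sum>k | k \<le> N \<and> \<delta> * real N \<le> \<bar>real k - real N * p\<bar>. Bernstein N k p) \<le> 1 / (real N * \<delta>\<^sup>2)"
proof -
  let ?T = "{k. k \<le> N \<and> \<delta> * real N \<le> \<bar>real k - real N * p\<bar>}"
  have var: "(\<Sum>k\<le>N. (real k - real N * p)\<^sup>2 * Bernstein N k p) = real N * p * (1 - p)"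
  proof -
    have "(\<Sum>k\<le>N. (real k - real N * p)\<^sup>2 * Bernstein N k p)
        = (\<Sum>k\<le>N. real k * (real k - 1) * Bernstein N k p + (1 - 2 * real N * p) * (real k * Bernstein N k p) + (real N * p)\<^sup>2 * Bernstein N k p)"
      by (intro sum.cong refl) (simp add: power2_eq_square algebra_simps)
    also have "\<dots> = real N * (real N - 1) * p\<^sup>2 + (1 - 2 * real N * p) * (real N * p) + (real N * p)\<^sup>2 * 1"
      unfolding sum.distrib sum_distrib_left[symmetric] by simp
    also have "\<dots> = real N * p * (1 - p)" by (simp add: power2_eq_square algebra_simps)
    finally show ?thesis .
  qed
  have dN: "(\<delta> * real N)\<^sup>2 > 0" using d N by simp
  have "(\<delta> * real N)\<^sup>2 * (\<Sum>k\<in>?T. Bernstein N k p) \<le> (\<Sum>k\<in>?T. (real k - real N * p)\<^sup>2 * Bernstein N k p)"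
    unfolding sum_distrib_left
  proof (intro sum_mono mult_right_mono)
    fix k assume "k \<in> ?T"
    then have "(\<delta> * real N)\<^sup>2 \<le> \<bar>real k - real N * p\<bar>\<^sup>2" using d by (intro power_mono) auto
    then show "(\<delta> * real N)\<^sup>2 \<le> (real k - real N * p)\<^sup>2" by simp
  qed (use p in \<open>simp add: Bernstein_nonneg\<close>)
  also have "\<dots> \<le> (\<Sum>k\<le>N. (real k - real N * p)\<^sup>2 * Bernstein N k p)"
    using p by (intro sum_mono2) (auto simp: Bernstein_nonneg)
  also have "\<dots> \<le> real N * 1"
  proof -
    have "p * (1 - p) \<le> 1 * 1" using p by (intro mult_mono) auto
    then show ?thesis unfolding var mult.assoc by (intro mult_left_mono) auto
  qed
  finally have "(\<Sum>k\<in>?T. Bernstein N k p) \<le> real N / (\<delta> * real N)\<^sup>2" using dN by (simp add: pos_le_divide_eq mult.commute)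
  also have "\<dots> = 1 / (real N * \<delta>\<^sup>2)" using N by (simp add: power2_eq_square)
  finally show ?thesis .
qed

text \<open>The binomial time lies in the window around \<open>N * p\<close> with probability at
  least 1/2, because \<open>N * \<delta>^2 \<ge> 2\<close>. If the average at \<open>m\<close> is at
  most that at every time in the window, half of it is at most the randomized average.\<close>

lemma depoissonize:
  assumes f: "\<And>L. 0 \<le> f L" and p: "0 \<le> p" "p \<le> 1" and d: "\<delta> > 0"
    and N: "\<Sum>{1..M} \<ge> 1" "2 \<le> real (\<Sum>{1..M}) * \<delta>\<^sup>2"
    and le: "\<And>k. k \<le> \<Sum>{1..M} \<Longrightarrow> \<bar>real k - real (\<Sum>{1..M}) * p\<bar> < \<delta> * real (\<Sum>{1..M}) \<Longrightarrow> avg_at M m f \<le> avg_at M k f"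
  shows "avg_at M m f \<le> 2 * EE M p f"
proof -
  define n where "n = \<Sum>{1..M}"
  let ?T = "{k. k \<le> n \<and> \<delta> * real n \<le> \<bar>real k - real n * p\<bar>}"
  have "(\<Sum>k\<in>?T. Bernstein n k p) \<le> 1 / (real n * \<delta>\<^sup>2)"
    using N p d unfolding n_def by (intro bernstein_tail) auto
  also have "\<dots> \<le> 1 / 2" using N(2) unfolding n_def by (intro divide_left_mono) auto
  finally have T: "(\<Sum>k\<in>?T. Bernstein n k p) \<le> 1 / 2" .
  have "{..n} = ({..n} - ?T) \<union> ?T" by auto
  then have "(\<Sum>k\<le>n. Bernstein n k p) = (\<Sum>k\<in>{..n} - ?T. Bernstein n k p) + (\<Sum>k\<in>?T. Bernstein n k p)"
    by (metis (no_types, lifting) Diff_disjoint Int_commute finite_Diff finite_atMost finite_subset inf_le2 sum.union_disjoint Un_upper2)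
  then have G: "(\<Sum>k\<in>{..n} - ?T. Bernstein n k p) \<ge> 1 / 2" using T by simp
  have "avg_at M m f * (1 / 2) \<le> avg_at M m f * (\<Sum>k\<in>{..n} - ?T. Bernstein n k p)"
    using G f by (intro mult_left_mono avg_at_nonneg) auto
  also have "\<dots> = (\<Sum>k\<in>{..n} - ?T. Bernstein n k p * avg_at M m f)" by (simp add: sum_distrib_left mult.commute)
  also have "\<dots> \<le> (\<Sum>k\<in>{..n} - ?T. Bernstein n k p * avg_at M k f)"
    using p by (intro sum_mono mult_left_mono le) (auto simp: n_def Bernstein_nonneg not_le)
  also have "\<dots> \<le> (\<Sum>k\<le>n. Bernstein n k p * avg_at M k f)"
    using p f by (intro sum_mono2) (auto simp: Bernstein_nonneg avg_at_nonneg)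
  also have "\<dots> = EE M p f" by (simp add: EE_avg_at n_def)
  finally show ?thesis by simp
qed

lemma parts_beyond_card:
  assumes "finite L"
  shows "parts_beyond n x L = real (card {y\<in>L. x < real y / real n})"
  using assms by (simp add: parts_beyond_def sum.If_cases Int_def)

text \<open>Each letter raises a part by one unit, so a count above a fixed threshold never falls;
  \<open>a\<close> is the least integer above \<open>x * n\<close>.\<close>

lemma parts_beyond_shape_mono:
  assumes w: "w \<in> networks M" and k: "k \<le> m" "m \<le> \<Sum>{1..M}" and n: "n \<ge> 1" and x: "x > 0"
  shows "parts_beyond n x (shape w k) \<le> parts_beyond n x (shape w m)"
  using k
proof (induction m rule: dec_induct)
  case base
  then show ?case by simp
next
  case (step j)
  have jl: "j < length w" using step w by (simp add: networks_def)
  define L where "L = shape w j"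
  define a where "a = nat \<lfloor>x * real n\<rfloor> + 1"
  have "x * real n \<ge> 0" using x by simp
  then have a: "real a - 1 \<le> x * real n" "x * real n < real a" unfolding a_def by linarith+
  have iff: "x < real y / real n \<longleftrightarrow> a \<le> y" for y
  proof -
    have "x < real y / real n \<longleftrightarrow> x * real n < real y" using n by (simp add: pos_less_divide_eq)
    also have "\<dots> \<longleftrightarrow> a \<le> y"
    proof
      assume "x * real n < real y"
      then have "real a < real y + 1" using a by linarith
      then show "a \<le> y" by simp
    next
      assume "a \<le> y"
      then have "real a \<le> real y" by simp
      then show "x * real n < real y" using a by linarith
    qed
    finally show ?thesis .
  qed
  have L: "L \<subseteq> {1..M}" "shape w (Suc j) \<subseteq> {1..M}" unfolding L_def by (rule shape_subset[OF w])+
  then have L': "finite L" "0 \<notin> L" "finite (shape w (Suc j))" by (auto intro: finite_subset)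
  have "ok M {} (take (Suc j) w)" using w ok_take_drop[of M "{}" w "Suc j"] by (simp add: networks_def)
  then have c: "addable (w ! j) L" using jl by (simp add: ok_take_Suc L_def)
  have "parts_beyond n x L \<le> parts_beyond n x (shape w (Suc j))"
    unfolding parts_beyond_card[OF L'(1)] parts_beyond_card[OF L'(3)] iff unfolding shape_Suc[OF jl] L_def[symmetric]
    using card_add_part[OF L'(1,2) c, of a] by (simp add: a_def)
  then show ?case using step by (simp add: L_def)
qed

lemma tendsto_sum_size: "\<forall>\<^sub>F n in sequentially. c \<le> real (\<Sum>{1..n-1})"
proof -
  obtain K :: nat where K: "c \<le> real K" using real_arch_simple by blast
  have "c \<le> real (\<Sum>{1..n-1})" if n: "n \<ge> K + 2" for n
  proof -
    have "n - 1 \<le> \<Sum>{1..n-1}" using n by (intro member_le_sum[of "n-1" "{1..n-1}" "\<lambda>x. x"]) auto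
    then have "K \<le> \<Sum>{1..n-1}" using n by linarith
    then have "real K \<le> real (\<Sum>{1..n-1})" by (rule of_nat_mono)
    then show ?thesis using K by linarith
  qed
  then show ?thesis unfolding eventually_sequentially by blast
qed

text \<open>Too many large parts at time \<open>\<alpha> * N\<close> persist at later times, too few
  were already present as a deficit earlier. Each one-sided event is compared with a binomial time
  on its proper side of \<open>\<alpha>\<close>, close enough that continuity of the profile in time
  costs only \<open>\<epsilon> / 2\<close>.\<close>

lemma fixed_time_prob_tendsto:
  assumes al: "0 < \<alpha>" "\<alpha> < 1" and x: "0 < x" "x \<le> 1" and e: "\<epsilon> > 0"
  shows "(\<lambda>n. avg_at (n - 1) (nat \<lfloor>\<alpha> * real (\<Sum>{1..n-1})\<rfloor>) (\<lambda>L. if \<bar>parts_beyond n x L / real n - profile (1 - 2 * \<alpha>) x\<bar> > \<epsilon> then 1 else 0)) \<longlonglongrightarrow> 0"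
proof -
  define N where "N = (\<lambda>n::nat. \<Sum>{1..n-1})"
  have Nn: "\<Sum>{1..n-1} = N n" for n by (simp only: N_def)
  define h where "h = (\<lambda>p. profile (1 - 2 * p) x)"
  define m where "m = (\<lambda>n. nat \<lfloor>\<alpha> * real (N n)\<rfloor>)"
  have mb: "real (m n) \<le> \<alpha> * real (N n)" "\<alpha> * real (N n) < real (m n) + 1" "m n \<le> N n" for n
  proof -
    have 0: "0 \<le> \<alpha> * real (N n)" using al by simp
    then show 1: "real (m n) \<le> \<alpha> * real (N n)" "\<alpha> * real (N n) < real (m n) + 1" unfolding m_def by linarith+
    have "\<alpha> * real (N n) \<le> 1 * real (N n)" using al by (intro mult_right_mono) auto
    then have "real (m n) \<le> real (N n)" using 1 by linarith
    then show "m n \<le> N n" by (simp only: of_nat_le_iff)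
  qed
  have c1: "isCont (\<lambda>p. 1 - 2 * p) \<alpha>" by (intro continuous_intros)
  have c2: "isCont (\<lambda>t. profile t x) (1 - 2 * \<alpha>)"
    using al x by (intro DERIV_isCont[OF DERIV_profile_param_all]) (auto simp: abs_less_iff)
  have "isCont h \<alpha>" unfolding h_def by (rule isCont_o2[OF c1 c2])
  then obtain s where s: "s > 0" "\<And>p. \<bar>p - \<alpha>\<bar> < s \<Longrightarrow> \<bar>h p - h \<alpha>\<bar> < \<epsilon> / 2"
    using e unfolding continuous_at_eps_delta dist_real_def by (metis half_gt_zero)
  have I: "(\<lambda>n. 2 * EE (n - 1) p (\<lambda>L. if \<bar>parts_beyond n x L / real n - h p\<bar> > \<epsilon> / 2 then 1 else 0)) \<longlonglongrightarrow> 0" if "0 < p" "p < 1" for p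
    unfolding h_def using that x e by (intro tendsto_mult_right_zero poisson_prob_tendsto) auto
  have up: "(\<lambda>n. avg_at (n - 1) (m n) (\<lambda>L. if parts_beyond n x L / real n > h \<alpha> + \<epsilon> then 1 else 0)) \<longlonglongrightarrow> 0"
  proof -
    \<comment> \<open>With \<open>p = \<alpha> + \<delta>\<close> the whole window of half-width
      \<open>\<delta> * N\<close> around \<open>p * N\<close> lies after
      \<open>\<alpha> * N\<close>.\<close>
    define \<delta> where "\<delta> = min (s / 2) ((1 - \<alpha>) / 2)"
    define p where "p = \<alpha> + \<delta>"
    have d: "\<delta> > 0" "\<delta> < s" "\<delta> < 1 - \<alpha>" using s(1) al by (auto simp: \<delta>_def min_def)
    have p: "0 < p" "p < 1" using d al by (auto simp: p_def)
    have hp: "\<bar>h p - h \<alpha>\<bar> < \<epsilon> / 2" using d by (intro s) (simp add: p_def)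
    have im: "\<epsilon> / 2 < \<bar>z - h p\<bar>" if "z > h \<alpha> + \<epsilon>" for z using hp that by linarith
    let ?f = "\<lambda>n L. if parts_beyond n x L / real n > h \<alpha> + \<epsilon> then 1 else 0 :: real"
    have "\<forall>\<^sub>F n in sequentially. norm (avg_at (n - 1) (m n) (?f n)) \<le> 2 * EE (n - 1) p (\<lambda>L. if \<bar>parts_beyond n x L / real n - h p\<bar> > \<epsilon> / 2 then 1 else 0)"
      using tendsto_sum_size[of "2 / \<delta>\<^sup>2", unfolded Nn] tendsto_sum_size[of 1, unfolded Nn] eventually_ge_at_top[of 1]
    proof eventually_elim
      case (elim n)
      have "avg_at (n - 1) (m n) (?f n) \<le> 2 * EE (n - 1) p (?f n)"
      proof (rule depoissonize[where \<delta> = \<delta> and M = "n - 1", unfolded Nn])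
        show "2 \<le> real (N n) * \<delta>\<^sup>2" using elim(1) d by (simp add: pos_divide_le_eq)
        fix k assume k: "k \<le> N n" "\<bar>real k - real (N n) * p\<bar> < \<delta> * real (N n)"
        then have "\<alpha> * real (N n) < real k" unfolding p_def by (simp add: algebra_simps abs_less_iff)
        then have mk: "m n \<le> k" using mb(1)[of n] by simp
        show "avg_at (n - 1) (m n) (?f n) \<le> avg_at (n - 1) k (?f n)"
        proof (rule avg_at_mono2)
          fix w assume w: "w \<in> networks (n - 1)"
          have "parts_beyond n x (shape w (m n)) \<le> parts_beyond n x (shape w k)" using w mk k elim x by (intro parts_beyond_shape_mono[where M = "n - 1", unfolded Nn]) auto
          then have "parts_beyond n x (shape w (m n)) / real n \<le> parts_beyond n x (shape w k) / real n" by (rule divide_right_mono) simp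
          then show "?f n (shape w (m n)) \<le> ?f n (shape w k)" by auto
        qed
      qed (use p d elim in auto)
      also have "\<dots> \<le> 2 * EE (n - 1) p (\<lambda>L. if \<bar>parts_beyond n x L / real n - h p\<bar> > \<epsilon> / 2 then 1 else 0)"
        using p im by (intro mult_left_mono EE_mono) auto
      finally show ?case using avg_at_nonneg[of "?f n" "n - 1" "m n"] by simp
    qed
    then show ?thesis by (rule Lim_null_comparison) (rule I[OF p])
  qed
  have down: "(\<lambda>n. avg_at (n - 1) (m n) (\<lambda>L. if parts_beyond n x L / real n < h \<alpha> - \<epsilon> then 1 else 0)) \<longlonglongrightarrow> 0"
  proof -
    \<comment> \<open>Here \<open>p = \<alpha> - 2 * \<delta>\<close>, so the window ends
      \<open>\<delta> * N\<close> before \<open>\<alpha> * N\<close>; this slack, at least 1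
      eventually, covers the rounding down of the time.\<close>
    define \<delta> where "\<delta> = min (s / 4) (\<alpha> / 4)"
    define p where "p = \<alpha> - 2 * \<delta>"
    have d: "\<delta> > 0" "2 * \<delta> < s" "2 * \<delta> < \<alpha>" using s(1) al by (auto simp: \<delta>_def min_def)
    have p: "0 < p" "p < 1" using d al by (auto simp: p_def)
    have hp: "\<bar>h p - h \<alpha>\<bar> < \<epsilon> / 2" using d by (intro s) (simp add: p_def)
    have im: "\<epsilon> / 2 < \<bar>z - h p\<bar>" if "z < h \<alpha> - \<epsilon>" for z using hp that by linarith
    let ?f = "\<lambda>n L. if parts_beyond n x L / real n < h \<alpha> - \<epsilon> then 1 else 0 :: real"
    have "\<forall>\<^sub>F n in sequentially. norm (avg_at (n - 1) (m n) (?f n)) \<le> 2 * EE (n - 1) p (\<lambda>L. if \<bar>parts_beyond n x L / real n - h p\<bar> > \<epsilon> / 2 then 1 else 0)"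
      using tendsto_sum_size[of "2 / \<delta>\<^sup>2", unfolded Nn] tendsto_sum_size[of "1 / \<delta>", unfolded Nn] tendsto_sum_size[of 1, unfolded Nn] eventually_ge_at_top[of 1]
    proof eventually_elim
      case (elim n)
      have "avg_at (n - 1) (m n) (?f n) \<le> 2 * EE (n - 1) p (?f n)"
      proof (rule depoissonize[where \<delta> = \<delta> and M = "n - 1", unfolded Nn])
        show "2 \<le> real (N n) * \<delta>\<^sup>2" using elim(1) d by (simp add: pos_divide_le_eq)
        have N1: "1 \<le> real (N n) * \<delta>" using elim(2) d by (simp add: pos_divide_le_eq)
        fix k assume k: "k \<le> N n" "\<bar>real k - real (N n) * p\<bar> < \<delta> * real (N n)"
        then have "real k < \<alpha> * real (N n) - real (N n) * \<delta>" unfolding p_def by (simp add: algebra_simps abs_less_iff)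
        then have "real k < real (m n)" using mb(2)[of n] N1 by linarith
        then have mk: "k \<le> m n" by simp
        show "avg_at (n - 1) (m n) (?f n) \<le> avg_at (n - 1) k (?f n)"
        proof (rule avg_at_mono2)
          fix w assume w: "w \<in> networks (n - 1)"
          have "parts_beyond n x (shape w k) \<le> parts_beyond n x (shape w (m n))" using w mk mb(3)[of n] elim x by (intro parts_beyond_shape_mono[where M = "n - 1", unfolded Nn]) auto
          then have "parts_beyond n x (shape w k) / real n \<le> parts_beyond n x (shape w (m n)) / real n" by (rule divide_right_mono) simp
          then show "?f n (shape w (m n)) \<le> ?f n (shape w k)" by auto
        qed
      qed (use p d elim in auto)
      also have "\<dots> \<le> 2 * EE (n - 1) p (\<lambda>L. if \<bar>parts_beyond n x L / real n - h p\<bar> > \<epsilon> / 2 then 1 else 0)"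
        using p im by (intro mult_left_mono EE_mono) auto
      finally show ?case using avg_at_nonneg[of "?f n" "n - 1" "m n"] by simp
    qed
    then show ?thesis by (rule Lim_null_comparison) (rule I[OF p])
  qed
  have sum0: "(\<lambda>n. avg_at (n - 1) (m n) (\<lambda>L. if parts_beyond n x L / real n > h \<alpha> + \<epsilon> then 1 else 0)
      + avg_at (n - 1) (m n) (\<lambda>L. if parts_beyond n x L / real n < h \<alpha> - \<epsilon> then 1 else 0)) \<longlonglongrightarrow> 0"
    using tendsto_add[OF up down] by simp
  have "norm (avg_at (n - 1) (m n) (\<lambda>L. if \<bar>parts_beyond n x L / real n - h \<alpha>\<bar> > \<epsilon> then 1 else 0)) \<le>
     avg_at (n - 1) (m n) (\<lambda>L. if parts_beyond n x L / real n > h \<alpha> + \<epsilon> then 1 else 0)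
      + avg_at (n - 1) (m n) (\<lambda>L. if parts_beyond n x L / real n < h \<alpha> - \<epsilon> then 1 else 0)" for n
  proof -
    have "avg_at (n - 1) (m n) (\<lambda>L. if \<bar>parts_beyond n x L / real n - h \<alpha>\<bar> > \<epsilon> then 1 else 0) \<le>
      avg_at (n - 1) (m n) (\<lambda>L. (if parts_beyond n x L / real n > h \<alpha> + \<epsilon> then 1 else 0) + (if parts_beyond n x L / real n < h \<alpha> - \<epsilon> then 1 else 0))"
      by (rule avg_at_mono2) (auto simp: abs_less_iff)
    moreover have "0 \<le> avg_at (n - 1) (m n) (\<lambda>L. if \<bar>parts_beyond n x L / real n - h \<alpha>\<bar> > \<epsilon> then 1 else 0)" by (rule avg_at_nonneg) simp
    ultimately show ?thesis unfolding avg_at_add by simp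
  qed
  then have "(\<lambda>n. avg_at (n - 1) (m n) (\<lambda>L. if \<bar>parts_beyond n x L / real n - h \<alpha>\<bar> > \<epsilon> then 1 else 0)) \<longlonglongrightarrow> 0"
    by (intro Lim_null_comparison[OF _ sum0] always_eventually allI)
  then show ?thesis by (simp only: m_def h_def N_def)
qed

section \<open>Comparison with the stated limit functions\<close>

definition paper_profile :: "real \<Rightarrow> real \<Rightarrow> real" where
  "paper_profile \<alpha> x = 1 / sqrt 2 * (gt \<alpha> (- x / sqrt 2) - x / sqrt 2)"

lemma profile_reflect:
  assumes "0 \<le> x" "x \<le> 1"
  shows "profile (- t) x = 1 - x - profile t x"
proof -
  have x: "\<bar>x\<bar> \<le> 1" using assms by simp
  have c: "clip x (- t) = - clip x t"
  proof -
    have "sqrt (1 - x\<^sup>2) \<ge> 0" using x by (simp add: abs_square_le_1)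
    then show ?thesis unfolding clip_def by linarith
  qed
  show ?thesis unfolding profile_def c
    using profile_args[OF x, of t] by (simp add: arcsin_minus field_simps)
qed

lemma gt_reflect: "0 \<le> \<alpha> \<Longrightarrow> \<alpha> \<le> 1 \<Longrightarrow> gt (1 - \<alpha>) u = sqrt 2 - gt \<alpha> u"
  by (auto simp: gt_def real_sqrt_divide field_simps)

text \<open>Put \<open>t = 1 - 2 * \<alpha>\<close> and \<open>u = - x / sqrt 2\<close>: then
  \<open>2 * \<alpha> * (1 - \<alpha>) = (1 - t^2) / 2\<close>, so the support of \<open>g\<close>
  is the curved region of \<open>profile\<close>. The second arctangent of \<open>g\<close> has the
  inverse argument and is turned over by \<open>arctan_inverse\<close>, which uses
  \<open>t > 0\<close>; hence the restriction to this half.\<close>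

lemma paper_profile_lower_half:
  assumes al: "0 < \<alpha>" "\<alpha> < 1/2" and x: "0 < x" "x \<le> 1"
  shows "paper_profile \<alpha> x = profile (1 - 2 * \<alpha>) x"
proof -
  define t where "t = 1 - 2 * \<alpha>"
  have t: "0 < t" "t < 1" using al by (auto simp: t_def)
  define u where "u = - x / sqrt 2"
  have u2: "u\<^sup>2 = x\<^sup>2 / 2" by (simp add: u_def power_divide)
  have au: "\<bar>u\<bar> = x / sqrt 2" using x by (simp add: u_def)
  have q: "2 * \<alpha> * (1 - \<alpha>) = (1 - t\<^sup>2) / 2" by (simp add: t_def power2_eq_square algebra_simps)
  have gu: "gt \<alpha> u = gt_low \<alpha> u" using al by (simp add: gt_def)
  have iff: "\<bar>u\<bar> < sqrt (2 * \<alpha> * (1 - \<alpha>)) \<longleftrightarrow> \<bar>t\<bar> < sqrt (1 - x\<^sup>2)"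
    unfolding abs_less_sqrt q u2 by auto
  show ?thesis
  proof (cases "\<bar>t\<bar> < sqrt (1 - x\<^sup>2)")
    case True
    define s where "s = sqrt (1 - t\<^sup>2 - x\<^sup>2)"
    have s2: "1 - t\<^sup>2 - x\<^sup>2 > 0" using True by (simp add: abs_less_sqrt)
    then have s0: "s > 0" by (simp add: s_def)
    have d: "2 * \<alpha> * (1 - \<alpha>) - u\<^sup>2 = (1 - t\<^sup>2 - x\<^sup>2) / 2" unfolding q u2 by (simp add: diff_divide_distrib)
    have e1: "sqrt (2 * \<alpha> * (1 - \<alpha>) - u\<^sup>2) = s / sqrt 2" unfolding d s_def by (rule real_sqrt_divide)
    have e2: "sqrt (2 * (2 * \<alpha> * (1 - \<alpha>) - u\<^sup>2)) = s" unfolding d s_def by simp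
    have a1: "(1 - 2 * \<alpha>) * u / (s / sqrt 2) = - (t * x / s)" by (simp add: u_def t_def)
    have a2: "arctan (s / t) = pi / 2 - arctan (t / s)"
    proof -
      have "0 < t / s" using t s0 by simp
      from arctan_inverse[OF this] show ?thesis by simp
    qed
    have "gt \<alpha> u = g \<alpha> u" using True iff gu by (simp add: gt_low_def)
    also have "\<dots> = 2 * u / pi * arctan (- (t * x / s)) + sqrt 2 / pi * (pi / 2 - arctan (t / s))"
      unfolding g_def e1 e2 a1 using a2 by (simp add: t_def)
    finally have G: "gt \<alpha> u = 2 * u / pi * arctan (- (t * x / s)) + sqrt 2 / pi * (pi / 2 - arctan (t / s))" .
    define r where "r = sqrt 2"
    have r: "r \<noteq> 0" "r * r = 2" by (auto simp: r_def)
    have alg: "1 / r * (2 * (- x / r) / P * (- A) + r / P * (P / 2 - B) - x / r) = x / P * A + 1 / 2 - 1 / P * B - x / 2"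
      if "P \<noteq> 0" for P A B
    proof -
      have "1 / r * (2 * (- x / r) / P * (- A) + r / P * (P / 2 - B) - x / r) = 2 * x * A / ((r * r) * P) + 1 / 2 - B / P - x / (r * r)"
        using r(1) that by (simp add: field_simps)
      then show ?thesis unfolding r(2) by simp
    qed
    have "paper_profile \<alpha> x = 1 / r * (gt \<alpha> u - x / r)" by (simp add: paper_profile_def u_def r_def)
    also have "\<dots> = 1 / r * (2 * (- x / r) / pi * (- arctan (t * x / s)) + r / pi * (pi / 2 - arctan (t / s)) - x / r)"
      unfolding G by (simp add: u_def r_def arctan_minus)
    also have "\<dots> = x / pi * arctan (t * x / s) + 1 / 2 - 1 / pi * arctan (t / s) - x / 2" by (rule alg) simp
    also have "\<dots> = profile t x" using profile_arctan[OF _ True] x by (simp add: s_def)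
    finally show ?thesis by (simp add: t_def)
  next
    case False
    then have "gt \<alpha> u = x / sqrt 2" using iff gu au by (simp add: gt_low_def)
    then have "paper_profile \<alpha> x = 0" by (simp add: paper_profile_def u_def)
    moreover have "profile t x = 0" using profile_saturated(1)[OF x, of t] False t by simp
    ultimately show ?thesis by (simp add: t_def)
  qed
qed

lemma paper_profile_reflect:
  assumes "0 \<le> \<alpha>" "\<alpha> \<le> 1"
  shows "paper_profile (1 - \<alpha>) x = 1 - x - paper_profile \<alpha> x"
proof -
  define r where "r = sqrt 2"
  have r: "r \<noteq> 0" "r * r = 2" by (auto simp: r_def)
  have "1 / r * (r - v - x / r) = 1 - x - 1 / r * (v - x / r)" for v
  proof -
    have "1 / r * (r - v - x / r) + 1 / r * (v - x / r) = 1 - 2 * x / (r * r)" using r(1) by (simp add: field_simps)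
    then show ?thesis unfolding r(2) by simp
  qed
  then show ?thesis unfolding paper_profile_def gt_reflect[OF assms] r_def[symmetric] .
qed

lemma paper_profile_eq_profile:
  assumes al: "0 < \<alpha>" "\<alpha> < 1" and x: "0 < x" "x \<le> 1"
  shows "paper_profile \<alpha> x = profile (1 - 2 * \<alpha>) x"
proof -
  consider "\<alpha> < 1/2" | "\<alpha> = 1/2" | "\<alpha> > 1/2" by linarith
  then show ?thesis
  proof cases
    case 1
    then show ?thesis using paper_profile_lower_half al x by blast
  next
    case 2
    then show ?thesis using x by (simp add: paper_profile_def gt_def profile_0 field_simps)
  next
    case 3
    have "paper_profile \<alpha> x = 1 - x - paper_profile (1 - \<alpha>) x" using paper_profile_reflect[of "1 - \<alpha>" x] al by simp
    also have "paper_profile (1 - \<alpha>) x = profile (1 - 2 * (1 - \<alpha>)) x" using 3 al x by (intro paper_profile_lower_half) auto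
    also have "1 - 2 * (1 - \<alpha>) = - (1 - 2 * \<alpha>)" by simp
    also have "1 - x - profile (- (1 - 2 * \<alpha>)) x = profile (1 - 2 * \<alpha>) x" using profile_reflect[of x "1 - 2 * \<alpha>"] x by simp
    finally show ?thesis .
  qed
qed

definition parts_from :: "nat \<Rightarrow> nat set \<Rightarrow> nat" where
  "parts_from j L = card {y\<in>L. j \<le> y}"

text \<open>Round \<open>j / n\<close> up to the next grid point \<open>i / K\<close>. This changes
  the profile by at most \<open>1 / K\<close>, and the normalized count by at most
  \<open>1 / K + 1 / n\<close>, since parts are distinct integers.\<close>

lemma grid_approx:
  assumes L: "finite L" and t: "\<bar>t\<bar> < 1" and j: "1 \<le> j" "j \<le> n" and K: "K \<ge> (1::nat)"
  shows "\<exists>i\<in>{1..K}. \<bar>real (parts_from j L) / real n - profile t (real j / real n)\<bar> \<le> \<bar>parts_beyond n (real i / real K) L / real n - profile t (real i / real K)\<bar> + 2 / real K + 1 / real n"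
proof -
  have n0: "real n > 0" using j by simp
  define v where "v = real j / real n"
  have v: "0 < v" "v \<le> 1" using j n0 by (auto simp: v_def)
  have K0: "real K > 0" using K by simp
  define i where "i = nat \<lceil>v * real K\<rceil>"
  have vK: "0 < v * real K" using v K0 by simp
  have i: "v * real K \<le> real i" "real i < v * real K + 1" unfolding i_def using vK by linarith+
  have "v * real K \<le> 1 * real K" using v K0 by (intro mult_right_mono) auto
  then have iK: "i \<in> {1..K}" unfolding i_def using vK by (auto simp: ceiling_le_iff nat_le_iff le_nat_iff)
  define x where "x = real i / real K"
  have x1: "v \<le> x" using i(1) K0 by (simp add: x_def pos_le_divide_eq)
  have x2: "x \<le> v + 1 / real K"
  proof -
    have "x \<le> (v * real K + 1) / real K" unfolding x_def using i(2) K0 by (intro divide_right_mono) auto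
    also have "\<dots> = v + 1 / real K" using K0 by (simp add: add_divide_distrib)
    finally show ?thesis .
  qed
  have x3: "x \<le> 1" using iK K0 by (simp add: x_def)
  have ge: "parts_beyond n x L \<le> real (parts_from j L)"
  proof -
    have "{y\<in>L. x < real y / real n} \<subseteq> {y\<in>L. j \<le> y}"
    proof
      fix y assume y: "y \<in> {y\<in>L. x < real y / real n}"
      then have "v < real y / real n" using x1 by simp
      then have "real j < real y" using n0 by (simp add: v_def divide_less_cancel)
      then show "y \<in> {y\<in>L. j \<le> y}" using y by simp
    qed
    then show ?thesis unfolding parts_beyond_card[OF L] parts_from_def using L by (simp add: card_mono)
  qed
  have le: "real (parts_from j L) \<le> parts_beyond n x L + (real n / real K + 1)"
  proof -
    define b where "b = nat \<lfloor>x * real n\<rfloor>"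
    have xn: "real j \<le> x * real n" using x1 n0 by (simp add: v_def pos_divide_le_eq)
    then have b: "real b \<le> x * real n" "x * real n < real b + 1" "j \<le> b" unfolding b_def by (auto simp: le_nat_floor)
    have "{y\<in>L. j \<le> y} \<subseteq> {y\<in>L. x < real y / real n} \<union> {j..b}"
    proof
      fix y assume y: "y \<in> {y\<in>L. j \<le> y}"
      show "y \<in> {y\<in>L. x < real y / real n} \<union> {j..b}"
      proof (cases "x < real y / real n")
        case False
        then have "real y \<le> x * real n" using n0 by (simp add: pos_divide_le_eq not_less)
        then have "real y < real b + 1" using b by linarith
        then show ?thesis using y by simp
      qed (use y in simp)
    qed
    then have "card {y\<in>L. j \<le> y} \<le> card ({y\<in>L. x < real y / real n} \<union> {j..b})" using L by (intro card_mono) auto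
    also have "\<dots> \<le> card {y\<in>L. x < real y / real n} + card {j..b}" by (rule card_Un_le)
    finally have "real (parts_from j L) \<le> parts_beyond n x L + real (Suc b - j)" unfolding parts_from_def parts_beyond_card[OF L] by simp
    also have "real (Suc b - j) = real b + 1 - real j" using b(3) by (simp add: of_nat_diff)
    also have "\<dots> \<le> real n / real K + 1"
    proof -
      have "x * real n \<le> (v + 1 / real K) * real n" using x2 n0 by (intro mult_right_mono) auto
      also have "\<dots> = real j + real n / real K" using n0 by (simp add: v_def algebra_simps)
      finally show ?thesis using b(1) by linarith
    qed
    finally show ?thesis by simp
  qed
  have "\<bar>real (parts_from j L) / real n - parts_beyond n x L / real n\<bar> \<le> 1 / real K + 1 / real n"
  proof -
    have "\<bar>real (parts_from j L) - parts_beyond n x L\<bar> / real n \<le> (real n / real K + 1) / real n"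
      using ge le n0 by (intro divide_right_mono) auto
    also have "\<dots> = 1 / real K + 1 / real n" using n0 by (simp add: add_divide_distrib)
    finally show ?thesis using n0 by (simp add: diff_divide_distrib[symmetric] abs_divide)
  qed
  moreover have "\<bar>profile t v - profile t x\<bar> \<le> 1 / real K"
    using profile_lipschitz[OF t, of v x] v x1 x2 x3 by simp
  ultimately have "\<bar>real (parts_from j L) / real n - profile t v\<bar> \<le> \<bar>parts_beyond n x L / real n - profile t x\<bar> + 2 / real K + 1 / real n"
    by (simp add: field_simps)
  then show ?thesis using iK unfolding v_def x_def by blast
qed

text \<open>A union bound over a fixed number \<open>K\<close> of grid points;
  \<open>grid_approx\<close> controls all \<open>j\<close> in between.\<close>

lemma uniform_prob_tendsto_interior:
  assumes al: "0 < \<alpha>" "\<alpha> < 1" and e: "\<epsilon> > 0"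
  shows "(\<lambda>n. avg_at (n - 1) (nat \<lfloor>\<alpha> * real (\<Sum>{1..n-1})\<rfloor>)
     (\<lambda>L. if \<exists>j\<in>{1..n}. \<bar>real (parts_from j L) / real n - paper_profile \<alpha> (real j / real n)\<bar> > \<epsilon> then 1 else 0)) \<longlonglongrightarrow> 0"
proof -
  define t where "t = 1 - 2 * \<alpha>"
  have t: "\<bar>t\<bar> < 1" using al by (auto simp: t_def abs_less_iff)
  define m where "m = (\<lambda>n. nat \<lfloor>\<alpha> * real (\<Sum>{1..n-1::nat})\<rfloor>)"
  \<comment> \<open>With \<open>8 / \<epsilon> < K\<close> the grid error \<open>2 / K\<close> is
    below \<open>\<epsilon> / 4\<close>; \<open>1 / n\<close> eventually takes another quarter,
    leaving \<open>\<epsilon> / 2\<close> at some grid point.\<close>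
  obtain K :: nat where K: "8 / \<epsilon> < real K" using reals_Archimedean2 by blast
  have "8 / \<epsilon> > 0" using e by simp
  then have "real K > 0" using K by linarith
  then have K1: "K \<ge> 1" "real K > 0" by auto
  have K2: "2 / real K < \<epsilon> / 4"
  proof -
    have "8 < real K * \<epsilon>" using K e by (simp add: pos_divide_less_eq)
    then show ?thesis using K1 by (simp add: field_simps)
  qed
  let ?f = "\<lambda>n L. if \<exists>j\<in>{1..n}. \<bar>real (parts_from j L) / real n - paper_profile \<alpha> (real j / real n)\<bar> > \<epsilon> then 1 else 0 :: real"
  let ?h = "\<lambda>n i L. if \<bar>parts_beyond n (real i / real K) L / real n - profile t (real i / real K)\<bar> > \<epsilon> / 2 then 1 else 0 :: real"
  have "(\<lambda>n. \<Sum>i\<in>{1..K}. avg_at (n - 1) (m n) (?h n i)) \<longlonglongrightarrow> (\<Sum>i\<in>{1..K}. 0)"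
    unfolding m_def t_def using al e K1 by (intro tendsto_sum fixed_time_prob_tendsto) auto
  then have lim: "(\<lambda>n. \<Sum>i\<in>{1..K}. avg_at (n - 1) (m n) (?h n i)) \<longlonglongrightarrow> 0" by simp
  have "\<forall>\<^sub>F n in sequentially. 1 / real n < \<epsilon> / 4" using e by (intro order_tendstoD(2)[OF lim_1_over_n]) simp
  then have "\<forall>\<^sub>F n in sequentially. norm (avg_at (n - 1) (m n) (?f n)) \<le> (\<Sum>i\<in>{1..K}. avg_at (n - 1) (m n) (?h n i))"
  proof eventually_elim
    case (elim n)
    have "avg_at (n - 1) (m n) (?f n) \<le> avg_at (n - 1) (m n) (\<lambda>L. \<Sum>i\<in>{1..K}. ?h n i L)"
    proof (rule avg_at_mono2)
      fix w assume w: "w \<in> networks (n - 1)"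
      define L where "L = shape w (m n)"
      have L: "finite L" using shape_subset[OF w, of "m n"] finite_subset unfolding L_def by blast
      have "?f n L \<le> (\<Sum>i\<in>{1..K}. ?h n i L)"
      proof (cases "\<exists>j\<in>{1..n}. \<bar>real (parts_from j L) / real n - paper_profile \<alpha> (real j / real n)\<bar> > \<epsilon>")
        case True
        then obtain j where j: "1 \<le> j" "j \<le> n" "\<bar>real (parts_from j L) / real n - paper_profile \<alpha> (real j / real n)\<bar> > \<epsilon>" by auto
        have "paper_profile \<alpha> (real j / real n) = profile t (real j / real n)" unfolding t_def using j al by (intro paper_profile_eq_profile) auto
        moreover obtain i where i: "i \<in> {1..K}" "\<bar>real (parts_from j L) / real n - profile t (real j / real n)\<bar> \<le> \<bar>parts_beyond n (real i / real K) L / real n - profile t (real i / real K)\<bar> + 2 / real K + 1 / real n"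
          using grid_approx[OF L t j(1,2) K1(1)] by blast
        ultimately have "\<bar>parts_beyond n (real i / real K) L / real n - profile t (real i / real K)\<bar> > \<epsilon> / 2" using j(3) K2 elim by linarith
        then have "1 \<le> ?h n i L" by simp
        also have "\<dots> \<le> (\<Sum>i\<in>{1..K}. ?h n i L)" using i(1) by (intro member_le_sum) auto
        finally show ?thesis by simp
      next
        case False
        then have "?f n L = 0" by (simp only: if_False)
        then show ?thesis by (simp add: sum_nonneg)
      qed
      then show "?f n (shape w (m n)) \<le> (\<Sum>i\<in>{1..K}. ?h n i (shape w (m n)))" unfolding L_def .
    qed
    also have "\<dots> = (\<Sum>i\<in>{1..K}. avg_at (n - 1) (m n) (?h n i))" by (rule avg_at_sum)
    finally show ?case using avg_at_nonneg[of "?f n" "n - 1" "m n"] by simp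
  qed
  then have "(\<lambda>n. avg_at (n - 1) (m n) (?f n)) \<longlonglongrightarrow> 0" using lim by (rule Lim_null_comparison)
  then show ?thesis by (simp only: m_def)
qed

text \<open>At \<open>\<alpha> = 0\<close> and \<open>\<alpha> = 1\<close> the gas degenerates, but
  the shape is deterministic, empty or all of \<open>{1..n-1}\<close>, and the count equals its
  limit exactly.\<close>

lemma uniform_prob_tendsto:
  assumes al: "0 \<le> \<alpha>" "\<alpha> \<le> 1" and e: "\<epsilon> > 0"
  shows "(\<lambda>n. avg_at (n - 1) (nat \<lfloor>\<alpha> * real (\<Sum>{1..n-1})\<rfloor>)
     (\<lambda>L. if \<exists>j\<in>{1..n}. \<bar>real (parts_from j L) / real n - paper_profile \<alpha> (real j / real n)\<bar> > \<epsilon> then 1 else 0)) \<longlonglongrightarrow> 0"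
proof -
  let ?m = "\<lambda>n. nat \<lfloor>\<alpha> * real (\<Sum>{1..n-1::nat})\<rfloor>"
  have exact: ?thesis
    if ex: "\<And>n w j. w \<in> networks (n - 1) \<Longrightarrow> 1 \<le> j \<Longrightarrow> j \<le> n \<Longrightarrow> real (parts_from j (shape w (?m n))) / real n = paper_profile \<alpha> (real j / real n)"
  proof -
    have "avg_at (n - 1) (?m n) (\<lambda>L. if \<exists>j\<in>{1..n}. \<bar>real (parts_from j L) / real n - paper_profile \<alpha> (real j / real n)\<bar> > \<epsilon> then 1 else 0) = 0" for n
    proof -
      have "\<not> (\<exists>j\<in>{1..n}. \<bar>real (parts_from j (shape w (?m n))) / real n - paper_profile \<alpha> (real j / real n)\<bar> > \<epsilon>)" if w: "w \<in> networks (n - 1)" for w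
      proof
        assume "\<exists>j\<in>{1..n}. \<bar>real (parts_from j (shape w (?m n))) / real n - paper_profile \<alpha> (real j / real n)\<bar> > \<epsilon>"
        then obtain j where j: "1 \<le> j" "j \<le> n" "\<bar>real (parts_from j (shape w (?m n))) / real n - paper_profile \<alpha> (real j / real n)\<bar> > \<epsilon>" by auto
        then show False using ex[OF w j(1,2)] e by linarith
      qed
      then show ?thesis unfolding avg_at_def by (simp only: if_False sum.neutral_const div_0 cong: sum.cong)
    qed
    then show ?thesis by (simp only: tendsto_const)
  qed
  consider "\<alpha> = 0" | "\<alpha> = 1" | "0 < \<alpha>" "\<alpha> < 1" using al by linarith
  then show ?thesis
  proof cases
    case 1
    show ?thesis
    proof (rule exact)
      fix n w j assume "w \<in> networks (n - 1)" "1 \<le> j" "j \<le> (n::nat)"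
      then show "real (parts_from j (shape w (?m n))) / real n = paper_profile \<alpha> (real j / real n)"
        by (simp add: 1 shape_0 parts_from_def paper_profile_def gt_def)
    qed
  next
    case 2
    show ?thesis
    proof (rule exact)
      fix n w j assume w: "w \<in> networks (n - 1)" and j: "1 \<le> j" "j \<le> (n::nat)"
      have m: "?m n = \<Sum>{1..n-1}" by (simp only: 2 mult_1_left floor_of_nat nat_int)
      have "shape w (?m n) = {1..n-1}" unfolding m
        using sum_shape[OF w le_refl] by (intro full_set shape_subset[OF w])
      moreover have "{y\<in>{1..n-1}. j \<le> y} = {j..n-1}" using j by auto
      ultimately have "parts_from j (shape w (?m n)) = n - j" using j by (simp add: parts_from_def)
      then have "real (parts_from j (shape w (?m n))) / real n = 1 - real j / real n" using j by (simp add: of_nat_diff diff_divide_distrib)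
      also have "paper_profile 1 (real j / real n) = 1 - real j / real n"
        using paper_profile_reflect[of 0 "real j / real n"] by (simp add: paper_profile_def gt_def)
      then have "1 - real j / real n = paper_profile \<alpha> (real j / real n)" by (simp add: 2)
      finally show "real (parts_from j (shape w (?m n))) / real n = paper_profile \<alpha> (real j / real n)" .
    qed
  next
    case 3
    then show ?thesis using e by (rule uniform_prob_tendsto_interior)
  qed
qed

lemma Pn_le_avg_at:
  assumes n: "n \<ge> 1" and P: "\<And>w. w \<in> networks (n - 1) \<Longrightarrow> P w \<Longrightarrow> Q (shape w m)"
  shows "Pn n P \<le> avg_at (n - 1) m (\<lambda>L. if Q L then 1 else 0)"
proof -
  have "real (card {w \<in> networks (n - 1). P w}) = (\<Sum>w\<in>networks (n - 1). if P w then 1 else 0)"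
    using finite_networks by (simp add: sum.If_cases Int_def)
  also have "\<dots> \<le> (\<Sum>w\<in>networks (n - 1). if Q (shape w m) then 1 else 0)" using P by (intro sum_mono) auto
  finally show ?thesis unfolding Pn_def avg_at_def R132_eq[OF n] by (intro divide_right_mono) auto
qed

text \<open>The threshold is halved so that an event may differ from the deviation of the count by
  the offset \<open>1 / n\<close> between entries and counts.\<close>

lemma Pn_tendsto_zero:
  assumes al: "0 \<le> \<alpha>" "\<alpha> \<le> 1" and e: "\<epsilon> > 0"
    and P: "\<And>n w. n \<ge> 1 \<Longrightarrow> 1 / real n \<le> \<epsilon> / 2 \<Longrightarrow> w \<in> networks (n - 1) \<Longrightarrow> P n w \<Longrightarrow>
        \<exists>j\<in>{1..n}. \<bar>real (parts_from j (shape w (nat \<lfloor>\<alpha> * real (NN n)\<rfloor>))) / real n - paper_profile \<alpha> (real j / real n)\<bar> > \<epsilon> / 2"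
  shows "(\<lambda>n. Pn n (P n)) \<longlonglongrightarrow> 0"
proof -
  let ?B = "\<lambda>n. avg_at (n - 1) (nat \<lfloor>\<alpha> * real (\<Sum>{1..n-1})\<rfloor>)
     (\<lambda>L. if \<exists>j\<in>{1..n}. \<bar>real (parts_from j L) / real n - paper_profile \<alpha> (real j / real n)\<bar> > \<epsilon> / 2 then 1 else 0)"
  have lim: "?B \<longlonglongrightarrow> 0" using al e by (intro uniform_prob_tendsto) auto
  have "\<forall>\<^sub>F n in sequentially. 1 / real n < \<epsilon> / 2" using e by (intro order_tendstoD(2)[OF lim_1_over_n]) simp
  then have "\<forall>\<^sub>F n in sequentially. norm (Pn n (P n)) \<le> ?B n"
    using eventually_ge_at_top[of 1]
  proof eventually_elim
    case (elim n)
    have "Pn n (P n) \<le> ?B n"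
      unfolding NN_eq[OF elim(2), symmetric] using elim P by (intro Pn_le_avg_at) auto
    moreover have "0 \<le> Pn n (P n)" by (simp add: Pn_def)
    ultimately show ?case by simp
  qed
  then show ?thesis using lim by (rule Lim_null_comparison)
qed

theorem mainTheorem6:
  fixes \<alpha> \<epsilon> :: real
  assumes "0 \<le> \<alpha>" and "\<alpha> \<le> 1" and "\<epsilon> > 0"
  shows "((\<lambda>n. Pn n (\<lambda>w. \<exists>j\<in>Jw n w \<alpha>.
            \<bar>real (inter w (nat \<lfloor>\<alpha> * real (NN n)\<rfloor>) j) / real n
              - 1 / sqrt 2 * (gt \<alpha> (- real j / (real n * sqrt 2)) - real j / (real n * sqrt 2))\<bar> > \<epsilon>))
          \<longlonglongrightarrow> 0) \<and>
         ((\<lambda>n. Pn n (\<lambda>w. \<exists>j\<in>Jcw n w \<alpha>.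
            \<bar>real (inter w (nat \<lfloor>\<alpha> * real (NN n)\<rfloor>) j) / real n
              + 1 / sqrt 2 * (gt (1 - \<alpha>) (- real j / (real n * sqrt 2)) - real j / (real n * sqrt 2))
              - 1\<bar> > \<epsilon>))
          \<longlonglongrightarrow> 0)"
proof -
  have H: "1 / sqrt 2 * (gt \<alpha> (- real j / (real n * sqrt 2)) - real j / (real n * sqrt 2)) = paper_profile \<alpha> (real j / real n)" for j n
    by (simp add: paper_profile_def)
  have H': "1 / sqrt 2 * (gt (1 - \<alpha>) (- real j / (real n * sqrt 2)) - real j / (real n * sqrt 2)) = paper_profile (1 - \<alpha>) (real j / real n)" for j n
    by (simp add: paper_profile_def)
  \<comment> \<open>For \<open>j > 1\<close> in \<open>J\<close> the entry is the rank of the part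
    \<open>j - 1\<close>, which counts that part besides those \<open>\<ge> j\<close>; at
    \<open>j = 1\<close> the entry is one above all ranks. Both give the \<open>+ 1\<close>. Outside
    \<open>J\<close> no part sits at position \<open>j\<close>.\<close>
  have perm: "(j \<in> Jw n w \<alpha> \<longrightarrow> inter w (nat \<lfloor>\<alpha> * real (NN n)\<rfloor>) j = parts_from j (shape w (nat \<lfloor>\<alpha> * real (NN n)\<rfloor>)) + 1) \<and>
      (j \<in> Jcw n w \<alpha> \<longrightarrow> inter w (nat \<lfloor>\<alpha> * real (NN n)\<rfloor>) j = j + parts_from j (shape w (nat \<lfloor>\<alpha> * real (NN n)\<rfloor>)))"
    if n: "n \<ge> 1" and w: "w \<in> networks (n - 1)" and j: "j \<in> {1..n}" for n w j
  proof -
    define m where "m = nat \<lfloor>\<alpha> * real (NN n)\<rfloor>"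
    define L where "L = shape w m"
    have "\<alpha> * real (NN n) \<le> 1 * real (NN n)" using assms by (intro mult_right_mono) auto
    then have "m \<le> NN n" unfolding m_def by linarith
    then have ml: "m \<le> length w" using w NN_eq[OF n] by (simp add: networks_def)
    have "ok (n - 1) {} (take m w)" using w ok_take_drop[of "n - 1" "{}" w m] by (simp add: networks_def)
    then have s: "inter w m k = one_line L k" if "k \<ge> 1" for k
      using inter_eq_one_line ml that unfolding L_def by blast
    have "L \<subseteq> {1..n-1}" unfolding L_def by (rule shape_subset[OF w])
    then have L: "finite L" "0 \<notin> L" by (auto intro: finite_subset)
    have J: "j \<in> Jw n w \<alpha> \<longleftrightarrow> one_line L j \<le> one_line L 1" using j s by (simp add: Jw_def Let_def flip: m_def)
    have Jc: "j \<in> Jcw n w \<alpha> \<longleftrightarrow> \<not> one_line L j \<le> one_line L 1" using j J by (simp add: Jcw_def)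
    have "one_line L j = parts_from j L + 1" if "one_line L j \<le> one_line L 1"
    proof (cases "j = 1")
      case True
      then show ?thesis using L by (simp add: one_line_def parts_from_def)
    next
      case False
      have "j - 1 \<in> L"
      proof (rule ccontr)
        assume "j - 1 \<notin> L"
        then have "one_line L 1 < one_line L j" using L j False by (intro one_line_other_mono) auto
        then show False using that by simp
      qed
      then show ?thesis using card_split_at[OF L(1), of "j - 1"] j by (simp add: one_line_def parts_from_def)
    qed
    moreover have "one_line L j = j + parts_from j L" if "\<not> one_line L j \<le> one_line L 1"
    proof -
      have "card L < one_line L 1" using L by (intro one_line_other_ge) auto
      then have "j - 1 \<notin> L" using one_line_part_le[OF L(1), of j] that by linarith
      then show ?thesis by (simp add: one_line_def parts_from_def)
    qed
    ultimately show ?thesis using j s[of j] unfolding m_def[symmetric] L_def[symmetric] J Jc by auto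
  qed
  have sub: "Jw n w \<alpha> \<subseteq> {1..n}" "Jcw n w \<alpha> \<subseteq> {1..n}" for n w
    by (auto simp: Jw_def Jcw_def Let_def)
  show ?thesis unfolding H H'
  proof (intro conjI Pn_tendsto_zero[OF assms])
    fix n w
    assume n: "n \<ge> 1" "1 / real n \<le> \<epsilon> / 2" and w: "w \<in> networks (n - 1)"
      and "\<exists>j\<in>Jw n w \<alpha>. \<bar>real (inter w (nat \<lfloor>\<alpha> * real (NN n)\<rfloor>) j) / real n - paper_profile \<alpha> (real j / real n)\<bar> > \<epsilon>"
    then obtain j where j: "j \<in> Jw n w \<alpha>" "\<bar>real (inter w (nat \<lfloor>\<alpha> * real (NN n)\<rfloor>) j) / real n - paper_profile \<alpha> (real j / real n)\<bar> > \<epsilon>" by blast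
    have jn: "j \<in> {1..n}" using j sub by blast
    have "inter w (nat \<lfloor>\<alpha> * real (NN n)\<rfloor>) j = parts_from j (shape w (nat \<lfloor>\<alpha> * real (NN n)\<rfloor>)) + 1"
      using perm[OF n(1) w jn] j by blast
    then have "real (inter w (nat \<lfloor>\<alpha> * real (NN n)\<rfloor>) j) / real n = real (parts_from j (shape w (nat \<lfloor>\<alpha> * real (NN n)\<rfloor>))) / real n + 1 / real n"
      by (simp add: add_divide_distrib)
    then have "\<bar>real (parts_from j (shape w (nat \<lfloor>\<alpha> * real (NN n)\<rfloor>))) / real n - paper_profile \<alpha> (real j / real n)\<bar> > \<epsilon> / 2"
      using j(2) n(2) zero_le_divide_1_iff[of "real n"] by linarith
    then show "\<exists>j\<in>{1..n}. \<bar>real (parts_from j (shape w (nat \<lfloor>\<alpha> * real (NN n)\<rfloor>))) / real n - paper_profile \<alpha> (real j / real n)\<bar> > \<epsilon> / 2"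
      using jn by blast
  next
    fix n w
    assume n: "n \<ge> 1" "1 / real n \<le> \<epsilon> / 2" and w: "w \<in> networks (n - 1)"
      and "\<exists>j\<in>Jcw n w \<alpha>. \<bar>real (inter w (nat \<lfloor>\<alpha> * real (NN n)\<rfloor>) j) / real n + paper_profile (1 - \<alpha>) (real j / real n) - 1\<bar> > \<epsilon>"
    then obtain j where j: "j \<in> Jcw n w \<alpha>" "\<bar>real (inter w (nat \<lfloor>\<alpha> * real (NN n)\<rfloor>) j) / real n + paper_profile (1 - \<alpha>) (real j / real n) - 1\<bar> > \<epsilon>" by blast
    have jn: "j \<in> {1..n}" using j sub by blast
    have "inter w (nat \<lfloor>\<alpha> * real (NN n)\<rfloor>) j = j + parts_from j (shape w (nat \<lfloor>\<alpha> * real (NN n)\<rfloor>))"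
      using perm[OF n(1) w jn] j by blast
    then have "real (inter w (nat \<lfloor>\<alpha> * real (NN n)\<rfloor>) j) / real n = real j / real n + real (parts_from j (shape w (nat \<lfloor>\<alpha> * real (NN n)\<rfloor>))) / real n"
      by (simp add: add_divide_distrib)
    \<comment> \<open>Reflection cancels \<open>1 - j / n\<close>, so the second event states the
      same deviation of the count as the first, without any offset.\<close>
    moreover have "paper_profile (1 - \<alpha>) (real j / real n) = 1 - real j / real n - paper_profile \<alpha> (real j / real n)" by (rule paper_profile_reflect[OF assms(1,2)])
    ultimately have "\<bar>real (parts_from j (shape w (nat \<lfloor>\<alpha> * real (NN n)\<rfloor>))) / real n - paper_profile \<alpha> (real j / real n)\<bar> > \<epsilon> / 2"
      using j(2) assms(3) by linarith
    then show "\<exists>j\<in>{1..n}. \<bar>real (parts_from j (shape w (nat \<lfloor>\<alpha> * real (NN n)\<rfloor>))) / real n - paper_profile \<alpha> (real j / real n)\<bar> > \<epsilon> / 2"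
      using jn by blast
  qed
qed

end
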